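(* Let $d\ge7$ be prime, $n\ge1$, $\alpha\in[1/2,+\infty]$, and $\Lambda$ an $n$-qudit quantum channel. Then $H_\alpha(\mathcal M(\Lambda))\ge H_\alpha(\Lambda)$.
   Context: Fix a prime $d$; $\chi(k)=e^{2\pi ik/d}$, $X|k\rangle=|k+1\rangle$, $Z|k\rangle=\chi(k)|k\rangle$ on $\mathbb C^d$; Weyl operators $w(p,q)=\chi(-2^{-1}pq)Z^pX^q$ (odd $d$), $w(\vec p,\vec q)=\bigotimes_kw(p_k,q_k)$; characteristic function $\Xi_\rho(\vec x)=\mathrm{Tr}[\rho\,w(-\vec x)]$ for states on any number of qudits. The mean state $\mathcal M(\rho)$ has $\Xi_{\mathcal M(\rho)}(\vec x)=\Xi_\rho(\vec x)$ if $|\Xi_\rho(\vec x)|=1$ and $0$ otherwise. The Choi state of an $n$-qudit channel $\Lambda$ is $J_\Lambda=(\mathrm{id}_A\otimes\Lambda)(|\Phi\rangle\langle\Phi|)$, $|\Phi\rangle=d^{-n/2}\sum_{\vec j}|\vec j\rangle_A|\vec j\rangle_{A'}$. The mean channel $\mathcal M(\Lambda)$ is the channel with Choi state $\mathcal M(J_\Lambda)$ (which is again a valid Choi state). Let $\mathcal R(\rho)=\mathrm{Tr}[\rho]I_n/d^n$. With $D_\alpha$ the sandwiched Rényi relative entropy $D_\alpha(\rho\|\sigma)=\frac1{\alpha-1}\log\mathrm{Tr}[(\sigma^{\frac{1-\alpha}{2\alpha}}\rho\sigma^{\frac{1-\alpha}{2\alpha}})^\alpha]$, define $D_\alpha(\Lambda\|\mathcal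 R)=\sup_{\rho_{AR}}D_\alpha((\Lambda\otimes\mathrm{id}_R)(\rho_{AR})\|(\mathcal R\otimes\mathrm{id}_R)(\rho_{AR}))$ over all ancillas $R$ and states $\rho_{AR}$, and the channel Rényi entropy $H_\alpha(\Lambda)=n\log d-D_\alpha(\Lambda\|\mathcal R)$. *)

theory Defs
  imports "Jordan_Normal_Form.Matrix" "HOL-Library.Extended_Real"
begin

definition mtrace :: "complex mat \<Rightarrow> complex" where
  "mtrace A = (\<Sum>i<dim_row A. A $$ (i, i))"

definition adj :: "complex mat \<Rightarrow> complex mat" where
  "adj A = mat (dim_col A) (dim_row A) (\<lambda>(i, j). cnj (A $$ (j, i)))"

definition hermitian :: "nat \<Rightarrow> complex mat \<Rightarrow> bool" where
  "hermitian N A \<longleftrightarrow> A \<in> carrier_mat N N \<and> adj A = A"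

definition unitary :: "nat \<Rightarrow> complex mat \<Rightarrow> bool" where
  "unitary N U \<longleftrightarrow> U \<in> carrier_mat N N \<and> U * adj U = 1\<^sub>m N \<and> adj U * U = 1\<^sub>m N"

definition psd :: "nat \<Rightarrow> complex mat \<Rightarrow> bool" where
  "psd N A \<longleftrightarrow> hermitian N A \<and>
     (\<forall>v \<in> carrier_vec N. 0 \<le> Re (conjugate v \<bullet> (A *\<^sub>v v)))"

definition density :: "nat \<Rightarrow> complex mat \<Rightarrow> bool" where
  "density N \<rho> \<longleftrightarrow> psd N \<rho> \<and> mtrace \<rho> = 1"

text \<open>Functional calculus for Hermitian matrices: A = U diag(lam) U^*, f(A) = U diag(f lam) U^*.
  (Well defined independently of the chosen diagonalisation.)\<close>
definition diag_of :: "nat \<Rightarrow> (nat \<Rightarrow> real) \<Rightarrow> complex mat" where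
  "diag_of N lam = mat N N (\<lambda>(i, j). if i = j then complex_of_real (lam i) else 0)"

definition mat_fun :: "(real \<Rightarrow> real) \<Rightarrow> complex mat \<Rightarrow> complex mat" where
  "mat_fun f A = (let N = dim_row A;
      (U, lam) = (SOME (U, lam). unitary N U \<and> A = U * diag_of N lam * adj U)
    in U * diag_of N (\<lambda>i. f (lam i)) * adj U)"

text \<open>real powers, with the generalised-inverse convention on the kernel (0 \<mapsto> 0)\<close>
definition mat_powr :: "complex mat \<Rightarrow> real \<Rightarrow> complex mat" where
  "mat_powr A p = mat_fun (\<lambda>x. if x > 0 then x powr p else 0) A"

definition mat_ln :: "complex mat \<Rightarrow> complex mat" where
  "mat_ln A = mat_fun (\<lambda>x. if x > 0 then ln x else 0) A"

text \<open>support inclusion supp rho \<subseteq> supp sigma, i.e. ker sigma \<subseteq> ker rho\<close>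
definition supp_le :: "nat \<Rightarrow> complex mat \<Rightarrow> complex mat \<Rightarrow> bool" where
  "supp_le N \<rho> \<sigma> \<longleftrightarrow> (\<forall>v \<in> carrier_vec N. \<sigma> *\<^sub>v v = 0\<^sub>v N \<longrightarrow> \<rho> *\<^sub>v v = 0\<^sub>v N)"

text \<open>For alpha = 1 the (Umegaki) limit, for alpha = infinity the max-relative entropy limit.
  Logarithms are natural logarithms (the base is irrelevant for the statement).\<close>
definition sandwiched_renyi :: "nat \<Rightarrow> ereal \<Rightarrow> complex mat \<Rightarrow> complex mat \<Rightarrow> ereal" where
  "sandwiched_renyi N \<alpha> \<rho> \<sigma> =
    (if \<alpha> = \<infinity> then
       (if supp_le N \<rho> \<sigma>
        then ereal (ln (Inf {c :: real. c > 0 \<and> psd N (complex_of_real c \<cdot>\<^sub>m \<sigma> - \<rho>)}))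
        else \<infinity>)
     else if \<alpha> = 1 then
       (if supp_le N \<rho> \<sigma>
        then ereal (Re (mtrace (\<rho> * (mat_ln \<rho> - mat_ln \<sigma>))))
        else \<infinity>)
     else
       (let a = real_of_ereal \<alpha>; s = (1 - a) / (2 * a); S = mat_powr \<sigma> s in
        if a > 1 \<and> \<not> supp_le N \<rho> \<sigma> then \<infinity>
        else ereal (ln (Re (mtrace (mat_powr (S * \<rho> * S) a))) / (a - 1))))"

text \<open>(Phi \<otimes> id_R)(X) for a map Phi on N x N matrices and an ancilla of dimension m;
  basis of A \<otimes> R is indexed by a * m + r.\<close>
definition tensor_id :: "nat \<Rightarrow> nat \<Rightarrow> (complex mat \<Rightarrow> complex mat) \<Rightarrow> complex mat \<Rightarrow> complex mat" where
  "tensor_id N m \<Phi> X = mat (N * m) (N * m) (\<lambda>(i, j).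
      \<Phi> (mat N N (\<lambda>(a, b). X $$ (a * m + i mod m, b * m + j mod m))) $$ (i div m, j div m))"

text \<open>(id_A \<otimes> Phi)(X), with A of dimension N first; basis indexed by a * N + a'.\<close>
definition id_tensor :: "nat \<Rightarrow> (complex mat \<Rightarrow> complex mat) \<Rightarrow> complex mat \<Rightarrow> complex mat" where
  "id_tensor N \<Phi> X = mat (N * N) (N * N) (\<lambda>(i, j).
      \<Phi> (mat N N (\<lambda>(a, b). X $$ ((i div N) * N + a, (j div N) * N + b))) $$ (i mod N, j mod N))"

definition is_channel :: "nat \<Rightarrow> (complex mat \<Rightarrow> complex mat) \<Rightarrow> bool" where
  "is_channel N \<Lambda> \<longleftrightarrow>
     (\<forall>X \<in> carrier_mat N N. \<Lambda> X \<in> carrier_mat N N) \<and>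
     (\<forall>X \<in> carrier_mat N N. \<forall>Y \<in> carrier_mat N N. \<Lambda> (X + Y) = \<Lambda> X + \<Lambda> Y) \<and>
     (\<forall>X \<in> carrier_mat N N. \<forall>c. \<Lambda> (c \<cdot>\<^sub>m X) = c \<cdot>\<^sub>m \<Lambda> X) \<and>
     (\<forall>X \<in> carrier_mat N N. mtrace (\<Lambda> X) = mtrace X) \<and>
     (\<forall>m > 0. \<forall>X. psd (N * m) X \<longrightarrow> psd (N * m) (tensor_id N m \<Lambda> X))"

definition max_ent :: "nat \<Rightarrow> complex mat" where
  "max_ent N = mat (N * N) (N * N) (\<lambda>(i, j).
      if i div N = i mod N \<and> j div N = j mod N then 1 / of_nat N else 0)"

definition choi :: "nat \<Rightarrow> (complex mat \<Rightarrow> complex mat) \<Rightarrow> complex mat" where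
  "choi N \<Lambda> = id_tensor N \<Lambda> (max_ent N)"

definition depol :: "nat \<Rightarrow> complex mat \<Rightarrow> complex mat" where
  "depol N \<rho> = (mtrace \<rho> / of_nat N) \<cdot>\<^sub>m 1\<^sub>m N"

definition chi :: "nat \<Rightarrow> int \<Rightarrow> complex" where
  "chi d k = exp (2 * pi * \<i> * of_int k / of_nat d)"

text \<open>2^{-1} modulo the odd prime d\<close>
definition inv2 :: "nat \<Rightarrow> int" where
  "inv2 d = (int d + 1) div 2"

text \<open>single-qudit Weyl operator w(p,q) = chi(-2^{-1} p q) Z^p X^q; its (i,j) entry is
  [i = j + q mod d] chi(-2^{-1} p q) chi(p i)\<close>
definition weyl1 :: "nat \<Rightarrow> int \<Rightarrow> int \<Rightarrow> complex mat" where
  "weyl1 d p q = mat d d (\<lambda>(i, j).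
     if int i mod int d = (int j + q) mod int d
     then chi d (- inv2 d * p * q) * chi d (p * int i) else 0)"

text \<open>k-th qudit digit of a basis index of m qudits (qudit 0 is the leftmost tensor factor)\<close>
definition digit :: "nat \<Rightarrow> nat \<Rightarrow> nat \<Rightarrow> nat \<Rightarrow> nat" where
  "digit d m k i = (i div d ^ (m - 1 - k)) mod d"

text \<open>m-qudit Weyl operator w(p,q) = \<Otimes>_k w(p_k, q_k)\<close>
definition weyl :: "nat \<Rightarrow> nat \<Rightarrow> (nat \<Rightarrow> int) \<Rightarrow> (nat \<Rightarrow> int) \<Rightarrow> complex mat" where
  "weyl d m p q = mat (d ^ m) (d ^ m) (\<lambda>(i, j).
     \<Prod>k<m. weyl1 d (p k) (q k) $$ (digit d m k i, digit d m k j))"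

definition charfun :: "nat \<Rightarrow> nat \<Rightarrow> complex mat \<Rightarrow> (nat \<Rightarrow> int) \<Rightarrow> (nat \<Rightarrow> int) \<Rightarrow> complex" where
  "charfun d m \<rho> p q = mtrace (\<rho> * weyl d m (\<lambda>k. - p k) (\<lambda>k. - q k))"

definition mean_state :: "nat \<Rightarrow> nat \<Rightarrow> complex mat \<Rightarrow> complex mat" where
  "mean_state d m \<rho> = (THE \<sigma>. \<sigma> \<in> carrier_mat (d ^ m) (d ^ m) \<and>
     (\<forall>p q. charfun d m \<sigma> p q =
        (if cmod (charfun d m \<rho> p q) = 1 then charfun d m \<rho> p q else 0)))"

text \<open>mean channel: the channel whose Choi state is the mean state of the Choi state
  (as a function it is normalised to be 0 outside the N x N matrices, to make it unique)\<close>
definition mean_channel :: "nat \<Rightarrow> nat \<Rightarrow> (complex mat \<Rightarrow> complex mat) \<Rightarrow> (complex mat \<Rightarrow> complex mat)" where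
  "mean_channel d n \<Lambda> = (THE \<Lambda>'. is_channel (d ^ n) \<Lambda>' \<and>
     (\<forall>X. X \<notin> carrier_mat (d ^ n) (d ^ n) \<longrightarrow> \<Lambda>' X = 0\<^sub>m (d ^ n) (d ^ n)) \<and>
     choi (d ^ n) \<Lambda>' = mean_state d (2 * n) (choi (d ^ n) \<Lambda>))"

definition chan_renyi_div :: "nat \<Rightarrow> nat \<Rightarrow> ereal \<Rightarrow> (complex mat \<Rightarrow> complex mat) \<Rightarrow> ereal" where
  "chan_renyi_div d n \<alpha> \<Lambda> = (SUP (m, \<rho>) \<in> {(m, \<rho>). m > 0 \<and> density (d ^ n * m) \<rho>}.
      sandwiched_renyi (d ^ n * m) \<alpha>
        (tensor_id (d ^ n) m \<Lambda> \<rho>) (tensor_id (d ^ n) m (depol (d ^ n)) \<rho>))"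

definition chan_renyi_entropy :: "nat \<Rightarrow> nat \<Rightarrow> ereal \<Rightarrow> (complex mat \<Rightarrow> complex mat) \<Rightarrow> ereal" where
  "chan_renyi_entropy d n \<alpha> \<Lambda> = ereal (real n * ln (real d)) - chan_renyi_div d n \<alpha> \<Lambda>"

end

theory Submission
  imports Defs "Jordan_Normal_Form.Spectral_Radius" "HOL-Analysis.Convex"
begin

unbundle no inner_syntax

text \<open>
  The points where the characteristic function \<open>\<Xi>\<close> of the Choi state has modulus one form a subgroup
  of phase space. The symplectic Fourier transform of its indicator function is therefore a probability
  distribution, so the mean state is a random Weyl conjugation of the Choi state. On the level of channels,
  \<open>\<M>(\<Lambda>)\<close> is a convex mixture of the maps \<open>X \<mapsto> U \<Lambda>(V X V\<^sup>*) U\<^sup>*\<close> with unitary \<open>U\<close> and \<open>V\<close>.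

  The reference state \<open>(\<R> \<otimes> id)(\<rho>) = I/N \<otimes> \<rho>\<^sub>R\<close> neither changes when \<open>V\<close> acts on the input nor when \<open>U\<close>
  acts on the output. So only quasi-convexity of the sandwiched divergence in its first argument is needed.
  For a fixed second argument this follows from convexity of \<open>A \<mapsto> Tr f(A)\<close> for convex \<open>f\<close>.
\<close>

section \<open>Spectral theorem\<close>

text \<open>Since \<open>ln 0 = 0\<close>, a vanishing trace would spoil every comparison of
  divergences. For this reason each output state is kept below \<open>N * N\<close> times the common
  reference state: one factor \<open>N\<close> pays for pinching to the blocks of the channel
  system, the other for the normalisation \<open>I / N\<close>. This single bound yields the support
  inclusions, a nonempty set of constants for the max-divergence, and strict positivity of the
  sandwiched trace. With the reference fixed, sandwiching is linear in the state, so for each order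
  the matter comes down to the curvature of one scalar function. The unitary \<open>V\<close> arises
  because a Weyl operator on the reference half of the Choi state acts, through the maximally
  entangled vector, as its transpose on the channel input. Functional calculus, mean state and mean
  channel are given by choice or description operators. Each needs a uniqueness proof: independence
  of the diagonalisation, Fourier inversion over phase space, and injectivity of the Choi
  correspondence.\<close>

lemma mult_mat_index:
  assumes "A \<in> carrier_mat n k" "B \<in> carrier_mat k m" "i < n" "j < m"
  shows "(A * B) $$ (i, j) = (\<Sum>l<k. A $$ (i, l) * B $$ (l, j))"
  using assms by (auto simp: scalar_prod_def atLeast0LessThan)

lemma mult_carrier_square [simp]:
  "A \<in> carrier_mat N N \<Longrightarrow> B \<in> carrier_mat N N \<Longrightarrow> A * B \<in> carrier_mat N N"
  by (rule mult_carrier_mat)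

section \<open>Adjoints, unitary and Hermitian matrices\<close>

lemma adj_carrier [simp]: "A \<in> carrier_mat n m \<Longrightarrow> adj A \<in> carrier_mat m n"
  by (auto simp: adj_def)

lemma adj_dim [simp]: "dim_row (adj A) = dim_col A" "dim_col (adj A) = dim_row A"
  by (auto simp: adj_def)

lemma adj_index: "A \<in> carrier_mat n m \<Longrightarrow> i < m \<Longrightarrow> j < n \<Longrightarrow> adj A $$ (i, j) = cnj (A $$ (j, i))"
  by (auto simp: adj_def)

lemma adj_adj [simp]: "adj (adj A) = A"
  by (rule eq_matI) (auto simp: adj_def)

lemma adj_mult:
  assumes A: "A \<in> carrier_mat n k" and B: "B \<in> carrier_mat k m"
  shows "adj (A * B) = adj B * adj A"
proof (rule eq_matI)
  fix i j assume "i < dim_row (adj B * adj A)" "j < dim_col (adj B * adj A)"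
  hence ij: "i < m" "j < n" using A B by auto
  have "adj (A * B) $$ (i, j) = cnj ((A * B) $$ (j, i))"
    using A B ij by (intro adj_index) auto
  also have "\<dots> = (\<Sum>l<k. cnj (A $$ (j, l)) * cnj (B $$ (l, i)))"
    using mult_mat_index[OF A B ij(2,1)] by simp
  also have "\<dots> = (\<Sum>l<k. adj B $$ (i, l) * adj A $$ (l, j))"
    using A B ij by (intro sum.cong refl) (auto simp: adj_index[OF A] adj_index[OF B])
  also have "\<dots> = (adj B * adj A) $$ (i, j)"
    using mult_mat_index[OF adj_carrier[OF B] adj_carrier[OF A] ij] by simp
  finally show "adj (A * B) $$ (i, j) = (adj B * adj A) $$ (i, j)" .
qed (use A B in auto)

lemma unitary_carrier: "unitary N U \<Longrightarrow> U \<in> carrier_mat N N"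
  by (simp add: unitary_def)

lemma unitaryI_adj_mult:
  assumes "U \<in> carrier_mat N N" "adj U * U = 1\<^sub>m N"
  shows "unitary N U"
  using assms mat_mult_left_right_inverse[of "adj U" N U] by (auto simp: unitary_def)

text \<open>Orthonormal columns are the criterion that explicit matrices meet most directly:
  reflections, tensor products with an identity and clock-shift operators are all handled this
  way.\<close>

lemma unitaryI_columns:
  assumes U: "U \<in> carrier_mat N N"
    and cols: "\<And>i j. i < N \<Longrightarrow> j < N \<Longrightarrow>
      (\<Sum>k<N. cnj (U $$ (k, i)) * U $$ (k, j)) = (if i = j then 1 else 0)"
  shows "unitary N U"
proof (rule unitaryI_adj_mult[OF U], rule eq_matI)
  fix i j assume "i < dim_row (1\<^sub>m N :: complex mat)" "j < dim_col (1\<^sub>m N :: complex mat)"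
  hence ij: "i < N" "j < N" by auto
  have "(adj U * U) $$ (i, j) = (\<Sum>k<N. cnj (U $$ (k, i)) * U $$ (k, j))"
    unfolding mult_mat_index[OF adj_carrier[OF U] U ij]
    by (intro sum.cong refl) (use ij in \<open>auto simp: adj_index[OF U]\<close>)
  thus "(adj U * U) $$ (i, j) = 1\<^sub>m N $$ (i, j)" using cols[OF ij] ij by simp
qed (use U in auto)

lemma unitary_columns:
  assumes "unitary N U" "i < N" "j < N"
  shows "(\<Sum>k<N. cnj (U $$ (k, i)) * U $$ (k, j)) = (if i = j then 1 else 0)"
proof -
  have U: "U \<in> carrier_mat N N" and 1: "adj U * U = 1\<^sub>m N" using assms by (auto simp: unitary_def)
  have "(adj U * U) $$ (i, j) = (\<Sum>k<N. cnj (U $$ (k, i)) * U $$ (k, j))"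
    unfolding mult_mat_index[OF adj_carrier[OF U] U assms(2,3)]
    by (intro sum.cong refl) (use assms in \<open>auto simp: adj_index[OF U]\<close>)
  thus ?thesis using assms by (simp add: 1)
qed

lemma unitary_rows:
  assumes "unitary N U" "i < N" "j < N"
  shows "(\<Sum>k<N. U $$ (i, k) * cnj (U $$ (j, k))) = (if i = j then 1 else 0)"
proof -
  have U: "U \<in> carrier_mat N N" and 1: "U * adj U = 1\<^sub>m N" using assms by (auto simp: unitary_def)
  have "(U * adj U) $$ (i, j) = (\<Sum>k<N. U $$ (i, k) * cnj (U $$ (j, k)))"
    unfolding mult_mat_index[OF U adj_carrier[OF U] assms(2,3)]
    by (intro sum.cong refl) (use assms in \<open>auto simp: adj_index[OF U]\<close>)
  thus ?thesis using assms by (simp add: 1)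
qed

lemma unitary_adj [simp]: "unitary N U \<Longrightarrow> unitary N (adj U)"
  by (auto simp: unitary_def)

lemma unitary_mult:
  assumes "unitary N U" "unitary N V"
  shows "unitary N (U * V)"
proof -
  have c: "U \<in> carrier_mat N N" "V \<in> carrier_mat N N" "adj U \<in> carrier_mat N N" "adj V \<in> carrier_mat N N"
    using assms by (auto simp: unitary_def)
  have "adj (U * V) * (U * V) = adj V * (adj U * U) * V"
    using c by (simp add: adj_mult[OF c(1,2)] assoc_mult_mat[of _ N N _ N _ N])
  also have "\<dots> = 1\<^sub>m N" using assms c by (simp add: unitary_def)
  finally show ?thesis using c by (intro unitaryI_adj_mult) auto
qed

lemma unitary_one: "unitary N (1\<^sub>m N)"
proof -
  have "adj (1\<^sub>m N) = 1\<^sub>m N" by (rule eq_matI) (auto simp: adj_def)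
  thus ?thesis by (auto simp: unitary_def)
qed

lemma unitary_cancel:
  assumes "unitary N U" "X \<in> carrier_mat N N"
  shows "U * (adj U * X) = X" "adj U * (U * X) = X" "X * U * adj U = X" "X * adj U * U = X"
proof -
  have c: "U \<in> carrier_mat N N" "adj U \<in> carrier_mat N N" using assms by (auto simp: unitary_def)
  have "U * (adj U * X) = U * adj U * X" "adj U * (U * X) = adj U * U * X"
    "X * U * adj U = X * (U * adj U)" "X * adj U * U = X * (adj U * U)"
    using c assms(2) by (simp_all add: assoc_mult_mat[of _ N N _ N _ N])
  thus "U * (adj U * X) = X" "adj U * (U * X) = X" "X * U * adj U = X" "X * adj U * U = X"
    using assms by (auto simp: unitary_def)
qed

lemma hermitian_carrier: "hermitian N A \<Longrightarrow> A \<in> carrier_mat N N"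
  by (simp add: hermitian_def)

lemma hermitian_index: "hermitian N A \<Longrightarrow> i < N \<Longrightarrow> j < N \<Longrightarrow> cnj (A $$ (i, j)) = A $$ (j, i)"
  by (metis adj_index hermitian_def)

lemma hermitianI:
  assumes "A \<in> carrier_mat N N" "\<And>i j. i < N \<Longrightarrow> j < N \<Longrightarrow> cnj (A $$ (i, j)) = A $$ (j, i)"
  shows "hermitian N A"
  unfolding hermitian_def using assms by (auto simp: adj_def intro!: eq_matI)

lemma hermitian_conj:
  assumes "hermitian N A" "T \<in> carrier_mat N N"
  shows "hermitian N (T * A * adj T)"
proof -
  have c: "A \<in> carrier_mat N N" "adj T \<in> carrier_mat N N" "adj A = A"
    using assms by (auto simp: hermitian_def)
  have "adj (T * A * adj T) = adj (adj T) * (adj A * adj T)"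
    using c assms(2) by (simp add: adj_mult[of _ N N _ N])
  also have "\<dots> = T * A * adj T" using c assms(2) by (simp add: assoc_mult_mat[of _ N N _ N _ N])
  finally have "adj (T * A * adj T) = T * A * adj T" .
  moreover have "T * A * adj T \<in> carrier_mat N N" using c assms(2) by simp
  ultimately show ?thesis unfolding hermitian_def by (intro conjI)
qed

section \<open>Diagonal matrices and diagonalisation\<close>

lemma diag_of_carrier [simp]: "diag_of N lam \<in> carrier_mat N N"
  by (simp add: diag_of_def)

lemma adj_diag_of [simp]: "adj (diag_of N lam) = diag_of N lam"
  by (rule eq_matI) (auto simp: adj_def diag_of_def)

lemma diag_of_mult: "diag_of N f * diag_of N g = diag_of N (\<lambda>i. f i * g i)"
proof (rule eq_matI)
  fix i j assume "i < dim_row (diag_of N (\<lambda>i. f i * g i))" "j < dim_col (diag_of N (\<lambda>i. f i * g i))"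
  hence ij: "i < N" "j < N" by (auto simp: diag_of_def)
  have "(diag_of N f * diag_of N g) $$ (i, j)
      = (\<Sum>l<N. if l = i then (if i = j then of_real (f i * g i) else 0) else 0)"
    unfolding mult_mat_index[OF diag_of_carrier diag_of_carrier ij]
    by (intro sum.cong refl) (use ij in \<open>auto simp: diag_of_def\<close>)
  thus "(diag_of N f * diag_of N g) $$ (i, j) = diag_of N (\<lambda>i. f i * g i) $$ (i, j)"
    using ij by (simp add: diag_of_def)
qed (auto simp: diag_of_def)

lemma mult_diag_of_index:
  assumes "U \<in> carrier_mat N N" "i < N" "j < N"
  shows "(U * diag_of N lam) $$ (i, j) = U $$ (i, j) * of_real (lam j)"
proof -
  have "(U * diag_of N lam) $$ (i, j) = (\<Sum>l<N. if l = j then U $$ (i, j) * of_real (lam j) else 0)"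
    unfolding mult_mat_index[OF assms(1) diag_of_carrier assms(2,3)]
    by (intro sum.cong refl) (use assms in \<open>auto simp: diag_of_def\<close>)
  thus ?thesis using assms by simp
qed

lemma diag_of_mult_index:
  assumes "U \<in> carrier_mat N N" "i < N" "j < N"
  shows "(diag_of N lam * U) $$ (i, j) = of_real (lam i) * U $$ (i, j)"
proof -
  have "(diag_of N lam * U) $$ (i, j) = (\<Sum>l<N. if l = i then of_real (lam i) * U $$ (i, j) else 0)"
    unfolding mult_mat_index[OF diag_of_carrier assms(1) assms(2,3)]
    by (intro sum.cong refl) (use assms in \<open>auto simp: diag_of_def\<close>)
  thus ?thesis using assms by simp
qed

lemma diagonalised_index:
  assumes U: "U \<in> carrier_mat N N" and ij: "i < N" "j < N"
  shows "(U * diag_of N lam * adj U) $$ (i, j) = (\<Sum>k<N. U $$ (i, k) * of_real (lam k) * cnj (U $$ (j, k)))"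
proof -
  have "U * diag_of N lam \<in> carrier_mat N N" using U by auto
  from mult_mat_index[OF this adj_carrier[OF U] ij] show ?thesis
    by (simp, intro sum.cong refl) (use ij in \<open>auto simp: adj_index[OF U] mult_diag_of_index[OF U]\<close>)
qed

text \<open>The Householder reflection along \<open>w = x - e_0\<close> exchanges \<open>e_0\<close>
  and \<open>x\<close>. Over the complex numbers this requires the inner product of the two to be
  real, hence the condition on \<open>x 0\<close>; \<open>unit_eigenvector\<close> arranges it by a
  phase.\<close>

lemma householder_column:
  fixes x :: "nat \<Rightarrow> complex"
  assumes N: "N > 0" and unit: "(\<Sum>i<N. (cmod (x i))\<^sup>2) = 1" and x0: "Im (x 0) = 0"
  shows "\<exists>H. unitary N H \<and> (\<forall>i<N. H $$ (i, 0) = x i)"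
proof -
  define w where "w i = x i - (if i = 0 then 1 else 0)" for i
  define t where "t = (\<Sum>i<N. (cmod (w i))\<^sup>2)"
  \<comment> \<open>\<open>t\<close> is the squared norm of \<open>w\<close>. When it vanishes,
    \<open>x\<close> is \<open>e_0\<close> already and \<open>c = 0\<close> makes the reflection the
    identity.\<close>
  define c where "c = (if t = 0 then 0 else 2 / t)"
  have x0': "x 0 = of_real (Re (x 0))" using x0 by (simp add: complex_eq_iff)
  obtain n where Nn: "N = Suc n" using N by (cases N) auto
  have t: "t = 2 - 2 * Re (x 0)"
  proof -
    have "t = (cmod (x 0 - 1))\<^sup>2 + (\<Sum>i<n. (cmod (x (Suc i)))\<^sup>2)"
      unfolding t_def Nn by (subst sum.lessThan_Suc_shift) (simp add: w_def)
    also have "(\<Sum>i<n. (cmod (x (Suc i)))\<^sup>2) = 1 - (cmod (x 0))\<^sup>2"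
      using unit unfolding Nn by (subst (asm) sum.lessThan_Suc_shift) simp
    finally have "t = (cmod (x 0 - 1))\<^sup>2 + (1 - (cmod (x 0))\<^sup>2)" .
    thus ?thesis unfolding cmod_power2 using x0 by (simp add: power2_eq_square algebra_simps)
  qed
  have w0: "w 0 = - of_real (t / 2)" using x0' unfolding w_def t by (simp add: complex_eq_iff diff_divide_distrib)
  have wt: "(\<Sum>k<N. cnj (w k) * w k) = of_real t"
    unfolding t_def of_real_sum by (intro sum.cong refl) (metis complex_norm_square mult.commute of_real_power)
  \<comment> \<open>By this identity the quadratic term of \<open>adj H * H\<close> cancels the two
    linear ones.\<close>
  have c2: "c * c * t = 2 * c" by (simp add: c_def)
  define H where "H = mat N N (\<lambda>(i, j). (if i = j then 1 else 0) - of_real c * w i * cnj (w j))"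
  have "unitary N H"
  proof (rule unitaryI_columns)
    fix i j assume ij: "i < N" "j < N"
    have "(\<Sum>k<N. cnj (H $$ (k, i)) * H $$ (k, j)) =
      (\<Sum>k<N. (if k = i then (if i = j then 1 else 0) else 0)
        - (if k = i then of_real c * w i * cnj (w j) else 0)
        - (if k = j then of_real c * w i * cnj (w j) else 0)
        + of_real (c * c) * w i * cnj (w j) * (cnj (w k) * w k))"
      by (intro sum.cong refl) (use ij in \<open>auto simp: H_def algebra_simps\<close>)
    also have "\<dots> = (if i = j then 1 else 0) - 2 * of_real c * w i * cnj (w j)
        + of_real (c * c * t) * w i * cnj (w j)"
      using ij by (simp add: sum.distrib sum_subtractf sum_distrib_left[symmetric] wt)
    finally show "(\<Sum>k<N. cnj (H $$ (k, i)) * H $$ (k, j)) = (if i = j then 1 else 0)"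
      by (simp add: c2)
  qed (simp add: H_def)
  moreover have "H $$ (i, 0) = x i" if i: "i < N" for i
  proof (cases "t = 0")
    case True
    hence "(cmod (w i))\<^sup>2 = 0" unfolding t_def using i by (subst (asm) sum_nonneg_eq_0_iff) auto
    thus ?thesis using True i N by (auto simp: H_def c_def w_def)
  next
    case False
    have "H $$ (i, 0) = (if i = 0 then 1 else 0) + of_real (c * t / 2) * w i"
      using i N by (simp add: H_def w0)
    thus ?thesis using False by (simp add: c_def w_def)
  qed
  ultimately show ?thesis by blast
qed

lemma unit_eigenvector:
  assumes A: "A \<in> carrier_mat N N" and N: "N > 0"
  shows "\<exists>x k. (\<Sum>i<N. (cmod (x i))\<^sup>2) = 1 \<and> Im (x 0) = 0 \<and>
    (\<forall>i<N. (\<Sum>j<N. A $$ (i, j) * x j) = k * x i)"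
proof -
  obtain k where "eigenvalue A k" using spectrum_non_empty[OF A N] by (auto simp: spectrum_def)
  then obtain v where v: "v \<in> carrier_vec N" "v \<noteq> 0\<^sub>v N" "A *\<^sub>v v = k \<cdot>\<^sub>v v"
    using A by (auto simp: eigenvalue_def eigenvector_def)
  have ev: "(\<Sum>j<N. A $$ (i, j) * v $ j) = k * v $ i" if "i < N" for i
  proof -
    have "(A *\<^sub>v v) $ i = (\<Sum>j<N. A $$ (i, j) * v $ j)"
      using that A v(1) by (auto simp: scalar_prod_def atLeast0LessThan)
    thus ?thesis using v that by simp
  qed
  define r where "r = sqrt (\<Sum>i<N. (cmod (v $ i))\<^sup>2)"
  obtain i0 where i0: "i0 < N" "v $ i0 \<noteq> 0" using v by (metis eq_vecI carrier_vecD index_zero_vec)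
  have "(\<Sum>i<N. (cmod (v $ i))\<^sup>2) > 0"
    using i0 by (intro sum_pos2[of _ i0]) auto
  hence r: "r > 0" "r\<^sup>2 = (\<Sum>i<N. (cmod (v $ i))\<^sup>2)" by (auto simp: r_def)
  \<comment> \<open>A phase turning the first coordinate into a nonnegative real; any unimodular
    value serves when that coordinate is zero.\<close>
  define u where "u = (if v $ 0 = 0 then 1 else cnj (v $ 0) / of_real (cmod (v $ 0)))"
  have u: "cmod u = 1" by (auto simp: u_def norm_divide)
  define x where "x i = u * v $ i / of_real r" for i
  have "(\<Sum>i<N. (cmod (x i))\<^sup>2) = (\<Sum>i<N. (cmod (v $ i))\<^sup>2 / r\<^sup>2)"
    by (intro sum.cong refl) (use r u in \<open>simp add: x_def norm_mult norm_divide power_divide\<close>)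
  also have "\<dots> = 1" using r(1) by (simp add: sum_divide_distrib[symmetric] r(2)[symmetric])
  finally have 1: "(\<Sum>i<N. (cmod (x i))\<^sup>2) = 1" .
  have "u * v $ 0 = of_real (cmod (v $ 0))"
  proof (cases "v $ 0 = 0")
    case False
    thus ?thesis
      by (simp add: u_def complex_norm_square[symmetric] mult.commute power2_eq_square)
  qed simp
  hence 2: "Im (x 0) = 0" by (simp add: x_def)
  have 3: "(\<Sum>j<N. A $$ (i, j) * x j) = k * x i" if "i < N" for i
  proof -
    have "(\<Sum>j<N. A $$ (i, j) * x j) = (u / of_real r) * (\<Sum>j<N. A $$ (i, j) * v $ j)"
      unfolding sum_distrib_left by (intro sum.cong refl) (simp add: x_def)
    thus ?thesis using ev[OF that] by (simp add: x_def)
  qed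
  from 1 2 3 show ?thesis by blast
qed

text \<open>Deflation: conjugation by a unitary whose first column is a unit eigenvector clears the
  first column off the diagonal, and self-adjointness clears the first row with it. The remaining
  block is again Hermitian and falls to the induction hypothesis.\<close>

theorem hermitian_diagonalisable:
  assumes "hermitian N A"
  shows "\<exists>U lam. unitary N U \<and> A = U * diag_of N lam * adj U"
  using assms
proof (induction N arbitrary: A)
  case 0
  hence "A = 1\<^sub>m 0 * diag_of 0 (\<lambda>_. 0) * adj (1\<^sub>m 0)"
    by (intro eq_matI) (auto simp: hermitian_def diag_of_def)
  with unitary_one show ?case by blast
next
  case (Suc n)
  let ?N = "Suc n"
  have A: "A \<in> carrier_mat ?N ?N" using Suc.prems by (simp add: hermitian_def)
  obtain x k where x: "(\<Sum>i<?N. (cmod (x i))\<^sup>2) = 1" "Im (x 0) = 0"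
    and ev: "\<And>i. i < ?N \<Longrightarrow> (\<Sum>j<?N. A $$ (i, j) * x j) = k * x i"
    using unit_eigenvector[OF A] by blast
  obtain H where H: "unitary ?N H" and Hx: "\<And>i. i < ?N \<Longrightarrow> H $$ (i, 0) = x i"
    using householder_column[OF _ x] by blast
  have Hc: "H \<in> carrier_mat ?N ?N" "adj H \<in> carrier_mat ?N ?N" using H by (auto simp: unitary_def)
  define B where "B = adj H * A * H"
  have Bc: "B \<in> carrier_mat ?N ?N" using Hc A by (simp add: B_def)
  have Bh: "hermitian ?N B"
    using hermitian_conj[OF Suc.prems Hc(2)] by (simp add: B_def)
  have AH: "(A * H) $$ (i, 0) = k * H $$ (i, 0)" if "i < ?N" for i
    using mult_mat_index[OF A Hc(1) that] ev[OF that] Hx that by simp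
  have B0: "B $$ (i, 0) = (if i = 0 then k else 0)" if i: "i < ?N" for i
  proof -
    have "B = adj H * (A * H)" using Hc A by (simp add: B_def assoc_mult_mat[of _ ?N ?N _ ?N _ ?N])
    hence "B $$ (i, 0) = (\<Sum>l<?N. adj H $$ (i, l) * (A * H) $$ (l, 0))"
      using mult_mat_index[OF Hc(2) _ i, of "A * H" ?N 0] A Hc(1) by auto
    also have "\<dots> = (\<Sum>l<?N. k * (cnj (H $$ (l, i)) * H $$ (l, 0)))"
      by (intro sum.cong refl) (use i in \<open>auto simp: AH adj_index[OF Hc(1)]\<close>)
    also have "\<dots> = k * (if i = 0 then 1 else 0)"
      using unitary_columns[OF H i, of 0] by (simp add: sum_distrib_left[symmetric])
    finally show ?thesis by simp
  qed
  \<comment> \<open>The eigenvalue has become a diagonal entry of a Hermitian matrix, hence is real,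
    as \<open>diag_of\<close> demands.\<close>
  have kr: "k = of_real (Re k)"
    using hermitian_index[OF Bh, of 0 0] B0[of 0] by (simp add: complex_eq_iff)
  have B0': "B $$ (0, i) = (if i = 0 then k else 0)" if i: "i < ?N" for i
    using hermitian_index[OF Bh i, of 0] B0[OF i] kr by (auto simp: complex_eq_iff)
  define A' where "A' = mat n n (\<lambda>(i, j). B $$ (Suc i, Suc j))"
  have "hermitian n A'"
    by (rule hermitianI) (auto simp: A'_def hermitian_index[OF Bh])
  then obtain V mu where V: "unitary n V" and A': "A' = V * diag_of n mu * adj V"
    using Suc.IH by blast
  have Vc: "V \<in> carrier_mat n n" using V by (rule unitary_carrier)
  \<comment> \<open>The block matrix \<open>1 \<oplus> V\<close>; \<open>i - 1\<close> undoes the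
    index shift caused by the split-off coordinate.\<close>
  define W where "W = mat ?N ?N (\<lambda>(i, j). if i = 0 \<and> j = 0 then 1
    else if i = 0 \<or> j = 0 then 0 else V $$ (i - 1, j - 1))"
  define lam where "lam = case_nat (Re k) mu"
  have Wc: "W \<in> carrier_mat ?N ?N" by (simp add: W_def)
  have W: "unitary ?N W"
  proof (rule unitaryI_columns[OF Wc])
    fix i j assume ij: "i < ?N" "j < ?N"
    show "(\<Sum>k<?N. cnj (W $$ (k, i)) * W $$ (k, j)) = (if i = j then 1 else 0)"
      using ij unitary_columns[OF V]
      by (cases i; cases j) (auto simp: W_def sum.lessThan_Suc_shift simp del: sum.lessThan_Suc)
  qed
  have BW: "B = W * diag_of ?N lam * adj W"
  proof (rule eq_matI)
    fix i j assume "i < dim_row (W * diag_of ?N lam * adj W)" "j < dim_col (W * diag_of ?N lam * adj W)"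
    hence ij: "i < ?N" "j < ?N" using Wc by auto
    have "A' $$ (a, b) = (\<Sum>k<n. V $$ (a, k) * of_real (mu k) * cnj (V $$ (b, k)))"
      if "a < n" "b < n" for a b
      unfolding A' by (rule diagonalised_index[OF Vc that])
    hence "B $$ (Suc a, Suc b) = (\<Sum>k<n. V $$ (a, k) * of_real (mu k) * cnj (V $$ (b, k)))"
      if "a < n" "b < n" for a b
      using that by (simp add: A'_def)
    thus "B $$ (i, j) = (W * diag_of ?N lam * adj W) $$ (i, j)"
      unfolding diagonalised_index[OF Wc ij] using ij B0 B0' kr
      by (cases i; cases j) (auto simp: W_def lam_def sum.lessThan_Suc_shift simp del: sum.lessThan_Suc)
  qed (use Wc Bc in auto)
  have "A = H * (adj H * A * H) * adj H"
    using unitary_cancel[OF H] Hc A by (simp add: assoc_mult_mat[of _ ?N ?N _ ?N _ ?N])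
  also have "\<dots> = H * (W * diag_of ?N lam * adj W) * adj H" by (simp add: BW[symmetric] B_def)
  also have "\<dots> = (H * W) * diag_of ?N lam * adj (H * W)"
    using Hc Wc by (simp add: adj_mult[of _ ?N ?N _ ?N] assoc_mult_mat[of _ ?N ?N _ ?N _ ?N])
  finally show ?case using unitary_mult[OF H W] by blast
qed

section \<open>Positive matrices and functional calculus\<close>

text \<open>The form \<open><v, A w>\<close>. Vectors are functions on indices, so sums and case
  distinctions over them carry no dimension; their values from \<open>N\<close> on are
  ignored.\<close>

definition sform :: "nat \<Rightarrow> complex mat \<Rightarrow> (nat \<Rightarrow> complex) \<Rightarrow> (nat \<Rightarrow> complex) \<Rightarrow> complex" where
  "sform N A v w = (\<Sum>i<N. \<Sum>j<N. cnj (v i) * A $$ (i, j) * w j)"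

lemma scalar_prod_sform:
  assumes "A \<in> carrier_mat N N" "v \<in> carrier_vec N" "w \<in> carrier_vec N"
  shows "conjugate v \<bullet> (A *\<^sub>v w) = sform N A (\<lambda>i. v $ i) (\<lambda>i. w $ i)"
  using assms by (auto simp: scalar_prod_def sform_def atLeast0LessThan sum_distrib_left mult.assoc
      intro!: sum.cong)

lemma sform_cong:
  assumes "\<And>i. i < N \<Longrightarrow> v i = v' i" "\<And>i. i < N \<Longrightarrow> w i = w' i"
    "\<And>i j. i < N \<Longrightarrow> j < N \<Longrightarrow> A $$ (i, j) = A' $$ (i, j)"
  shows "sform N A v w = sform N A' v' w'"
  unfolding sform_def using assms by (intro sum.cong refl) auto

lemma psd_iff_sform: "psd N A \<longleftrightarrow> hermitian N A \<and> (\<forall>v. 0 \<le> Re (sform N A v v))"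
proof (cases "hermitian N A")
  case True
  hence A: "A \<in> carrier_mat N N" by (rule hermitian_carrier)
  have "sform N A v v = conjugate (vec N v) \<bullet> (A *\<^sub>v vec N v)" for v
    by (subst scalar_prod_sform[OF A]) (auto intro: sform_cong)
  moreover have "(\<forall>v\<in>carrier_vec N. 0 \<le> Re (conjugate v \<bullet> (A *\<^sub>v v))) \<longleftrightarrow>
      (\<forall>v. 0 \<le> Re (sform N A v v))"
    using calculation scalar_prod_sform[OF A] by (metis vec_carrier)
  ultimately show ?thesis using True by (simp add: psd_def)
qed (simp add: psd_def)

lemma psd_hermitian: "psd N A \<Longrightarrow> hermitian N A"
  by (simp add: psd_def)

lemma psd_carrier: "psd N A \<Longrightarrow> A \<in> carrier_mat N N"
  by (simp add: psd_def hermitian_def)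

lemma psd_sform_nonneg: "psd N A \<Longrightarrow> 0 \<le> Re (sform N A v v)"
  by (simp add: psd_iff_sform)

lemma conj_mat_index:
  assumes T: "T \<in> carrier_mat N N" and A: "A \<in> carrier_mat N N" and ij: "i < N" "j < N"
  shows "(T * A * adj T) $$ (i, j) = (\<Sum>k<N. \<Sum>l<N. T $$ (i, k) * A $$ (k, l) * cnj (T $$ (j, l)))"
proof -
  have "(T * A * adj T) $$ (i, j) = (\<Sum>l<N. (\<Sum>k<N. T $$ (i, k) * A $$ (k, l)) * cnj (T $$ (j, l)))"
    using mult_mat_index[OF mult_carrier_square[OF T A] adj_carrier[OF T] ij]
      mult_mat_index[OF T A ij(1)] adj_index[OF T _ ij(2)] by simp
  thus ?thesis by (subst sum.swap) (simp add: sum_distrib_right)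
qed

lemma sform_conj:
  assumes T: "T \<in> carrier_mat N N" and A: "A \<in> carrier_mat N N"
  shows "sform N (T * A * adj T) v w =
    sform N A (\<lambda>k. \<Sum>i<N. cnj (T $$ (i, k)) * v i) (\<lambda>k. \<Sum>i<N. cnj (T $$ (i, k)) * w i)"
proof -
  have "sform N (T * A * adj T) v w =
    (\<Sum>i<N. \<Sum>j<N. \<Sum>k<N. \<Sum>l<N. cnj (v i) * T $$ (i, k) * A $$ (k, l) * (cnj (T $$ (j, l)) * w j))"
    unfolding sform_def
    by (intro sum.cong refl) (simp add: conj_mat_index[OF T A] sum_distrib_left sum_distrib_right mult_ac)
  also have "\<dots> = (\<Sum>i<N. \<Sum>k<N. \<Sum>l<N. \<Sum>j<N. cnj (v i) * T $$ (i, k) * A $$ (k, l) * (cnj (T $$ (j, l)) * w j))"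
    by (rule sum.cong[OF refl], subst sum.swap, rule sum.cong[OF refl], rule sum.swap)
  also have "\<dots> = (\<Sum>k<N. \<Sum>l<N. \<Sum>i<N. \<Sum>j<N. cnj (v i) * T $$ (i, k) * A $$ (k, l) * (cnj (T $$ (j, l)) * w j))"
    by (subst sum.swap, rule sum.cong[OF refl], rule sum.swap)
  also have "\<dots> = sform N A (\<lambda>k. \<Sum>i<N. cnj (T $$ (i, k)) * v i) (\<lambda>k. \<Sum>i<N. cnj (T $$ (i, k)) * w i)"
    unfolding sform_def
    by (intro sum.cong refl) (simp add: sum_distrib_left sum_distrib_right mult_ac)
  finally show ?thesis .
qed

lemma psd_conj:
  assumes "psd N A" "T \<in> carrier_mat N N"
  shows "psd N (T * A * adj T)"
  using assms hermitian_conj[OF psd_hermitian[OF assms(1)] assms(2)]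
  by (simp add: psd_iff_sform sform_conj hermitian_carrier)

lemma psd_diag_nonneg:
  assumes "psd N A" "i < N"
  shows "0 \<le> Re (A $$ (i, i))"
proof -
  have "sform N A (\<lambda>j. if j = i then 1 else 0) (\<lambda>j. if j = i then 1 else 0)
    = (\<Sum>k<N. \<Sum>l<N. if l = i then (if k = i then A $$ (i, i) else 0) else 0)"
    unfolding sform_def by (intro sum.cong refl) auto
  thus ?thesis using psd_sform_nonneg[OF assms(1), of "\<lambda>j. if j = i then 1 else 0"] assms(2) by simp
qed

lemma conj_diagonalised:
  assumes "unitary N U" "A = U * diag_of N lam * adj U"
  shows "adj U * A * U = diag_of N lam"
proof -
  have c: "U \<in> carrier_mat N N" "adj U \<in> carrier_mat N N" using assms by (auto simp: unitary_def)
  have "adj U * A * U = adj U * (U * (diag_of N lam * adj U * U))"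
    using c by (simp add: assms(2) assoc_mult_mat[of _ N N _ N _ N])
  thus ?thesis using unitary_cancel[OF assms(1)] c by simp
qed

text \<open>Eigenvalues are diagonal entries after a change of basis, and a change of basis keeps
  positivity.\<close>

lemma psd_eigenvalues_nonneg:
  assumes "psd N A" "unitary N U" "A = U * diag_of N lam * adj U" "i < N"
  shows "0 \<le> lam i"
proof -
  have "psd N (adj U * A * adj (adj U))"
    using assms(1,2) by (intro psd_conj) (auto simp: unitary_def)
  hence "psd N (diag_of N lam)" using conj_diagonalised[OF assms(2,3)] by simp
  from psd_diag_nonneg[OF this assms(4)] show ?thesis using assms(4) by (simp add: diag_of_def)
qed

lemma sform_diag_of: "sform N (diag_of N lam) v v = of_real (\<Sum>k<N. lam k * (cmod (v k))\<^sup>2)"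
proof -
  have "sform N (diag_of N lam) v v = (\<Sum>i<N. \<Sum>j<N. if j = i then of_real (lam i * (cmod (v i))\<^sup>2) else 0)"
    unfolding sform_def
    by (intro sum.cong refl) (auto simp: diag_of_def complex_norm_square[symmetric] mult_ac
        simp flip: of_real_power)
  thus ?thesis by simp
qed

text \<open>In an eigenbasis the form is the sum of the terms
  \<open>lam k * (cmod (u k))\<^sup>2\<close>. Being nonnegative, they vanish together with the sum,
  and then so do the numbers \<open>lam k * u k\<close>, which are the coordinates of
  \<open>A v\<close> in that basis.\<close>

lemma psd_kernel:
  assumes A: "psd N A" and 0: "Re (sform N A v v) = 0" and i: "i < N"
  shows "(\<Sum>j<N. A $$ (i, j) * v j) = 0"
proof -
  obtain U lam where U: "unitary N U" and AU: "A = U * diag_of N lam * adj U"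
    using hermitian_diagonalisable[OF psd_hermitian[OF A]] by blast
  have Uc: "U \<in> carrier_mat N N" using U by (rule unitary_carrier)
  define u where "u k = (\<Sum>i<N. cnj (U $$ (i, k)) * v i)" for k
  have nn: "lam k \<ge> 0" if "k < N" for k using psd_eigenvalues_nonneg[OF A U AU that] .
  have "(\<Sum>k<N. lam k * (cmod (u k))\<^sup>2) = 0"
    using 0 unfolding AU sform_conj[OF Uc diag_of_carrier] u_def[symmetric] sform_diag_of by simp
  hence z: "of_real (lam k) * u k = 0" if "k < N" for k
    using that nn by (subst (asm) sum_nonneg_eq_0_iff) auto
  have "(\<Sum>j<N. A $$ (i, j) * v j) = (\<Sum>j<N. \<Sum>k<N. U $$ (i, k) * of_real (lam k) * cnj (U $$ (j, k)) * v j)"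
    unfolding AU by (intro sum.cong refl) (use i in \<open>simp add: diagonalised_index[OF Uc] sum_distrib_right\<close>)
  also have "\<dots> = (\<Sum>k<N. U $$ (i, k) * (of_real (lam k) * u k))"
    by (subst sum.swap) (simp add: u_def sum_distrib_left mult_ac)
  also have "\<dots> = 0" using z by (intro sum.neutral ballI) simp
  finally show ?thesis .
qed

lemma psd_smult_diff_sform:
  assumes "S \<in> carrier_mat N N" "R \<in> carrier_mat N N"
  shows "sform N (of_real c \<cdot>\<^sub>m S - R) v v = of_real c * sform N S v v - sform N R v v"
  using assms by (simp add: sform_def sum_subtractf[symmetric] sum_distrib_left algebra_simps)

lemma hermitian_smult_diff:
  assumes "hermitian N S" "hermitian N R"
  shows "hermitian N (of_real c \<cdot>\<^sub>m S - R)"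
  using assms hermitian_carrier[OF assms(1)] hermitian_carrier[OF assms(2)]
  by (intro hermitianI) (auto simp: hermitian_index)

text \<open>On a kernel vector of \<open>S\<close> the form of \<open>R\<close> is nonpositive,
  hence zero, and \<open>psd_kernel\<close> turns this into \<open>R v = 0\<close>. The support
  conditions in the divergence are all discharged this way.\<close>

lemma supp_le_if_dominated:
  assumes R: "psd N R" and S: "psd N S" and D: "psd N (of_real c \<cdot>\<^sub>m S - R)"
  shows "supp_le N R S"
  unfolding supp_le_def
proof (intro ballI impI)
  fix v :: "complex vec" assume v: "v \<in> carrier_vec N" and Sv: "S *\<^sub>v v = 0\<^sub>v N"
  have Rc: "R \<in> carrier_mat N N" and Sc: "S \<in> carrier_mat N N" using R S psd_carrier by auto
  have "sform N S (\<lambda>i. v $ i) (\<lambda>i. v $ i) = 0"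
    using scalar_prod_sform[OF Sc v v] v by (simp add: Sv)
  hence "Re (sform N R (\<lambda>i. v $ i) (\<lambda>i. v $ i)) \<le> 0"
    using psd_sform_nonneg[OF D, of "\<lambda>i. v $ i"] by (simp add: psd_smult_diff_sform[OF Sc Rc])
  hence "Re (sform N R (\<lambda>i. v $ i) (\<lambda>i. v $ i)) = 0"
    using psd_sform_nonneg[OF R, of "\<lambda>i. v $ i"] by simp
  from psd_kernel[OF R this] show "R *\<^sub>v v = 0\<^sub>v N"
    using Rc v by (intro eq_vecI) (auto simp: scalar_prod_def atLeast0LessThan)
qed

section \<open>Traces and weighted mixtures of matrices\<close>

lemma mtrace_sum: "A \<in> carrier_mat N N \<Longrightarrow> mtrace A = (\<Sum>i<N. A $$ (i, i))"
  by (auto simp: mtrace_def)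

lemma mtrace_mult_comm:
  assumes "A \<in> carrier_mat N N" "B \<in> carrier_mat N N"
  shows "mtrace (A * B) = mtrace (B * A)"
proof -
  have "mtrace (A * B) = (\<Sum>i<N. \<Sum>l<N. A $$ (i, l) * B $$ (l, i))"
    using mult_mat_index[OF assms] mtrace_sum[OF mult_carrier_square[OF assms]] by simp
  also have "\<dots> = mtrace (B * A)"
    using mult_mat_index[OF assms(2,1)] mtrace_sum[OF mult_carrier_square[OF assms(2,1)]]
    by (subst sum.swap) (simp add: mult.commute)
  finally show ?thesis .
qed

lemma mtrace_conj_unitary:
  assumes "unitary N U" "A \<in> carrier_mat N N"
  shows "mtrace (U * A * adj U) = mtrace A"
proof -
  have c: "U \<in> carrier_mat N N" "adj U \<in> carrier_mat N N" using assms by (auto simp: unitary_def)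
  have "mtrace (U * A * adj U) = mtrace (adj U * (U * A))"
    using c assms(2) by (intro mtrace_mult_comm[of _ N]) auto
  thus ?thesis using unitary_cancel[OF assms] by simp
qed

lemma density_conj_unitary:
  assumes "unitary N U" "density N A"
  shows "density N (U * A * adj U)"
  using assms by (auto simp: density_def mtrace_conj_unitary psd_carrier unitary_carrier intro!: psd_conj)

text \<open>Formed entry by entry with explicit size \<open>N\<close>, because matrices of varying
  dimension share no zero from which a sum could start.\<close>

definition mixture :: "nat \<Rightarrow> 'i set \<Rightarrow> ('i \<Rightarrow> real) \<Rightarrow> ('i \<Rightarrow> complex mat) \<Rightarrow> complex mat" where
  "mixture N I \<mu> M = mat N N (\<lambda>(i, j). \<Sum>y\<in>I. of_real (\<mu> y) * M y $$ (i, j))"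

lemma mixture_carrier [simp]: "mixture N I \<mu> M \<in> carrier_mat N N"
  by (simp add: mixture_def)

lemma mixture_index:
  "i < N \<Longrightarrow> j < N \<Longrightarrow> mixture N I \<mu> M $$ (i, j) = (\<Sum>y\<in>I. of_real (\<mu> y) * M y $$ (i, j))"
  by (simp add: mixture_def)

lemma mixture_cong: "(\<And>y. y \<in> I \<Longrightarrow> M y = M' y) \<Longrightarrow> mixture N I \<mu> M = mixture N I \<mu> M'"
  by (auto simp: mixture_def intro!: eq_matI sum.cong)

lemma sform_mixture:
  "sform N (mixture N I \<mu> M) v w = (\<Sum>y\<in>I. of_real (\<mu> y) * sform N (M y) v w)"
proof -
  have "sform N (mixture N I \<mu> M) v w
    = (\<Sum>i<N. \<Sum>j<N. \<Sum>y\<in>I. of_real (\<mu> y) * (cnj (v i) * M y $$ (i, j) * w j))"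
    unfolding sform_def
    by (intro sum.cong[OF refl]) (simp add: mixture_index sum_distrib_left sum_distrib_right mult_ac)
  also have "\<dots> = (\<Sum>y\<in>I. \<Sum>i<N. \<Sum>j<N. of_real (\<mu> y) * (cnj (v i) * M y $$ (i, j) * w j))"
    by (simp only: sum.swap[of _ I])
  finally show ?thesis by (simp add: sform_def sum_distrib_left)
qed

lemma psd_mixture:
  assumes "\<And>y. y \<in> I \<Longrightarrow> 0 \<le> \<mu> y" "\<And>y. y \<in> I \<Longrightarrow> psd N (M y)"
  shows "psd N (mixture N I \<mu> M)"
proof -
  have "hermitian N (mixture N I \<mu> M)"
    by (rule hermitianI)
      (auto simp: mixture_index hermitian_index[OF psd_hermitian[OF assms(2)]] intro!: sum.cong)
  moreover have "0 \<le> Re (sform N (mixture N I \<mu> M) v v)" for v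
    unfolding sform_mixture using assms psd_sform_nonneg by (auto intro!: sum_nonneg)
  ultimately show ?thesis by (simp add: psd_iff_sform)
qed

lemma mtrace_mixture:
  assumes "\<And>y. y \<in> I \<Longrightarrow> M y \<in> carrier_mat N N"
  shows "mtrace (mixture N I \<mu> M) = (\<Sum>y\<in>I. of_real (\<mu> y) * mtrace (M y))"
proof -
  have "mtrace (mixture N I \<mu> M) = (\<Sum>y\<in>I. of_real (\<mu> y) * (\<Sum>i<N. M y $$ (i, i)))"
    unfolding mtrace_sum[OF mixture_carrier] sum_distrib_left
    by (subst sum.swap) (simp add: mixture_index)
  thus ?thesis using assms by (simp add: mtrace_sum[of _ N])
qed

lemma density_mixture:
  assumes "\<And>y. y \<in> I \<Longrightarrow> 0 \<le> \<mu> y" "sum \<mu> I = 1" "\<And>y. y \<in> I \<Longrightarrow> density N (M y)"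
  shows "density N (mixture N I \<mu> M)"
proof -
  have "mtrace (mixture N I \<mu> M) = of_real (sum \<mu> I)"
    using assms(3) by (subst mtrace_mixture) (auto simp: density_def psd_carrier)
  thus ?thesis using assms by (auto simp: density_def intro!: psd_mixture)
qed

lemma mixture_mult:
  assumes "\<And>y. y \<in> I \<Longrightarrow> M y \<in> carrier_mat N N" "B \<in> carrier_mat N N"
  shows "mixture N I \<mu> M * B = mixture N I \<mu> (\<lambda>y. M y * B)"
proof (rule eq_matI)
  fix i j assume "i < dim_row (mixture N I \<mu> (\<lambda>y. M y * B))" "j < dim_col (mixture N I \<mu> (\<lambda>y. M y * B))"
  hence ij: "i < N" "j < N" by (auto simp: mixture_def)
  have "(mixture N I \<mu> M * B) $$ (i, j) = (\<Sum>l<N. \<Sum>y\<in>I. of_real (\<mu> y) * (M y $$ (i, l) * B $$ (l, j)))"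
    unfolding mult_mat_index[OF mixture_carrier assms(2) ij]
    by (rule sum.cong[OF refl]) (use ij in \<open>simp add: mixture_index sum_distrib_left sum_distrib_right mult_ac\<close>)
  also have "\<dots> = (\<Sum>y\<in>I. of_real (\<mu> y) * (\<Sum>l<N. M y $$ (i, l) * B $$ (l, j)))"
    by (subst sum.swap) (simp add: sum_distrib_left)
  finally show "(mixture N I \<mu> M * B) $$ (i, j) = mixture N I \<mu> (\<lambda>y. M y * B) $$ (i, j)"
    using ij mult_mat_index[OF assms ij] by (simp add: mixture_index)
qed (use assms in \<open>auto simp: mixture_def\<close>)

lemma mult_mixture:
  assumes "\<And>y. y \<in> I \<Longrightarrow> M y \<in> carrier_mat N N" "B \<in> carrier_mat N N"
  shows "B * mixture N I \<mu> M = mixture N I \<mu> (\<lambda>y. B * M y)"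
proof (rule eq_matI)
  fix i j assume "i < dim_row (mixture N I \<mu> (\<lambda>y. B * M y))" "j < dim_col (mixture N I \<mu> (\<lambda>y. B * M y))"
  hence ij: "i < N" "j < N" by (auto simp: mixture_def)
  have "(B * mixture N I \<mu> M) $$ (i, j) = (\<Sum>l<N. \<Sum>y\<in>I. of_real (\<mu> y) * (B $$ (i, l) * M y $$ (l, j)))"
    unfolding mult_mat_index[OF assms(2) mixture_carrier ij]
    by (rule sum.cong[OF refl]) (use ij in \<open>simp add: mixture_index sum_distrib_left mult_ac\<close>)
  also have "\<dots> = (\<Sum>y\<in>I. of_real (\<mu> y) * (\<Sum>l<N. B $$ (i, l) * M y $$ (l, j)))"
    by (subst sum.swap) (simp add: sum_distrib_left)
  finally show "(B * mixture N I \<mu> M) $$ (i, j) = mixture N I \<mu> (\<lambda>y. B * M y) $$ (i, j)"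
    using ij mult_mat_index[OF assms(2,1) ij] by (simp add: mixture_index)
qed (use assms in \<open>auto simp: mixture_def\<close>)

text \<open>Independence of the diagonalisation picked by \<open>SOME\<close>. Two diagonalisations
  of one matrix differ by a unitary \<open>W\<close> intertwining the diagonal parts. Such an
  intertwiner connects only equal eigenvalues, so it also intertwines the images of the diagonal
  parts under \<open>f\<close>.\<close>

lemma mat_fun_diagonalised:
  assumes U: "unitary N U"
  shows "mat_fun f (U * diag_of N lam * adj U) = U * diag_of N (\<lambda>i. f (lam i)) * adj U"
proof -
  define A where "A = U * diag_of N lam * adj U"
  have Uc: "U \<in> carrier_mat N N" "adj U \<in> carrier_mat N N" using U by (auto simp: unitary_def)
  have dim: "dim_row A = N" using Uc by (simp add: A_def)
  define P where "P = (\<lambda>(V, mu). unitary N V \<and> A = V * diag_of N mu * adj V)"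
  obtain V mu where Vmu: "(SOME x. P x) = (V, mu)" by (metis surj_pair)
  have "P (U, lam)" using U by (simp add: P_def A_def)
  hence "P (V, mu)" unfolding Vmu[symmetric] by (rule someI)
  hence V: "unitary N V" and AV: "A = V * diag_of N mu * adj V" by (auto simp: P_def)
  have Vc: "V \<in> carrier_mat N N" "adj V \<in> carrier_mat N N" using V by (auto simp: unitary_def)
  define W where "W = adj V * U"
  have Wc: "W \<in> carrier_mat N N" using Vc Uc by (simp add: W_def)
  have "adj V * A * U = W * diag_of N lam"
    using U Uc Vc
    by (simp add: A_def W_def assoc_mult_mat[of _ N N _ N _ N] unitary_def right_mult_one_mat[of _ N N])
  moreover have "adj V * A * U = diag_of N mu * W"
    using unitary_cancel(2)[OF V] Uc Vc by (simp add: AV W_def assoc_mult_mat[of _ N N _ N _ N])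
  ultimately have WD: "W * diag_of N lam = diag_of N mu * W" by simp
  have "W * diag_of N (\<lambda>i. f (lam i)) = diag_of N (\<lambda>i. f (mu i)) * W"
  proof (rule eq_matI)
    fix i j assume "i < dim_row (diag_of N (\<lambda>i. f (mu i)) * W)" "j < dim_col (diag_of N (\<lambda>i. f (mu i)) * W)"
    hence ij: "i < N" "j < N" using Wc by (auto simp: diag_of_def)
    have "W $$ (i, j) * of_real (lam j) = of_real (mu i) * W $$ (i, j)"
      using arg_cong[OF WD, of "\<lambda>M. M $$ (i, j)"]
      by (simp add: mult_diag_of_index[OF Wc ij] diag_of_mult_index[OF Wc ij])
    hence "W $$ (i, j) = 0 \<or> lam j = mu i" by (auto simp: mult.commute)
    thus "(W * diag_of N (\<lambda>i. f (lam i))) $$ (i, j) = (diag_of N (\<lambda>i. f (mu i)) * W) $$ (i, j)"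
      unfolding mult_diag_of_index[OF Wc ij] diag_of_mult_index[OF Wc ij] by auto
  qed (use Wc in \<open>auto simp: diag_of_def\<close>)
  hence "V * (W * diag_of N (\<lambda>i. f (lam i))) * adj U = V * (diag_of N (\<lambda>i. f (mu i)) * W) * adj U" by simp
  moreover have "V * (W * diag_of N (\<lambda>i. f (lam i))) * adj U = U * diag_of N (\<lambda>i. f (lam i)) * adj U"
    using unitary_cancel(1)[OF V] Uc Vc by (simp add: W_def assoc_mult_mat[of _ N N _ N _ N])
  moreover have "V * (diag_of N (\<lambda>i. f (mu i)) * W) * adj U = V * diag_of N (\<lambda>i. f (mu i)) * adj V"
    using U Uc Vc
    by (simp add: W_def assoc_mult_mat[of _ N N _ N _ N] unitary_def right_mult_one_mat[of _ N N])
  moreover have "mat_fun f A = V * diag_of N (\<lambda>i. f (mu i)) * adj V"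
    unfolding mat_fun_def Let_def dim P_def[symmetric] Vmu by simp
  ultimately show ?thesis by (simp add: A_def)
qed

lemma mat_fun_hermitian:
  assumes "hermitian N A"
  shows "hermitian N (mat_fun f A)"
proof -
  obtain U lam where U: "unitary N U" and A: "A = U * diag_of N lam * adj U"
    using hermitian_diagonalisable[OF assms] by blast
  have "hermitian N (diag_of N (\<lambda>i. f (lam i)))" by (simp add: hermitian_def)
  from hermitian_conj[OF this unitary_carrier[OF U]] show ?thesis
    unfolding A mat_fun_diagonalised[OF U] .
qed

text \<open>If \<open>U\<close> diagonalises \<open>A\<close>, then \<open>T * U\<close>
  diagonalises the conjugate with the same eigenvalues.\<close>

lemma mat_fun_conj:
  assumes "hermitian N A" and T: "unitary N T"
  shows "mat_fun f (T * A * adj T) = T * mat_fun f A * adj T"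
proof -
  obtain U lam where U: "unitary N U" and A: "A = U * diag_of N lam * adj U"
    using hermitian_diagonalisable[OF assms(1)] by blast
  have c: "U \<in> carrier_mat N N" "T \<in> carrier_mat N N" using U T by (auto simp: unitary_def)
  have *: "T * (U * diag_of N g * adj U) * adj T = (T * U) * diag_of N g * adj (T * U)" for g
    using c by (simp add: adj_mult[of _ N N _ N] assoc_mult_mat[of _ N N _ N _ N])
  show ?thesis
    unfolding A * mat_fun_diagonalised[OF U] mat_fun_diagonalised[OF unitary_mult[OF T U]] ..
qed

lemma mtrace_mat_fun_diagonalised:
  assumes "unitary N U"
  shows "mtrace (mat_fun f (U * diag_of N lam * adj U)) = of_real (\<Sum>i<N. f (lam i))"
  unfolding mat_fun_diagonalised[OF assms] mtrace_conj_unitary[OF assms diag_of_carrier]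
  unfolding mtrace_sum[OF diag_of_carrier] by (simp add: diag_of_def)

text \<open>The diagonal in a second orthonormal basis averages the eigenvalues with weights
  \<open>(cmod (W $$ (i, k)))\<^sup>2\<close>. These are doubly stochastic: unit row sums permit
  Jensen's inequality for each entry, unit column sums reassemble the full spectrum.\<close>

lemma peierls_inequality:
  assumes U: "unitary N U" and V: "unitary N V" and A: "A = U * diag_of N lam * adj U"
    and f: "convex_on S f" and lam: "\<And>i. i < N \<Longrightarrow> lam i \<in> S"
  shows "(\<Sum>i<N. f (Re ((adj V * A * V) $$ (i, i)))) \<le> (\<Sum>i<N. f (lam i))"
proof (cases "N = 0")
  case False
  have c: "U \<in> carrier_mat N N" "adj V \<in> carrier_mat N N" "V \<in> carrier_mat N N"
    using U V by (auto simp: unitary_def)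
  define W where "W = adj V * U"
  have W: "unitary N W" using U V by (simp add: W_def unitary_mult)
  have Wc: "W \<in> carrier_mat N N" using W by (rule unitary_carrier)
  have eq: "adj V * A * V = W * diag_of N lam * adj W"
    using c by (simp add: A W_def adj_mult[of _ N N _ N] assoc_mult_mat[of _ N N _ N _ N])
  define p where "p i k = (cmod (W $$ (i, k)))\<^sup>2" for i k
  have p: "of_real (p i k) = W $$ (i, k) * cnj (W $$ (i, k))" for i k
    unfolding p_def by (rule complex_norm_square)
  have p1: "(\<Sum>k<N. p i k) = 1" if "i < N" for i
  proof -
    have "complex_of_real (\<Sum>k<N. p i k) = of_real 1"
      using unitary_rows[OF W that that] by (simp add: p)
    thus ?thesis unfolding of_real_eq_iff .
  qed
  have p2: "(\<Sum>i<N. p i k) = 1" if "k < N" for k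
  proof -
    have "complex_of_real (\<Sum>i<N. p i k) = of_real 1"
      using unitary_columns[OF W that that] by (simp add: p mult.commute)
    thus ?thesis unfolding of_real_eq_iff .
  qed
  have diag: "Re ((adj V * A * V) $$ (i, i)) = (\<Sum>k<N. p i k * lam k)" if "i < N" for i
  proof -
    have "(adj V * A * V) $$ (i, i) = of_real (\<Sum>k<N. p i k * lam k)"
      unfolding eq diagonalised_index[OF Wc that that] by (simp add: p mult_ac)
    thus ?thesis by simp
  qed
  have "(\<Sum>i<N. f (Re ((adj V * A * V) $$ (i, i)))) = (\<Sum>i<N. f (\<Sum>k<N. p i k *\<^sub>R lam k))"
    by (intro sum.cong refl) (simp add: diag)
  also have "\<dots> \<le> (\<Sum>i<N. \<Sum>k<N. p i k * f (lam k))"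
    using False p1 lam by (intro sum_mono convex_on_sum[OF _ _ f]) (auto simp: p_def)
  also have "\<dots> = (\<Sum>k<N. (\<Sum>i<N. p i k) * f (lam k))"
    by (subst sum.swap) (simp add: sum_distrib_right)
  also have "\<dots> = (\<Sum>i<N. f (lam i))" using p2 by simp
  finally show ?thesis .
qed simp

text \<open>Everything is measured in an eigenbasis of the mixture. There the eigenvalues of the
  mixture are averages of the diagonals of the components, so Jensen's inequality applies to each
  eigenvalue and \<open>peierls_inequality\<close> to each component.\<close>

lemma trace_mat_fun_convex:
  assumes I: "finite I" and mu: "\<And>y. y \<in> I \<Longrightarrow> 0 \<le> \<mu> y" "sum \<mu> I = 1"
    and M: "\<And>y. y \<in> I \<Longrightarrow> psd N (M y)" and f: "convex_on {0..} f"
  shows "Re (mtrace (mat_fun f (mixture N I \<mu> M))) \<le> (\<Sum>y\<in>I. \<mu> y * Re (mtrace (mat_fun f (M y))))"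
proof -
  have psd: "psd N (mixture N I \<mu> M)" using mu M by (intro psd_mixture)
  obtain V nu where V: "unitary N V" and eq: "mixture N I \<mu> M = V * diag_of N nu * adj V"
    using hermitian_diagonalisable[OF psd_hermitian[OF psd]] by blast
  have c: "V \<in> carrier_mat N N" "adj V \<in> carrier_mat N N" using V by (auto simp: unitary_def)
  have Mc: "M y \<in> carrier_mat N N" if "y \<in> I" for y using M[OF that] by (rule psd_carrier)
  define h where "h y i = Re ((adj V * M y * V) $$ (i, i))" for y i
  have h0: "h y i \<ge> 0" if "y \<in> I" "i < N" for y i
    using psd_diag_nonneg[OF psd_conj[OF M[OF that(1)] c(2)] that(2)] by (simp add: h_def)
  have "diag_of N nu = adj V * mixture N I \<mu> M * V"
    using conj_diagonalised[OF V eq] by simp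
  also have "\<dots> = mixture N I \<mu> (\<lambda>y. adj V * M y * V)"
    using c Mc by (simp add: mixture_mult mult_mixture)
  finally have d: "diag_of N nu = mixture N I \<mu> (\<lambda>y. adj V * M y * V)" .
  have nu: "nu i = (\<Sum>y\<in>I. \<mu> y *\<^sub>R h y i)" if "i < N" for i
    using arg_cong[OF d, of "\<lambda>A. Re (A $$ (i, i))"] that
    by (simp add: mixture_index diag_of_def h_def)
  have pe: "(\<Sum>i<N. f (h y i)) \<le> Re (mtrace (mat_fun f (M y)))" if y: "y \<in> I" for y
  proof -
    obtain U lam where U: "unitary N U" and A: "M y = U * diag_of N lam * adj U"
      using hermitian_diagonalisable[OF psd_hermitian[OF M[OF y]]] by blast
    have "(\<Sum>i<N. f (h y i)) \<le> (\<Sum>i<N. f (lam i))"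
      unfolding h_def using psd_eigenvalues_nonneg[OF M[OF y] U A]
      by (intro peierls_inequality[OF U V A f]) auto
    thus ?thesis unfolding A mtrace_mat_fun_diagonalised[OF U] by simp
  qed
  have "I \<noteq> {}" using mu by auto
  have "Re (mtrace (mat_fun f (mixture N I \<mu> M))) = (\<Sum>i<N. f (\<Sum>y\<in>I. \<mu> y *\<^sub>R h y i))"
    unfolding eq mtrace_mat_fun_diagonalised[OF V] using nu by simp
  also have "\<dots> \<le> (\<Sum>i<N. \<Sum>y\<in>I. \<mu> y * f (h y i))"
    using mu h0 \<open>I \<noteq> {}\<close> by (intro sum_mono convex_on_sum[OF I _ f]) auto
  also have "\<dots> = (\<Sum>y\<in>I. \<mu> y * (\<Sum>i<N. f (h y i)))"
    by (subst sum.swap) (simp add: sum_distrib_left)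
  also have "\<dots> \<le> (\<Sum>y\<in>I. \<mu> y * Re (mtrace (mat_fun f (M y))))"
    using mu pe by (intro sum_mono mult_left_mono) auto
  finally show ?thesis .
qed

section \<open>Quasi-convexity of the sandwiched divergence\<close>

text \<open>Derivative tests cover the open half-line, while spectra may contain \<open>0\<close>,
  where the functional calculus assigns the value \<open>0\<close>. For chords starting at
  \<open>0\<close>, convexity is just the inequality \<open>f (t * x) \<le> t * f x\<close>.\<close>

lemma convex_on_extend_zero:
  fixes f :: "real \<Rightarrow> real"
  assumes conv: "convex_on {0<..} g" and eq: "\<And>x. 0 < x \<Longrightarrow> f x = g x" and 0: "f 0 = 0"
    and scale: "\<And>t x. 0 < t \<Longrightarrow> t < 1 \<Longrightarrow> 0 < x \<Longrightarrow> f (t * x) \<le> t * f x"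
  shows "convex_on {0..} f"
proof (rule convex_on_linorderI)
  fix t x y :: real assume t: "t > 0" "t < 1" and xy: "x \<in> {0..}" "y \<in> {0..}" "x < y"
  show "f ((1 - t) *\<^sub>R x + t *\<^sub>R y) \<le> (1 - t) * f x + t * f y"
  proof (cases "x = 0")
    case True
    thus ?thesis using scale[OF t, of y] xy 0 by simp
  next
    case False
    hence "0 < (1 - t) * x + t * y" using t xy by (simp add: add_pos_pos)
    thus ?thesis using False convex_onD[OF conv, of t x y] t xy by (simp add: eq)
  qed
qed simp

lemma convex_on_positive_powr:
  assumes "1 \<le> a"
  shows "convex_on {0..} (\<lambda>x::real. if x > 0 then x powr a else 0)"
proof (rule convex_on_extend_zero)
  show "convex_on {0<..} (\<lambda>x. x powr a)" by (rule powr_convex[OF assms])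
  fix t x :: real assume t: "0 < t" "t < 1" "0 < x"
  have "t powr a \<le> t powr 1" using t assms by (intro powr_mono') auto
  thus "(if t * x > 0 then (t * x) powr a else 0) \<le> t * (if x > 0 then x powr a else 0)"
    using t by (simp add: powr_mult mult_right_mono)
qed simp_all

text \<open>Concavity of the power, negated so that the convex trace inequality also serves the
  orders below one.\<close>

lemma convex_on_neg_positive_powr:
  assumes "0 < a" "a \<le> 1"
  shows "convex_on {0..} (\<lambda>x::real. - (if x > 0 then x powr a else 0))"
proof (rule convex_on_extend_zero)
  show "convex_on {0<..} (\<lambda>x::real. - (x powr a))"
  proof (rule f''_ge0_imp_convex)
    show "((\<lambda>x. - (x powr a)) has_real_derivative - (a * x powr (a - 1))) (at x)" if "x \<in> {0<..}" for x
      using that by (auto intro!: derivative_eq_intros)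
    show "((\<lambda>x. - (a * x powr (a - 1))) has_real_derivative - (a * ((a - 1) * x powr (a - 1 - 1)))) (at x)"
      if "x \<in> {0<..}" for x
      using that by (auto intro!: derivative_eq_intros)
    show "0 \<le> - (a * ((a - 1) * x powr (a - 1 - 1)))" for x :: real
      using assms by (simp add: mult_nonneg_nonpos mult_nonpos_nonneg)
  qed simp
  fix t x :: real assume t: "0 < t" "t < 1" "0 < x"
  have "t powr 1 \<le> t powr a" using t assms by (intro powr_mono') auto
  thus "- (if t * x > 0 then (t * x) powr a else 0) \<le> t * - (if x > 0 then x powr a else 0)"
    using t by (simp add: powr_mult mult_right_mono)
qed simp_all

text \<open>The entropy function behind order one; its value at \<open>0\<close> is the limit from
  the right.\<close>

lemma convex_on_x_ln_x: "convex_on {0..} (\<lambda>x::real. x * (if x > 0 then ln x else 0))"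
proof (rule convex_on_extend_zero)
  show "convex_on {0<..} (\<lambda>x::real. x * ln x)"
  proof (rule f''_ge0_imp_convex)
    show "((\<lambda>x. x * ln x) has_real_derivative ln x + 1) (at x)" if "x \<in> {0<..}" for x :: real
      using that by (auto intro!: derivative_eq_intros)
    show "((\<lambda>x. ln x + 1) has_real_derivative 1 / x) (at x)" if "x \<in> {0<..}" for x :: real
      using that by (auto intro!: derivative_eq_intros)
  qed auto
  fix t x :: real assume t: "0 < t" "t < 1" "0 < x"
  have "t * x * ln t \<le> 0" using t by (simp add: mult_nonneg_nonpos)
  thus "t * x * (if t * x > 0 then ln (t * x) else 0) \<le> t * (x * (if x > 0 then ln x else 0))"
    using t by (simp add: ln_mult algebra_simps)
qed simp_all

section \<open>Sandwiched matrices and their traces\<close>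

lemma mtrace_minus:
  assumes "A \<in> carrier_mat N N" "B \<in> carrier_mat N N"
  shows "mtrace (A - B) = mtrace A - mtrace B"
  using assms by (simp add: mtrace_def sum_subtractf)

lemma mtrace_smult: "A \<in> carrier_mat N N \<Longrightarrow> mtrace (c \<cdot>\<^sub>m A) = c * mtrace A"
  by (simp add: mtrace_def sum_distrib_left)

lemma psd_trace_nonneg: "psd N A \<Longrightarrow> 0 \<le> Re (mtrace A)"
  by (auto simp: mtrace_sum[OF psd_carrier] psd_diag_nonneg intro!: sum_nonneg)

lemma mat_powr_hermitian: "hermitian N A \<Longrightarrow> hermitian N (mat_powr A p)"
  by (simp add: mat_powr_def mat_fun_hermitian)

lemma mat_ln_hermitian: "hermitian N A \<Longrightarrow> hermitian N (mat_ln A)"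
  by (simp add: mat_ln_def mat_fun_hermitian)

lemma sandwich_psd:
  assumes "psd N A" "hermitian N S"
  shows "psd N (S * A * S)"
  using psd_conj[OF assms(1) hermitian_carrier[OF assms(2)]] assms(2) by (simp add: hermitian_def)

lemma mult_smult_diff_mult:
  fixes A :: "complex mat"
  assumes "P \<in> carrier_mat N N" "A \<in> carrier_mat N N" "B \<in> carrier_mat N N" "Q \<in> carrier_mat N N"
  shows "P * (c \<cdot>\<^sub>m A - B) * Q = c \<cdot>\<^sub>m (P * A * Q) - P * B * Q"
proof -
  have "P * (c \<cdot>\<^sub>m A - B) = c \<cdot>\<^sub>m (P * A) - P * B"
    using assms by (simp add: mult_minus_distrib_mat[of _ N N _ N] mult_smult_distrib[of _ N N _ N])
  thus ?thesis
    using assms by (simp add: minus_mult_distrib_mat[of _ N N _ _ N] mult_smult_assoc_mat[of _ N N _ N])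
qed

text \<open>Ensures that the logarithm in the divergence is taken of a positive number. If the trace
  were zero, all eigenvalues of the sandwiched matrix would vanish. In an eigenbasis of
  \<open>\<sigma>\<close> the diagonal of \<open>R\<close> would then be zero at positive
  eigenvalues, and by domination also at zero eigenvalues, contradicting unit trace.\<close>

lemma trace_sandwich_powr_pos:
  assumes R: "density N R" and S: "psd N \<sigma>" and D: "psd N (of_real c \<cdot>\<^sub>m \<sigma> - R)"
  shows "0 < Re (mtrace (mat_powr (mat_powr \<sigma> s * R * mat_powr \<sigma> s) a))"
proof (rule ccontr)
  have Rp: "psd N R" and Rt: "mtrace R = 1" using R by (auto simp: density_def)
  have Rc: "R \<in> carrier_mat N N" using Rp by (rule psd_carrier)
  obtain U lam where U: "unitary N U" and SU: "\<sigma> = U * diag_of N lam * adj U"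
    using hermitian_diagonalisable[OF psd_hermitian[OF S]] by blast
  have Uc: "U \<in> carrier_mat N N" "adj U \<in> carrier_mat N N" using U by (auto simp: unitary_def)
  define g where "g i = (if lam i > 0 then lam i powr s else 0)" for i
  have P: "mat_powr \<sigma> s = U * diag_of N g * adj U"
    by (simp add: mat_powr_def SU mat_fun_diagonalised[OF U] g_def[abs_def])
  define Q where "Q = mat_powr \<sigma> s * R * mat_powr \<sigma> s"
  have Q: "psd N Q" unfolding Q_def
    by (rule sandwich_psd[OF Rp mat_powr_hermitian[OF psd_hermitian[OF S]]])
  define R' where "R' = adj U * R * U"
  have R'c: "R' \<in> carrier_mat N N" using Uc Rc by (simp add: R'_def)
  have R': "psd N R'" using psd_conj[OF Rp Uc(2)] by (simp add: R'_def)
  assume neg: "\<not> 0 < Re (mtrace (mat_powr (mat_powr \<sigma> s * R * mat_powr \<sigma> s) a))"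
  obtain V q where V: "unitary N V" and QV: "Q = V * diag_of N q * adj V"
    using hermitian_diagonalisable[OF psd_hermitian[OF Q]] by blast
  have q: "0 \<le> q i" if "i < N" for i using psd_eigenvalues_nonneg[OF Q V QV that] .
  have "(\<Sum>i<N. if q i > 0 then q i powr a else 0) \<le> 0"
    using neg unfolding Q_def[symmetric]
    unfolding mat_powr_def QV mtrace_mat_fun_diagonalised[OF V] by simp
  hence "(\<Sum>i<N. if q i > 0 then q i powr a else 0) = 0"
    by (intro antisym sum_nonneg) auto
  hence "(if q i > 0 then q i powr a else 0) = 0" if "i < N" for i
    using that by (subst (asm) sum_nonneg_eq_0_iff) auto
  \<comment> \<open>A power of a positive number is positive whatever the sign of \<open>a\<close>,
    so a zero term can only come from a zero eigenvalue.\<close>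
  hence q0: "q i = 0" if "i < N" for i using q[OF that] that by (force split: if_splits)
  have "mtrace Q = mtrace (diag_of N q)" unfolding QV by (rule mtrace_conj_unitary[OF V diag_of_carrier])
  also have "\<dots> = 0" using q0 unfolding mtrace_sum[OF diag_of_carrier] by (simp add: diag_of_def)
  finally have "mtrace Q = 0" .
  moreover have "Q = U * (diag_of N g * R' * diag_of N g) * adj U"
    using Uc Rc by (simp add: Q_def P R'_def assoc_mult_mat[of _ N N _ N _ N])
  ultimately have "mtrace (diag_of N g * R' * diag_of N g) = 0"
    using mtrace_conj_unitary[OF U, of "diag_of N g * R' * diag_of N g"] R'c by simp
  moreover have "(diag_of N g * R' * diag_of N g) $$ (i, i) = of_real (g i) * R' $$ (i, i) * of_real (g i)"
    if "i < N" for i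
    using that R'c by (simp add: mult_diag_of_index[of _ N] diag_of_mult_index[of _ N])
  ultimately have "(\<Sum>i<N. of_real (g i) * R' $$ (i, i) * of_real (g i)) = 0"
    using R'c by (simp add: mtrace_sum[of _ N])
  hence "Re (\<Sum>i<N. of_real (g i) * R' $$ (i, i) * of_real (g i)) = 0" by simp
  hence "(\<Sum>i<N. (g i)\<^sup>2 * Re (R' $$ (i, i))) = 0" by (simp add: power2_eq_square mult_ac)
  hence gR: "(g i)\<^sup>2 * Re (R' $$ (i, i)) = 0" if "i < N" for i
    using that psd_diag_nonneg[OF R'] by (subst (asm) sum_nonneg_eq_0_iff) auto
  have D': "adj U * (of_real c \<cdot>\<^sub>m \<sigma> - R) * U = of_real c \<cdot>\<^sub>m diag_of N lam - R'"
  proof -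
    have Sc: "\<sigma> \<in> carrier_mat N N" using S by (rule psd_carrier)
    have "adj U * (of_real c \<cdot>\<^sub>m \<sigma> - R) * U = of_real c \<cdot>\<^sub>m (adj U * \<sigma> * U) - adj U * R * U"
      using Uc Sc Rc by (intro mult_smult_diff_mult)
    thus ?thesis using conj_diagonalised[OF U SU] by (simp add: R'_def)
  qed
  \<comment> \<open>The sandwich does not see the kernel of \<open>\<sigma>\<close>, where
    \<open>mat_powr\<close> is zero; there the domination takes over.\<close>
  have "Re (R' $$ (i, i)) = 0" if i: "i < N" for i
  proof (cases "lam i > 0")
    case True
    thus ?thesis using gR[OF i] by (simp add: g_def)
  next
    case False
    hence "lam i = 0" using psd_eigenvalues_nonneg[OF S U SU i] by simp
    moreover have "psd N (of_real c \<cdot>\<^sub>m diag_of N lam - R')"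
      using psd_conj[OF D Uc(2)] D' by simp
    note psd_diag_nonneg[OF this i]
    ultimately show ?thesis
      using psd_diag_nonneg[OF R' i] i R'c by (simp add: diag_of_def)
  qed
  hence "Re (mtrace R') = 0" using R'c by (simp add: mtrace_sum)
  moreover have "mtrace R' = 1"
    using mtrace_conj_unitary[OF unitary_adj[OF U] Rc] Rt by (simp add: R'_def)
  ultimately show False by simp
qed

lemma mult_mat_ln_self:
  assumes "hermitian N R"
  shows "R * mat_ln R = mat_fun (\<lambda>x. x * (if x > 0 then ln x else 0)) R"
proof -
  obtain U lam where U: "unitary N U" and RU: "R = U * diag_of N lam * adj U"
    using hermitian_diagonalisable[OF assms] by blast
  have c: "U \<in> carrier_mat N N" "adj U \<in> carrier_mat N N" using U by (auto simp: unitary_def)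
  have "(U * diag_of N lam * adj U) * (U * diag_of N g * adj U) = U * (diag_of N lam * diag_of N g) * adj U" for g
    using c unitary_cancel(2)[OF U] by (simp add: assoc_mult_mat[of _ N N _ N _ N])
  thus ?thesis unfolding mat_ln_def RU mat_fun_diagonalised[OF U] diag_of_mult by simp
qed

text \<open>Separates a trace function of \<open>R\<close>, to which scalar convexity applies, from
  a term linear in \<open>R\<close>.\<close>

lemma relative_entropy_split:
  assumes "hermitian N R" "hermitian N \<sigma>"
  shows "Re (mtrace (R * (mat_ln R - mat_ln \<sigma>))) =
    Re (mtrace (mat_fun (\<lambda>x. x * (if x > 0 then ln x else 0)) R)) - Re (mtrace (R * mat_ln \<sigma>))"
proof -
  have c: "R \<in> carrier_mat N N" "mat_ln R \<in> carrier_mat N N" "mat_ln \<sigma> \<in> carrier_mat N N"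
    using assms mat_ln_hermitian hermitian_carrier by blast+
  have "R * (mat_ln R - mat_ln \<sigma>) = R * mat_ln R - R * mat_ln \<sigma>"
    using c by (simp add: mult_minus_distrib_mat[of _ N N])
  thus ?thesis using c by (simp add: mtrace_minus[of _ N] mult_mat_ln_self[OF assms(1), symmetric])
qed

text \<open>Invariance under conjugation is rewritten as commutation, the form in which
  \<open>T\<close> is later pulled through powers and logarithms of \<open>\<sigma>\<close>.\<close>

lemma conj_fixed:
  assumes T: "unitary N T" and L: "L \<in> carrier_mat N N" and inv: "T * L * adj T = L"
  shows "L * T = T * L" "adj T * L = L * adj T"
proof -
  have c: "T \<in> carrier_mat N N" "adj T \<in> carrier_mat N N" using T by (auto simp: unitary_def)
  have "L * T = T * L * adj T * T" by (simp only: inv)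
  thus "L * T = T * L" using unitary_cancel(4)[OF T, of "T * L"] c L by simp
  have "adj T * L = adj T * (T * L * adj T)" by (simp only: inv)
  also have "\<dots> = adj T * (T * (L * adj T))" using c L by (simp add: assoc_mult_mat[of _ N N _ N _ N])
  finally show "adj T * L = L * adj T" using unitary_cancel(2)[OF T, of "L * adj T"] c L by simp
qed

lemma psd_conj_unitary_iff:
  assumes T: "unitary N T" and A: "A \<in> carrier_mat N N"
  shows "psd N (T * A * adj T) \<longleftrightarrow> psd N A"
proof
  assume "psd N (T * A * adj T)"
  from psd_conj[OF this, of "adj T"] have "psd N (adj T * (T * A * adj T) * adj (adj T))"
    using T by (simp add: unitary_def)
  moreover have "adj T * (T * A * adj T) * T = A"
    using unitary_cancel(2,4)[OF T] A T
    by (simp add: assoc_mult_mat[of _ N N _ N _ N] unitary_def right_mult_one_mat[of _ N N])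
  ultimately show "psd N A" by simp
qed (use T in \<open>auto intro: psd_conj unitary_carrier\<close>)

text \<open>A unitary fixing \<open>\<sigma>\<close> by conjugation fixes every function of
  \<open>\<sigma>\<close>, so the sandwiched matrix is itself conjugated and its trace functionals
  keep their values. Domination by a multiple of \<open>\<sigma>\<close> puts both states in the
  branch where the support condition holds.\<close>

lemma sandwiched_renyi_conj_unitary:
  assumes R: "psd N R" and S: "psd N \<sigma>" and D: "psd N (of_real c \<cdot>\<^sub>m \<sigma> - R)"
    and T: "unitary N T" and inv: "T * \<sigma> * adj T = \<sigma>"
  shows "sandwiched_renyi N \<alpha> (T * R * adj T) \<sigma> = sandwiched_renyi N \<alpha> R \<sigma>"
proof -
  have Tc: "T \<in> carrier_mat N N" "adj T \<in> carrier_mat N N" using T by (auto simp: unitary_def)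
  have Rc: "R \<in> carrier_mat N N" and Sc: "\<sigma> \<in> carrier_mat N N" using R S by (auto dest: psd_carrier)
  have Rh: "hermitian N R" and Sh: "hermitian N \<sigma>" using R S by (auto dest: psd_hermitian)
  have conj_diff: "T * (of_real b \<cdot>\<^sub>m \<sigma> - R) * adj T = of_real b \<cdot>\<^sub>m \<sigma> - T * R * adj T" for b
  proof -
    have "T * (of_real b \<cdot>\<^sub>m \<sigma> - R) * adj T = of_real b \<cdot>\<^sub>m (T * \<sigma> * adj T) - T * R * adj T"
      using Tc Sc Rc by (intro mult_smult_diff_mult)
    thus ?thesis by (simp only: inv)
  qed
  have psd_iff: "psd N (of_real b \<cdot>\<^sub>m \<sigma> - T * R * adj T) \<longleftrightarrow> psd N (of_real b \<cdot>\<^sub>m \<sigma> - R)" for b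
    using psd_conj_unitary_iff[OF T, of "of_real b \<cdot>\<^sub>m \<sigma> - R"] minus_carrier_mat[OF Rc]
    by (simp add: conj_diff)
  have supp: "supp_le N R \<sigma>" "supp_le N (T * R * adj T) \<sigma>"
    using supp_le_if_dominated[OF R S D] supp_le_if_dominated[OF psd_conj[OF R Tc(1)] S] D psd_iff by auto
  have fun_fix: "T * mat_fun f \<sigma> * adj T = mat_fun f \<sigma>" for f
    using mat_fun_conj[OF Sh T, of f] inv by simp
  have fc: "mat_fun f \<sigma> \<in> carrier_mat N N" for f using mat_fun_hermitian[OF Sh] by (rule hermitian_carrier)
  have 1: "mtrace (mat_fun f (T * R * adj T)) = mtrace (mat_fun f R)" if "hermitian N R" for f R
    using mat_fun_conj[OF that T] mtrace_conj_unitary[OF T hermitian_carrier[OF mat_fun_hermitian[OF that]]]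
    by simp
  have sand: "mat_powr \<sigma> s * (T * R * adj T) * mat_powr \<sigma> s = T * (mat_powr \<sigma> s * R * mat_powr \<sigma> s) * adj T" for s
  proof -
    define L where "L = mat_powr \<sigma> s"
    have Lc: "L \<in> carrier_mat N N" using fc by (simp add: L_def mat_powr_def)
    have cm: "L * T = T * L" "adj T * L = L * adj T"
      using conj_fixed[OF T Lc] fun_fix by (auto simp: L_def mat_powr_def)
    have "L * (T * R * adj T) * L = (L * T) * R * (adj T * L)"
      using Lc Tc Rc by (simp add: assoc_mult_mat[of _ N N _ N _ N])
    also have "\<dots> = T * (L * R * L) * adj T"
      using Lc Tc Rc by (simp add: cm assoc_mult_mat[of _ N N _ N _ N])
    finally show ?thesis by (simp add: L_def)
  qed
  have sand_h: "hermitian N (mat_powr \<sigma> s * R * mat_powr \<sigma> s)" for s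
    by (intro psd_hermitian sandwich_psd R mat_powr_hermitian Sh)
  have ln: "mtrace (T * R * adj T * mat_ln \<sigma>) = mtrace (R * mat_ln \<sigma>)"
  proof -
    define L where "L = mat_ln \<sigma>"
    have Lc: "L \<in> carrier_mat N N" using fc by (simp add: L_def mat_ln_def)
    have cm: "adj T * L = L * adj T"
      using conj_fixed[OF T Lc] fun_fix by (auto simp: L_def mat_ln_def)
    have "T * R * adj T * L = T * (R * L) * adj T"
      using Lc Tc Rc cm by (simp add: assoc_mult_mat[of _ N N _ N _ N])
    thus ?thesis using mtrace_conj_unitary[OF T, of "R * L"] Rc Lc by (simp add: L_def)
  qed
  show ?thesis
    unfolding sandwiched_renyi_def Let_def sand psd_iff
    using supp relative_entropy_split[OF Rh Sh] relative_entropy_split[OF hermitian_conj[OF Rh Tc(1)] Sh]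
      1[OF Rh] 1[OF sand_h] ln
    by (simp add: mat_powr_def)
qed

lemma ln_le_iff_le_exp: "0 < x \<Longrightarrow> ln x \<le> y \<longleftrightarrow> x \<le> exp (y::real)"
  by (metis exp_le_cancel_iff exp_ln)

text \<open>Quasi-convexity, phrased with a common upper bound \<open>B\<close>. At order infinity
  the domination constants average; at order one the entropy part is convex and the rest linear. For
  the other orders the trace of the power is convex above one and concave below one, and dividing by
  \<open>a - 1\<close> reverses the inequality exactly in the second case.\<close>

lemma sandwiched_renyi_mixture_le:
  assumes I: "finite I" and mu: "\<And>y. y \<in> I \<Longrightarrow> 0 \<le> \<mu> y" "sum \<mu> I = 1"
    and M: "\<And>y. y \<in> I \<Longrightarrow> density N (M y)" and S: "density N \<sigma>"
    and c: "c > 0" and D: "\<And>y. y \<in> I \<Longrightarrow> psd N (of_real c \<cdot>\<^sub>m \<sigma> - M y)"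
    and \<alpha>: "ereal (1 / 2) \<le> \<alpha>"
    and B: "\<And>y. y \<in> I \<Longrightarrow> sandwiched_renyi N \<alpha> (M y) \<sigma> \<le> B"
  shows "sandwiched_renyi N \<alpha> (mixture N I \<mu> M) \<sigma> \<le> B"
proof (cases B)
  case PInf
  thus ?thesis by simp
next
  case MInf
  \<comment> \<open>The weights sum to one, so some component exists; its divergence is a real
    number or \<open>\<infinity>\<close>, never \<open>-\<infinity>\<close>.\<close>
  have "I \<noteq> {}" using mu by auto
  then obtain y where "y \<in> I" by blast
  from B[OF this] MInf have "sandwiched_renyi N \<alpha> (M y) \<sigma> = -\<infinity>" by simp
  thus ?thesis by (auto simp: sandwiched_renyi_def Let_def split: if_splits)
next
  case (real b)
  have Sp: "psd N \<sigma>" and St: "mtrace \<sigma> = 1" using S by (auto simp: density_def)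
  have Sc: "\<sigma> \<in> carrier_mat N N" and Sh: "hermitian N \<sigma>" using Sp by (auto dest: psd_carrier psd_hermitian)
  have Mp: "psd N (M y)" if "y \<in> I" for y using M[OF that] by (simp add: density_def)
  have Mc: "M y \<in> carrier_mat N N" and Mh: "hermitian N (M y)" if "y \<in> I" for y
    using Mp[OF that] by (auto dest: psd_carrier psd_hermitian)
  define R where "R = mixture N I \<mu> M"
  have Rd: "density N R" unfolding R_def by (rule density_mixture[OF mu M])
  have Rp: "psd N R" using Rd by (simp add: density_def)
  have Rh: "hermitian N R" using Rp by (rule psd_hermitian)
  \<comment> \<open>Individual constants \<open>k y\<close> average to a constant for the mixture. A
    constant \<open>k\<close> gives the domination of the mixture itself, a varying \<open>k\<close>
    the case of order infinity.\<close>
  have dom: "psd N (of_real (\<Sum>y\<in>I. \<mu> y * k y) \<cdot>\<^sub>m \<sigma> - R)"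
    if "\<And>y. y \<in> I \<Longrightarrow> psd N (of_real (k y) \<cdot>\<^sub>m \<sigma> - M y)" for k
  proof -
    have "of_real (\<Sum>y\<in>I. \<mu> y * k y) \<cdot>\<^sub>m \<sigma> - R = mixture N I \<mu> (\<lambda>y. of_real (k y) \<cdot>\<^sub>m \<sigma> - M y)"
    proof (rule eq_matI)
      fix i j assume "i < dim_row (mixture N I \<mu> (\<lambda>y. of_real (k y) \<cdot>\<^sub>m \<sigma> - M y))"
        "j < dim_col (mixture N I \<mu> (\<lambda>y. of_real (k y) \<cdot>\<^sub>m \<sigma> - M y))"
      hence ij: "i < N" "j < N" by (auto simp: mixture_def)
      have "mixture N I \<mu> (\<lambda>y. of_real (k y) \<cdot>\<^sub>m \<sigma> - M y) $$ (i, j)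
        = (\<Sum>y\<in>I. of_real (\<mu> y * k y) * \<sigma> $$ (i, j) - of_real (\<mu> y) * M y $$ (i, j))"
        unfolding mixture_index[OF ij]
        by (intro sum.cong refl) (use ij Sc in \<open>simp add: carrier_matD[OF Mc] algebra_simps\<close>)
      also have "\<dots> = of_real (\<Sum>y\<in>I. \<mu> y * k y) * \<sigma> $$ (i, j) - R $$ (i, j)"
        using ij by (simp add: R_def mixture_index sum_subtractf sum_distrib_right)
      finally show "(of_real (\<Sum>y\<in>I. \<mu> y * k y) \<cdot>\<^sub>m \<sigma> - R) $$ (i, j)
        = mixture N I \<mu> (\<lambda>y. of_real (k y) \<cdot>\<^sub>m \<sigma> - M y) $$ (i, j)"
        using ij Sc by (simp add: R_def mixture_def)
    qed (use Sc in \<open>auto simp: mixture_def R_def\<close>)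
    thus ?thesis using psd_mixture[OF mu(1) that] by simp
  qed
  have DR: "psd N (of_real c \<cdot>\<^sub>m \<sigma> - R)"
    using dom[of "\<lambda>_. c", OF D] mu by (simp add: sum_distrib_right[symmetric])
  have suppM: "supp_le N (M y) \<sigma>" if "y \<in> I" for y by (rule supp_le_if_dominated[OF Mp[OF that] Sp D[OF that]])
  have suppR: "supp_le N R \<sigma>" by (rule supp_le_if_dominated[OF Rp Sp DR])
  have avg_le: "(\<Sum>y\<in>I. \<mu> y * k y) \<le> z" if "\<And>y. y \<in> I \<Longrightarrow> k y \<le> z" for k z
  proof -
    have "(\<Sum>y\<in>I. \<mu> y * k y) \<le> (\<Sum>y\<in>I. \<mu> y * z)"
      using mu that by (intro sum_mono mult_left_mono) auto
    thus ?thesis using mu by (simp add: sum_distrib_right[symmetric])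
  qed
  consider (inf) "\<alpha> = \<infinity>" | (one) "\<alpha> = 1" | (fin) a where "\<alpha> = ereal a" "a \<noteq> 1" "a \<ge> 1 / 2"
    using \<alpha> by (cases \<alpha>) (auto simp: one_ereal_def)
  hence "sandwiched_renyi N \<alpha> R \<sigma> \<le> ereal b"
  proof cases
    case inf
    define C where "C X = {c :: real. c > 0 \<and> psd N (complex_of_real c \<cdot>\<^sub>m \<sigma> - X)}" for X
    \<comment> \<open>Comparing the traces of two density matrices bounds the infimum away from
      zero, so \<open>ln\<close> is monotone on the values in question.\<close>
    have Cge: "1 \<le> k" if X: "density N X" and "k \<in> C X" for k X
    proof -
      have Xc: "X \<in> carrier_mat N N" "mtrace X = 1" using X by (auto simp: density_def psd_carrier)
      have "0 \<le> Re (mtrace (complex_of_real k \<cdot>\<^sub>m \<sigma> - X))"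
        using that by (intro psd_trace_nonneg[of N]) (auto simp: C_def)
      also have "mtrace (complex_of_real k \<cdot>\<^sub>m \<sigma> - X) = of_real k - 1"
        using Xc Sc St by (simp add: mtrace_minus[of _ N] mtrace_smult[of _ N])
      finally show ?thesis by simp
    qed
    have Inf1: "1 \<le> Inf (C X)" if "density N X" "c \<in> C X" for X
      using that Cge by (intro cInf_greatest) auto
    have cM: "c \<in> C (M y)" if "y \<in> I" for y using c D[OF that] by (simp add: C_def)
    have cR: "c \<in> C R" using c DR by (simp add: C_def)
    have InfM: "Inf (C (M y)) \<le> exp b" if y: "y \<in> I" for y
    proof -
      have "ln (Inf (C (M y))) \<le> b"
        using B[OF y] inf real suppM[OF y] by (simp add: sandwiched_renyi_def C_def)
      hence "exp (ln (Inf (C (M y)))) \<le> exp b" by simp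
      thus ?thesis using Inf1[OF M[OF y] cM[OF y]] by simp
    qed
    have "Inf (C R) \<le> exp b"
    \<comment> \<open>Each component gets an admissible constant below \<open>exp b + e\<close>,
      which avoids showing that the infimum is attained.\<close>
    proof (rule field_le_epsilon)
      fix e :: real assume e: "e > 0"
      have "\<exists>k\<in>C (M y). k < exp b + e" if y: "y \<in> I" for y
        using cInf_lessD[of "C (M y)" "exp b + e"] InfM[OF y] cM[OF y] e by fastforce
      then obtain k where k: "\<And>y. y \<in> I \<Longrightarrow> k y \<in> C (M y)" "\<And>y. y \<in> I \<Longrightarrow> k y < exp b + e"
        by metis
      have "psd N (of_real (\<Sum>y\<in>I. \<mu> y * k y) \<cdot>\<^sub>m \<sigma> - R)"
        using k(1) by (intro dom) (simp add: C_def)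
      moreover have "1 \<le> (\<Sum>y\<in>I. \<mu> y * k y)"
      proof -
        have "- (\<Sum>y\<in>I. \<mu> y * k y) \<le> - 1"
          using avg_le[of "\<lambda>y. - k y" "- 1"] Cge[OF M k(1)] by (simp add: sum_negf)
        thus ?thesis by simp
      qed
      ultimately have "(\<Sum>y\<in>I. \<mu> y * k y) \<in> C R" by (simp add: C_def)
      hence "Inf (C R) \<le> (\<Sum>y\<in>I. \<mu> y * k y)"
        using Cge[OF Rd] by (intro cInf_lower bdd_belowI[of _ 1]) auto
      also have "\<dots> \<le> exp b + e" using k(2) by (intro avg_le) (simp add: less_imp_le)
      finally show "Inf (C R) \<le> exp b + e" .
    qed
    hence "ln (Inf (C R)) \<le> b" using Inf1[OF Rd cR] by (simp add: ln_le_iff_le_exp)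
    thus ?thesis using inf suppR by (simp add: sandwiched_renyi_def C_def)
  next
    case one
    let ?f = "\<lambda>x::real. x * (if x > 0 then ln x else 0)"
    define L where "L = mat_ln \<sigma>"
    have Lc: "L \<in> carrier_mat N N" unfolding L_def by (rule hermitian_carrier[OF mat_ln_hermitian[OF Sh]])
    have bM: "Re (mtrace (mat_fun ?f (M y))) - Re (mtrace (M y * L)) \<le> b" if y: "y \<in> I" for y
      using B[OF y] one real suppM[OF y] relative_entropy_split[OF Mh[OF y] Sh]
      by (simp add: sandwiched_renyi_def L_def)
    have "Re (mtrace (mat_fun ?f R)) \<le> (\<Sum>y\<in>I. \<mu> y * Re (mtrace (mat_fun ?f (M y))))"
      unfolding R_def by (rule trace_mat_fun_convex[OF I mu Mp convex_on_x_ln_x])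
    moreover have "Re (mtrace (R * L)) = (\<Sum>y\<in>I. \<mu> y * Re (mtrace (M y * L)))"
      unfolding R_def using Mc Lc by (simp add: mixture_mult mtrace_mixture)
    ultimately have "Re (mtrace (mat_fun ?f R)) - Re (mtrace (R * L))
      \<le> (\<Sum>y\<in>I. \<mu> y * (Re (mtrace (mat_fun ?f (M y))) - Re (mtrace (M y * L))))"
      by (simp add: right_diff_distrib sum_subtractf)
    also have "\<dots> \<le> b" using bM by (rule avg_le)
    finally show ?thesis
      using one suppR relative_entropy_split[OF Rh Sh] by (simp add: sandwiched_renyi_def L_def)
  next
    case (fin a)
    define P where "P = mat_powr \<sigma> ((1 - a) / (2 * a))"
    have Ph: "hermitian N P" unfolding P_def by (rule mat_powr_hermitian[OF Sh])
    have Pc: "P \<in> carrier_mat N N" using Ph by (rule hermitian_carrier)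
    define t where "t X = Re (mtrace (mat_powr (P * X * P) a))" for X
    have tpos: "0 < t X" if "density N X" "psd N (of_real c \<cdot>\<^sub>m \<sigma> - X)" for X
      unfolding t_def P_def by (rule trace_sandwich_powr_pos[OF that(1) Sp that(2)])
    have val: "sandwiched_renyi N \<alpha> X \<sigma> = ereal (ln (t X) / (a - 1))" if "supp_le N X \<sigma>" for X
      using that fin by (simp add: sandwiched_renyi_def Let_def t_def P_def one_ereal_def)
    have bM: "ln (t (M y)) / (a - 1) \<le> b" if "y \<in> I" for y
      using B[OF that] val[OF suppM[OF that]] real by simp
    have PM: "psd N (P * M y * P)" if "y \<in> I" for y by (rule sandwich_psd[OF Mp[OF that] Ph])
    \<comment> \<open>For fixed \<open>\<sigma>\<close> sandwiching is linear, so a mixture of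
      states becomes a mixture of positive matrices.\<close>
    have PR: "P * R * P = mixture N I \<mu> (\<lambda>y. P * M y * P)"
      unfolding R_def using Mc Pc by (simp add: mult_mixture mixture_mult)
    have tR: "0 < t R" and tM: "\<And>y. y \<in> I \<Longrightarrow> 0 < t (M y)" using tpos Rd DR M D by auto
    have "ln (t R) / (a - 1) \<le> b"
    proof (cases "a > 1")
      case True
      have le: "t (M y) \<le> exp (b * (a - 1))" if "y \<in> I" for y
        using bM[OF that] True tM[OF that] by (simp add: divide_le_eq ln_le_iff_le_exp)
      have "t R \<le> (\<Sum>y\<in>I. \<mu> y * t (M y))"
        unfolding t_def PR mat_powr_def using True
        by (intro trace_mat_fun_convex[OF I mu PM convex_on_positive_powr]) auto
      also have "\<dots> \<le> exp (b * (a - 1))" using le by (rule avg_le)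
      finally show ?thesis using True tR by (simp add: divide_le_eq ln_le_iff_le_exp)
    next
      case False
      hence a: "a < 1" "0 < a" using fin by auto
      \<comment> \<open>Since \<open>a - 1\<close> is negative, an upper bound on the divergence is
        a lower bound on the trace.\<close>
      have le: "exp (b * (a - 1)) \<le> t (M y)" if "y \<in> I" for y
        using bM[OF that] a tM[OF that] by (simp add: neg_divide_le_eq ln_ge_iff)
      let ?f = "\<lambda>x::real. if x > 0 then x powr a else 0"
      have neg: "Re (mtrace (mat_fun (\<lambda>x. - ?f x) X)) = - Re (mtrace (mat_fun ?f X))"
        if Xh: "hermitian N X" for X
      proof -
        obtain U lam where U: "unitary N U" and X: "X = U * diag_of N lam * adj U"
          using hermitian_diagonalisable[OF Xh] by blast
        show ?thesis unfolding X mtrace_mat_fun_diagonalised[OF U] by (simp add: sum_negf)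
      qed
      have "- t R \<le> (\<Sum>y\<in>I. \<mu> y * - t (M y))"
      proof -
        have "hermitian N (P * R * P)" by (intro psd_hermitian sandwich_psd Rp Ph)
        hence "- t R = Re (mtrace (mat_fun (\<lambda>x. - ?f x) (P * R * P)))"
          by (simp add: neg t_def mat_powr_def)
        also have "\<dots> \<le> (\<Sum>y\<in>I. \<mu> y * Re (mtrace (mat_fun (\<lambda>x. - ?f x) (P * M y * P))))"
          unfolding PR using a by (intro trace_mat_fun_convex[OF I mu PM convex_on_neg_positive_powr]) auto
        also have "\<dots> = (\<Sum>y\<in>I. \<mu> y * - t (M y))"
          by (intro sum.cong refl) (simp add: neg[OF psd_hermitian[OF PM]] t_def mat_powr_def)
        finally show ?thesis .
      qed
      also have "\<dots> \<le> - exp (b * (a - 1))" using le by (intro avg_le) simp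
      finally show ?thesis using a tR by (simp add: neg_divide_le_eq ln_ge_iff)
    qed
    thus ?thesis using val[OF suppR] by simp
  qed
  thus ?thesis by (simp add: R_def real)
qed

section \<open>Mixtures of unitarily rotated channels\<close>

lemma sum_lessThan_times:
  fixes f :: "nat \<Rightarrow> 'a::comm_monoid_add"
  shows "(\<Sum>k<N * m. f k) = (\<Sum>a<N. \<Sum>r<m. f (a * m + r))"
proof -
  have "(\<Sum>k<N * m. f k) = (\<Sum>a<N. sum f {a * m..<a * m + m})"
    by (rule sum.nat_group[symmetric])
  also have "\<dots> = (\<Sum>a<N. \<Sum>r<m. f (a * m + r))"
    by (rule sum.cong[OF refl], subst sum.atLeastLessThan_shift_0) (simp add: atLeast0LessThan)
  finally show ?thesis .
qed

lemma times_add_less: "a < N \<Longrightarrow> r < m \<Longrightarrow> a * m + r < N * (m::nat)"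
  using mult_le_mono1[of "Suc a" N m] by simp

lemma div_mod_bounds:
  assumes "i < N * (m::nat)"
  shows "i div m < N" "i mod m < m"
  using assms by (auto simp: less_mult_imp_div_less intro!: mod_less_divisor gr0I)

lemma sform_times:
  "sform (N * m) X v w = (\<Sum>a<N. \<Sum>r<m. \<Sum>b<N. \<Sum>s<m.
     cnj (v (a * m + r)) * X $$ (a * m + r, b * m + s) * w (b * m + s))"
  by (simp add: sform_def sum_lessThan_times)

lemma tensor_id_carrier [simp]: "tensor_id N m \<Phi> X \<in> carrier_mat (N * m) (N * m)"
  by (simp add: tensor_id_def)

lemma tensor_id_index:
  assumes "i < N * m" "j < N * m"
  shows "tensor_id N m \<Phi> X $$ (i, j) =
    \<Phi> (mat N N (\<lambda>(a, b). X $$ (a * m + i mod m, b * m + j mod m))) $$ (i div m, j div m)"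
  using assms by (simp add: tensor_id_def)

lemma tensor_id_cong:
  assumes "\<And>Y. Y \<in> carrier_mat N N \<Longrightarrow> \<Phi> Y = \<Psi> Y"
  shows "tensor_id N m \<Phi> X = tensor_id N m \<Psi> X"
  by (rule eq_matI) (auto simp: tensor_id_def assms)

lemma tensor_id_comp:
  assumes "\<And>Y. Y \<in> carrier_mat N N \<Longrightarrow> g Y \<in> carrier_mat N N"
  shows "tensor_id N m (\<lambda>Y. f (g Y)) X = tensor_id N m f (tensor_id N m g X)"
proof (rule eq_matI)
  fix i j assume "i < dim_row (tensor_id N m f (tensor_id N m g X))"
    "j < dim_col (tensor_id N m f (tensor_id N m g X))"
  hence ij: "i < N * m" "j < N * m" by (auto simp: tensor_id_def)
  note b = div_mod_bounds[OF ij(1)] div_mod_bounds[OF ij(2)]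
  let ?B = "mat N N (\<lambda>(a, b). X $$ (a * m + i mod m, b * m + j mod m))"
  have "mat N N (\<lambda>(a, b). tensor_id N m g X $$ (a * m + i mod m, b * m + j mod m)) = g ?B"
  proof (rule eq_matI)
    fix a c assume "a < dim_row (g ?B)" "c < dim_col (g ?B)"
    hence "a < N" "c < N" using assms[of ?B] by auto
    thus "mat N N (\<lambda>(a, b). tensor_id N m g X $$ (a * m + i mod m, b * m + j mod m)) $$ (a, c) = g ?B $$ (a, c)"
      using b by (simp add: tensor_id_index times_add_less)
  qed (use assms[of ?B] in auto)
  thus "tensor_id N m (\<lambda>Y. f (g Y)) X $$ (i, j) = tensor_id N m f (tensor_id N m g X) $$ (i, j)"
    using ij by (simp add: tensor_id_index)
qed (auto simp: tensor_id_def)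

lemma tensor_id_mixture:
  "tensor_id N m (\<lambda>Y. mixture N I \<mu> (\<lambda>y. F y Y)) X = mixture (N * m) I \<mu> (\<lambda>y. tensor_id N m (F y) X)"
  by (rule eq_matI) (auto simp: mixture_def tensor_id_def div_mod_bounds)

text \<open>\<open>U\<close> tensored with the identity on the ancilla, in the ordering
  \<open>a * m + r\<close> used by \<open>tensor_id\<close>.\<close>

definition kron_id :: "nat \<Rightarrow> nat \<Rightarrow> complex mat \<Rightarrow> complex mat" where
  "kron_id N m U = mat (N * m) (N * m) (\<lambda>(i, j). if i mod m = j mod m then U $$ (i div m, j div m) else 0)"

lemma kron_id_carrier [simp]: "kron_id N m U \<in> carrier_mat (N * m) (N * m)"
  by (simp add: kron_id_def)

lemma kron_id_index:
  assumes "i < N * m" "a < N" "r < m"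
  shows "kron_id N m U $$ (i, a * m + r) = (if r = i mod m then U $$ (i div m, a) else 0)"
    "kron_id N m U $$ (a * m + r, i) = (if r = i mod m then U $$ (a, i div m) else 0)"
  using assms by (auto simp: kron_id_def times_add_less)

text \<open>Turns a map applied block by block into conjugation by one matrix, to which the
  invariance results for trace, positivity and divergence apply.\<close>

lemma tensor_id_conj:
  assumes U: "U \<in> carrier_mat N N" and X: "X \<in> carrier_mat (N * m) (N * m)"
  shows "tensor_id N m (\<lambda>Y. U * Y * adj U) X = kron_id N m U * X * adj (kron_id N m U)"
proof (rule eq_matI)
  fix i j assume "i < dim_row (kron_id N m U * X * adj (kron_id N m U))"
    "j < dim_col (kron_id N m U * X * adj (kron_id N m U))"
  hence ij: "i < N * m" "j < N * m" by (auto simp: kron_id_def)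
  note b = div_mod_bounds[OF ij(1)] div_mod_bounds[OF ij(2)]
  have "(kron_id N m U * X * adj (kron_id N m U)) $$ (i, j) =
    (\<Sum>k<N. \<Sum>r<m. \<Sum>l<N. \<Sum>s<m. if s = j mod m then (if r = i mod m then
       U $$ (i div m, k) * X $$ (k * m + r, l * m + s) * cnj (U $$ (j div m, l)) else 0) else 0)"
    unfolding conj_mat_index[OF kron_id_carrier X ij] sum_lessThan_times
    by (intro sum.cong refl) (use ij in \<open>auto simp: kron_id_index\<close>)
  also have "\<dots> = (\<Sum>k<N. \<Sum>r<m. if r = i mod m then (\<Sum>l<N.
       U $$ (i div m, k) * X $$ (k * m + r, l * m + j mod m) * cnj (U $$ (j div m, l))) else 0)"
    using b by (intro sum.cong refl) simp
  also have "\<dots> = (\<Sum>k<N. \<Sum>l<N. U $$ (i div m, k) * X $$ (k * m + i mod m, l * m + j mod m) * cnj (U $$ (j div m, l)))"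
    using b by simp
  also have "\<dots> = tensor_id N m (\<lambda>Y. U * Y * adj U) X $$ (i, j)"
    unfolding tensor_id_index[OF ij] using b
    by (subst conj_mat_index[OF U]) auto
  finally show "tensor_id N m (\<lambda>Y. U * Y * adj U) X $$ (i, j) = (kron_id N m U * X * adj (kron_id N m U)) $$ (i, j)" ..
qed (auto simp: kron_id_def tensor_id_def)

lemma unitary_kron_id:
  assumes U: "unitary N U"
  shows "unitary (N * m) (kron_id N m U)"
proof (rule unitaryI_columns[OF kron_id_carrier])
  fix i j assume ij: "i < N * m" "j < N * m"
  note b = div_mod_bounds[OF ij(1)] div_mod_bounds[OF ij(2)]
  have "(\<Sum>k<N * m. cnj (kron_id N m U $$ (k, i)) * kron_id N m U $$ (k, j)) =
    (\<Sum>k<N. \<Sum>r<m. if r = i mod m then (if i mod m = j mod m then cnj (U $$ (k, i div m)) * U $$ (k, j div m) else 0) else 0)"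
    unfolding sum_lessThan_times by (intro sum.cong refl) (use ij in \<open>auto simp: kron_id_index\<close>)
  also have "\<dots> = (if i mod m = j mod m then (\<Sum>k<N. cnj (U $$ (k, i div m)) * U $$ (k, j div m)) else 0)"
    using b by auto
  also have "\<dots> = (if i mod m = j mod m \<and> i div m = j div m then 1 else 0)"
    unfolding unitary_columns[OF U b(1,3)] by auto
  also have "i mod m = j mod m \<and> i div m = j div m \<longleftrightarrow> i = j" by (metis div_mult_mod_eq)
  finally show "(\<Sum>k<N * m. cnj (kron_id N m U $$ (k, i)) * kron_id N m U $$ (k, j)) = (if i = j then 1 else 0)" .
qed

section \<open>Channels with an ancilla and the reference state\<close>

lemma channel_carrier: "is_channel N \<Lambda> \<Longrightarrow> X \<in> carrier_mat N N \<Longrightarrow> \<Lambda> X \<in> carrier_mat N N"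
  by (simp add: is_channel_def)

lemma channel_trace: "is_channel N \<Lambda> \<Longrightarrow> X \<in> carrier_mat N N \<Longrightarrow> mtrace (\<Lambda> X) = mtrace X"
  by (simp add: is_channel_def)

lemma channel_tensor_psd: "is_channel N \<Lambda> \<Longrightarrow> m > 0 \<Longrightarrow> psd (N * m) X \<Longrightarrow> psd (N * m) (tensor_id N m \<Lambda> X)"
  by (simp add: is_channel_def)

text \<open>Only the ancilla-diagonal blocks enter the trace, and the channel preserves the trace of
  each of them.\<close>

lemma mtrace_tensor_id:
  assumes L: "is_channel N \<Lambda>" and X: "X \<in> carrier_mat (N * m) (N * m)"
  shows "mtrace (tensor_id N m \<Lambda> X) = mtrace X"
proof -
  let ?B = "\<lambda>r. mat N N (\<lambda>(a, b). X $$ (a * m + r, b * m + r))"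
  have tr: "(\<Sum>a<N. \<Lambda> (?B r) $$ (a, a)) = (\<Sum>a<N. X $$ (a * m + r, a * m + r))" for r
    using channel_trace[OF L, of "?B r"] channel_carrier[OF L, of "?B r"] by (simp add: mtrace_sum[of _ N])
  have "mtrace (tensor_id N m \<Lambda> X) = (\<Sum>a<N. \<Sum>r<m. \<Lambda> (?B r) $$ (a, a))"
    unfolding mtrace_sum[OF tensor_id_carrier] sum_lessThan_times
    by (intro sum.cong refl) (simp add: tensor_id_index times_add_less)
  also have "\<dots> = (\<Sum>r<m. \<Sum>a<N. X $$ (a * m + r, a * m + r))"
    by (subst sum.swap) (simp add: tr)
  also have "\<dots> = mtrace X"
    unfolding mtrace_sum[OF X] sum_lessThan_times by (rule sum.swap)
  finally show ?thesis .
qed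

lemma density_tensor_id:
  assumes "is_channel N \<Lambda>" "m > 0" "density (N * m) X"
  shows "density (N * m) (tensor_id N m \<Lambda> X)"
  using assms channel_tensor_psd[OF assms(1,2)] mtrace_tensor_id[OF assms(1)]
  by (auto simp: density_def psd_carrier)

lemma depol_carrier [simp]: "depol N X \<in> carrier_mat N N"
  by (simp add: depol_def)

lemma tensor_id_depol_index:
  assumes ij: "i < N * m" "j < N * m"
  shows "tensor_id N m (depol N) X $$ (i, j) =
    (if i div m = j div m then (\<Sum>a<N. X $$ (a * m + i mod m, a * m + j mod m)) / of_nat N else 0)"
  using div_mod_bounds[OF ij(1)] div_mod_bounds[OF ij(2)]
  by (simp add: tensor_id_index[OF ij] depol_def mtrace_def)

text \<open>The reference state is \<open>I / N\<close> tensored with the partial trace over the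
  channel system. Writing the partial trace as a sum over basis positions \<open>a\<close> and
  cutting \<open>v\<close> into blocks, the form becomes a sum of forms of \<open>X\<close> at
  vectors that carry block \<open>c\<close> of \<open>v\<close> in position \<open>a\<close>.
  Positivity and domination are both read off from this.\<close>

lemma sform_tensor_id_depol:
  "of_nat N * sform (N * m) (tensor_id N m (depol N) X) v v =
    (\<Sum>c<N. \<Sum>a<N. sform (N * m) X (\<lambda>k. if k div m = a then v (c * m + k mod m) else 0)
      (\<lambda>k. if k div m = a then v (c * m + k mod m) else 0))"
proof (cases "N = 0")
  case False
  let ?g = "\<lambda>c r a s. cnj (v (c * m + r)) * X $$ (a * m + r, a * m + s) * v (c * m + s)"
  have "of_nat N * sform (N * m) (tensor_id N m (depol N) X) v v =
    (\<Sum>c<N. \<Sum>r<m. \<Sum>b<N. \<Sum>s<m. if b = c then \<Sum>a<N. ?g c r a s else 0)"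
    unfolding sform_times sum_distrib_left
    by (intro sum.cong[OF refl])
      (use False in \<open>auto simp: tensor_id_depol_index times_add_less sum_distrib_left sum_distrib_right
        sum_divide_distrib mult_ac\<close>)
  also have "\<dots> = (\<Sum>c<N. \<Sum>r<m. \<Sum>b<N. if b = c then (\<Sum>s<m. \<Sum>a<N. ?g c r a s) else 0)"
    by (intro sum.cong refl) auto
  also have "\<dots> = (\<Sum>c<N. \<Sum>r<m. \<Sum>s<m. \<Sum>a<N. ?g c r a s)"
    by (rule sum.cong[OF refl], rule sum.cong[OF refl]) simp
  also have "\<dots> = (\<Sum>c<N. \<Sum>a<N. \<Sum>r<m. \<Sum>s<m. ?g c r a s)"
    by (simp only: sum.swap[of _ "{..<N}" "{..<m}"])
  also have "\<dots> = (\<Sum>c<N. \<Sum>a<N. sform (N * m) X (\<lambda>k. if k div m = a then v (c * m + k mod m) else 0)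
      (\<lambda>k. if k div m = a then v (c * m + k mod m) else 0))"
  proof (intro sum.cong refl)
    fix c a assume "c \<in> {..<N}" "a \<in> {..<N}"
    have "sform (N * m) X (\<lambda>k. if k div m = a then v (c * m + k mod m) else 0)
      (\<lambda>k. if k div m = a then v (c * m + k mod m) else 0) =
      (\<Sum>a'<N. \<Sum>r<m. \<Sum>b<N. \<Sum>s<m. if b = a then (if a' = a then ?g c r a s else 0) else 0)"
      unfolding sform_times by (intro sum.cong refl) auto
    also have "\<dots> = (\<Sum>a'<N. \<Sum>r<m. \<Sum>b<N. if b = a then (\<Sum>s<m. if a' = a then ?g c r a s else 0) else 0)"
      by (intro sum.cong refl) auto
    also have "\<dots> = (\<Sum>a'<N. if a' = a then (\<Sum>r<m. \<Sum>s<m. ?g c r a s) else 0)"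
      using \<open>a \<in> {..<N}\<close> by (intro sum.cong[OF refl]) auto
    also have "\<dots> = (\<Sum>r<m. \<Sum>s<m. ?g c r a s)" using \<open>a \<in> {..<N}\<close> by simp
    finally show "(\<Sum>r<m. \<Sum>s<m. ?g c r a s) =
      sform (N * m) X (\<lambda>k. if k div m = a then v (c * m + k mod m) else 0)
      (\<lambda>k. if k div m = a then v (c * m + k mod m) else 0)" ..
  qed
  finally show ?thesis .
qed simp

lemma sform_sum_sum:
  "sform N A (\<lambda>k. \<Sum>c\<in>C. u c k) (\<lambda>k. \<Sum>c\<in>C. u c k) = (\<Sum>c\<in>C. \<Sum>e\<in>C. sform N A (u c) (u e))"
proof -
  have "sform N A (\<lambda>k. \<Sum>c\<in>C. u c k) (\<lambda>k. \<Sum>c\<in>C. u c k)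
    = (\<Sum>i<N. \<Sum>j<N. \<Sum>c\<in>C. \<Sum>e\<in>C. cnj (u c i) * A $$ (i, j) * u e j)"
    unfolding sform_def
    by (rule sum.cong[OF refl], rule sum.cong[OF refl], subst sum.swap)
      (simp add: sum_distrib_left sum_distrib_right)
  also have "\<dots> = (\<Sum>i<N. \<Sum>c\<in>C. \<Sum>e\<in>C. \<Sum>j<N. cnj (u c i) * A $$ (i, j) * u e j)"
    by (rule sum.cong[OF refl], subst sum.swap, rule sum.cong[OF refl], rule sum.swap)
  also have "\<dots> = (\<Sum>c\<in>C. \<Sum>e\<in>C. sform N A (u c) (u e))"
    unfolding sform_def by (subst sum.swap, rule sum.cong[OF refl], rule sum.swap)
  finally show ?thesis .
qed

lemma sform_diff_diff:
  "sform N A (\<lambda>k. v k - w k) (\<lambda>k. v k - w k) =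
    sform N A v v - sform N A v w - sform N A w v + sform N A w w"
  by (simp add: sform_def sum_subtractf sum.distrib algebra_simps)

lemma cnj_sform:
  assumes "hermitian N A"
  shows "cnj (sform N A v w) = sform N A w v"
proof -
  have "cnj (sform N A v w) = (\<Sum>i<N. \<Sum>j<N. cnj (w j) * A $$ (j, i) * v i)"
    unfolding sform_def cnj_sum by (intro sum.cong refl) (simp add: hermitian_index[OF assms] mult_ac)
  thus ?thesis by (subst (asm) sum.swap) (simp add: sform_def)
qed

text \<open>Positivity at \<open>v - w\<close> bounds each cross term by the mean of the two
  diagonal ones; summing over all pairs produces the factor \<open>card C\<close>.\<close>

lemma psd_sform_sum_le:
  assumes A: "psd N A"
  shows "Re (sform N A (\<lambda>k. \<Sum>c\<in>C. u c k) (\<lambda>k. \<Sum>c\<in>C. u c k)) \<le> of_nat (card C) * (\<Sum>c\<in>C. Re (sform N A (u c) (u c)))"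
proof -
  have le: "Re (sform N A v w) \<le> (Re (sform N A v v) + Re (sform N A w w)) / 2" for v w
  proof -
    have "Re (sform N A w v) = Re (sform N A v w)"
      by (metis cnj_sform[OF psd_hermitian[OF A]] cnj.simps(1))
    thus ?thesis using psd_sform_nonneg[OF A, of "\<lambda>k. v k - w k"] unfolding sform_diff_diff by simp
  qed
  have "Re (sform N A (\<lambda>k. \<Sum>c\<in>C. u c k) (\<lambda>k. \<Sum>c\<in>C. u c k)) = (\<Sum>c\<in>C. \<Sum>e\<in>C. Re (sform N A (u c) (u e)))"
    unfolding sform_sum_sum by simp
  also have "\<dots> \<le> (\<Sum>c\<in>C. \<Sum>e\<in>C. (Re (sform N A (u c) (u c)) + Re (sform N A (u e) (u e))) / 2)"
    by (intro sum_mono le)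
  also have "\<dots> = of_nat (card C) * (\<Sum>c\<in>C. Re (sform N A (u c) (u c)))"
    by (simp add: sum.distrib sum_divide_distrib[symmetric] sum_distrib_left[symmetric])
  finally show ?thesis .
qed

lemma hermitian_tensor_id_depol:
  assumes "hermitian (N * m) X"
  shows "hermitian (N * m) (tensor_id N m (depol N) X)"
  by (rule hermitianI) (auto simp: tensor_id_depol_index hermitian_index[OF assms] times_add_less div_mod_bounds)

lemma density_tensor_id_depol:
  assumes N: "N > 0" and X: "density (N * m) X"
  shows "density (N * m) (tensor_id N m (depol N) X)"
proof -
  have Xp: "psd (N * m) X" and Xt: "mtrace X = 1" using X by (auto simp: density_def)
  have "0 \<le> Re (of_nat N * sform (N * m) (tensor_id N m (depol N) X) v v)" for v
    unfolding sform_tensor_id_depol by (auto intro!: sum_nonneg psd_sform_nonneg[OF Xp])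
  hence "psd (N * m) (tensor_id N m (depol N) X)"
    using N hermitian_tensor_id_depol[OF psd_hermitian[OF Xp]] by (simp add: psd_iff_sform zero_le_mult_iff)
  moreover have "mtrace (tensor_id N m (depol N) X) = 1"
  proof -
    have "mtrace (tensor_id N m (depol N) X) = (\<Sum>c<N. \<Sum>r<m. (\<Sum>a<N. X $$ (a * m + r, a * m + r)) / of_nat N)"
      unfolding mtrace_sum[OF tensor_id_carrier] sum_lessThan_times
      by (intro sum.cong refl) (simp add: tensor_id_depol_index times_add_less)
    also have "\<dots> = (\<Sum>r<m. \<Sum>a<N. X $$ (a * m + r, a * m + r))"
      using N by (simp add: sum_divide_distrib[symmetric])
    also have "\<dots> = mtrace X"
      unfolding mtrace_sum[OF psd_carrier[OF Xp]] sum_lessThan_times by (rule sum.swap)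
    finally show ?thesis using Xt by simp
  qed
  ultimately show ?thesis by (simp add: density_def)
qed

text \<open>Pinching: a positive matrix on \<open>A \<otimes> R\<close> is at most \<open>N\<close> times its block-diagonal part,
  and each diagonal block is at most the partial trace over \<open>A\<close>.\<close>

lemma psd_dominated_by_depol:
  assumes X: "psd (N * m) X"
  shows "psd (N * m) (of_real (real (N * N)) \<cdot>\<^sub>m tensor_id N m (depol N) X - X)"
proof -
  let ?S = "tensor_id N m (depol N) X"
  have Xc: "X \<in> carrier_mat (N * m) (N * m)" using X by (rule psd_carrier)
  have "Re (sform (N * m) X v v) \<le> real (N * N) * Re (sform (N * m) ?S v v)" for v
  proof -
    \<comment> \<open>\<open>w c a\<close> carries block \<open>c\<close> of \<open>v\<close> in
      position \<open>a\<close>; the vectors with \<open>a = c\<close> add up to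
      \<open>v\<close>.\<close>
    define w where "w c a k = (if k div m = a then v (c * m + k mod m) else 0)" for c a k
    have "sform (N * m) X v v = sform (N * m) X (\<lambda>k. \<Sum>c<N. w c c k) (\<lambda>k. \<Sum>c<N. w c c k)"
    proof -
      have "v k = (\<Sum>c<N. w c c k)" if "k < N * m" for k
      proof -
        have "(\<Sum>c<N. w c c k) = (\<Sum>c<N. if c = k div m then v k else 0)"
          by (intro sum.cong refl) (auto simp: w_def)
        thus ?thesis using div_mod_bounds[OF that] by simp
      qed
      thus ?thesis by (intro sform_cong) auto
    qed
    hence "Re (sform (N * m) X v v) \<le> real N * (\<Sum>c<N. Re (sform (N * m) X (w c c) (w c c)))"
      using psd_sform_sum_le[OF X, where C = "{..<N}" and u = "\<lambda>c. w c c"] by simp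
    \<comment> \<open>Pinching produces the terms with \<open>a = c\<close>; the other terms are
      nonnegative and complete the sum to the partial trace.\<close>
    also have "\<dots> \<le> real N * (\<Sum>c<N. \<Sum>a<N. Re (sform (N * m) X (w c a) (w c a)))"
    proof (intro mult_left_mono sum_mono)
      fix c assume "c \<in> {..<N}"
      thus "Re (sform (N * m) X (w c c) (w c c)) \<le> (\<Sum>a<N. Re (sform (N * m) X (w c a) (w c a)))"
        by (intro member_le_sum[of c "{..<N}" "\<lambda>a. Re (sform (N * m) X (w c a) (w c a))"]
            psd_sform_nonneg[OF X]) auto
    qed simp
    also have "\<dots> = real N * Re (of_nat N * sform (N * m) ?S v v)"
      unfolding sform_tensor_id_depol w_def by simp
    finally show ?thesis by simp
  qed
  thus ?thesis
    using hermitian_smult_diff[OF hermitian_tensor_id_depol[OF psd_hermitian[OF X]] psd_hermitian[OF X]]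
    by (simp only: psd_iff_sform psd_smult_diff_sform[OF tensor_id_carrier Xc]) simp
qed

text \<open>Trace preservation makes \<open>depol\<close> absorb the channel. Bounding an output
  state by its own depolarisation therefore bounds it by the reference state of the input.\<close>

lemma tensor_id_depol_channel:
  assumes "is_channel N \<Lambda>"
  shows "tensor_id N m (depol N) (tensor_id N m \<Lambda> X) = tensor_id N m (depol N) X"
proof -
  have "tensor_id N m (depol N) (tensor_id N m \<Lambda> X) = tensor_id N m (\<lambda>Y. depol N (\<Lambda> Y)) X"
    by (rule tensor_id_comp[symmetric]) (rule channel_carrier[OF assms])
  also have "\<dots> = tensor_id N m (depol N) X"
    by (rule tensor_id_cong) (simp add: depol_def channel_trace[OF assms])
  finally show ?thesis .
qed

lemma tensor_id_depol_conj_input: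
  assumes V: "unitary N V" and X: "X \<in> carrier_mat (N * m) (N * m)"
  shows "tensor_id N m (depol N) (kron_id N m V * X * adj (kron_id N m V)) = tensor_id N m (depol N) X"
proof -
  have Vc: "V \<in> carrier_mat N N" "adj V \<in> carrier_mat N N" using V by (auto simp: unitary_def)
  have "tensor_id N m (depol N) (kron_id N m V * X * adj (kron_id N m V))
    = tensor_id N m (\<lambda>Y. depol N (V * Y * adj V)) X"
    unfolding tensor_id_conj[OF Vc(1) X, symmetric]
    by (rule tensor_id_comp[symmetric]) (use Vc in simp)
  also have "\<dots> = tensor_id N m (depol N) X"
    by (rule tensor_id_cong) (simp add: depol_def mtrace_conj_unitary[OF V])
  finally show ?thesis .
qed

lemma tensor_id_depol_conj_output:
  assumes U: "unitary N U"
  shows "kron_id N m U * tensor_id N m (depol N) X * adj (kron_id N m U) = tensor_id N m (depol N) X"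
proof -
  have Uc: "U \<in> carrier_mat N N" "adj U \<in> carrier_mat N N" using U by (auto simp: unitary_def)
  have "kron_id N m U * tensor_id N m (depol N) X * adj (kron_id N m U)
    = tensor_id N m (\<lambda>Y. U * depol N Y * adj U) X"
    unfolding tensor_id_conj[OF Uc(1) tensor_id_carrier, symmetric]
    by (rule tensor_id_comp[symmetric]) simp
  also have "\<dots> = tensor_id N m (depol N) X"
  proof (rule tensor_id_cong)
    fix Y :: "complex mat"
    have "U * (c \<cdot>\<^sub>m 1\<^sub>m N) * adj U = c \<cdot>\<^sub>m (U * adj U)" for c
      using Uc by (simp add: mult_smult_distrib[of _ N N _ N] mult_smult_assoc_mat[of _ N N _ N])
    thus "U * depol N Y * adj U = depol N Y" using U by (simp add: depol_def unitary_def)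
  qed
  finally show ?thesis .
qed

text \<open>The value outside the \<open>N x N\<close> matrices follows the normalisation in
  \<open>mean_channel\<close>, so that the two can be equal as functions.\<close>

definition unitary_mixture :: "nat \<Rightarrow> 'i set \<Rightarrow> ('i \<Rightarrow> real) \<Rightarrow> ('i \<Rightarrow> complex mat) \<Rightarrow> ('i \<Rightarrow> complex mat) \<Rightarrow>
    (complex mat \<Rightarrow> complex mat) \<Rightarrow> complex mat \<Rightarrow> complex mat" where
  "unitary_mixture N I \<mu> U V \<Lambda> X = (if X \<in> carrier_mat N N
     then mixture N I \<mu> (\<lambda>y. U y * \<Lambda> (V y * X * adj (V y)) * adj (U y)) else 0\<^sub>m N N)"

lemma tensor_id_unitary_mixture:
  assumes L: "is_channel N \<Lambda>" and U: "\<And>y. y \<in> I \<Longrightarrow> unitary N (U y)" and V: "\<And>y. y \<in> I \<Longrightarrow> unitary N (V y)"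
    and X: "X \<in> carrier_mat (N * m) (N * m)"
  shows "tensor_id N m (unitary_mixture N I \<mu> U V \<Lambda>) X = mixture (N * m) I \<mu> (\<lambda>y.
    kron_id N m (U y) * tensor_id N m \<Lambda> (kron_id N m (V y) * X * adj (kron_id N m (V y))) * adj (kron_id N m (U y)))"
proof -
  have "tensor_id N m (unitary_mixture N I \<mu> U V \<Lambda>) X
    = tensor_id N m (\<lambda>Y. mixture N I \<mu> (\<lambda>y. U y * \<Lambda> (V y * Y * adj (V y)) * adj (U y))) X"
    by (rule tensor_id_cong) (simp add: unitary_mixture_def)
  also have "\<dots> = mixture (N * m) I \<mu> (\<lambda>y. tensor_id N m (\<lambda>Y. U y * \<Lambda> (V y * Y * adj (V y)) * adj (U y)) X)"
    by (rule tensor_id_mixture)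
  also have "\<dots> = mixture (N * m) I \<mu> (\<lambda>y.
    kron_id N m (U y) * tensor_id N m \<Lambda> (kron_id N m (V y) * X * adj (kron_id N m (V y))) * adj (kron_id N m (U y)))"
  proof (rule mixture_cong)
    fix y assume y: "y \<in> I"
    have c: "U y \<in> carrier_mat N N" "V y \<in> carrier_mat N N"
      using U[OF y] V[OF y] by (auto simp: unitary_def)
    have "tensor_id N m (\<lambda>Y. U y * \<Lambda> (V y * Y * adj (V y)) * adj (U y)) X
      = tensor_id N m (\<lambda>Y. U y * Y * adj (U y)) (tensor_id N m (\<lambda>Y. \<Lambda> (V y * Y * adj (V y))) X)"
      by (rule tensor_id_comp[where f = "\<lambda>Y. U y * Y * adj (U y)"])
        (use c in \<open>auto intro!: channel_carrier[OF L]\<close>)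
    also have "tensor_id N m (\<lambda>Y. \<Lambda> (V y * Y * adj (V y))) X
      = tensor_id N m \<Lambda> (tensor_id N m (\<lambda>Y. V y * Y * adj (V y)) X)"
      by (rule tensor_id_comp) (use c in auto)
    finally show "tensor_id N m (\<lambda>Y. U y * \<Lambda> (V y * Y * adj (V y)) * adj (U y)) X =
      kron_id N m (U y) * tensor_id N m \<Lambda> (kron_id N m (V y) * X * adj (kron_id N m (V y))) * adj (kron_id N m (U y))"
      by (simp add: tensor_id_conj[OF c(1)] tensor_id_conj[OF c(2) X])
  qed
  finally show ?thesis .
qed

lemma mult_add_mult:
  fixes A :: "complex mat"
  assumes "P \<in> carrier_mat N N" "A \<in> carrier_mat N N" "B \<in> carrier_mat N N" "Q \<in> carrier_mat N N"
  shows "P * (A + B) * Q = P * A * Q + P * B * Q"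
  using assms by (simp add: mult_add_distrib_mat[of _ N N _ N] add_mult_distrib_mat[of _ N N _ _ N])

lemma mult_smult_mult:
  fixes A :: "complex mat"
  assumes "P \<in> carrier_mat N N" "A \<in> carrier_mat N N" "Q \<in> carrier_mat N N"
  shows "P * (c \<cdot>\<^sub>m A) * Q = c \<cdot>\<^sub>m (P * A * Q)"
  using assms by (simp add: mult_smult_distrib[of _ N N _ N] mult_smult_assoc_mat[of _ N N _ N])

lemma is_channel_unitary_mixture:
  assumes L: "is_channel N \<Lambda>" and mu: "\<And>y. y \<in> I \<Longrightarrow> 0 \<le> \<mu> y" "sum \<mu> I = 1"
    and U: "\<And>y. y \<in> I \<Longrightarrow> unitary N (U y)" and V: "\<And>y. y \<in> I \<Longrightarrow> unitary N (V y)"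
  shows "is_channel N (unitary_mixture N I \<mu> U V \<Lambda>)"
proof -
  let ?F = "\<lambda>y X. U y * \<Lambda> (V y * X * adj (V y)) * adj (U y)"
  have c: "U y \<in> carrier_mat N N" "V y \<in> carrier_mat N N" "adj (U y) \<in> carrier_mat N N" "adj (V y) \<in> carrier_mat N N"
    if "y \<in> I" for y using U[OF that] V[OF that] by (auto simp: unitary_def)
  have add: "\<And>X Y. X \<in> carrier_mat N N \<Longrightarrow> Y \<in> carrier_mat N N \<Longrightarrow> \<Lambda> (X + Y) = \<Lambda> X + \<Lambda> Y"
    and smult: "\<And>X k. X \<in> carrier_mat N N \<Longrightarrow> \<Lambda> (k \<cdot>\<^sub>m X) = k \<cdot>\<^sub>m \<Lambda> X"
    using L by (auto simp: is_channel_def)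
  have Fc: "?F y X \<in> carrier_mat N N" if "y \<in> I" "X \<in> carrier_mat N N" for y X
    using c[OF that(1)] that(2) by (auto intro!: mult_carrier_square channel_carrier[OF L])
  have Fadd: "?F y (X + Y) = ?F y X + ?F y Y" if "y \<in> I" "X \<in> carrier_mat N N" "Y \<in> carrier_mat N N" for y X Y
    using c[OF that(1)] that(2,3) by (simp add: mult_add_mult[of _ N] add channel_carrier[OF L])
  have Fsmult: "?F y (k \<cdot>\<^sub>m X) = k \<cdot>\<^sub>m ?F y X" if "y \<in> I" "X \<in> carrier_mat N N" for y X k
    using c[OF that(1)] that(2) by (simp add: mult_smult_mult[of _ N] smult channel_carrier[OF L])
  have Ftr: "mtrace (?F y X) = mtrace X" if "y \<in> I" "X \<in> carrier_mat N N" for y X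
    using c[OF that(1)] that(2)
    by (simp add: mtrace_conj_unitary[OF U[OF that(1)]] mtrace_conj_unitary[OF V[OF that(1)]]
        channel_carrier[OF L] channel_trace[OF L])
  show ?thesis
    unfolding is_channel_def
  proof (intro conjI ballI allI impI)
    fix X Y :: "complex mat" assume XY: "X \<in> carrier_mat N N" "Y \<in> carrier_mat N N"
    have "mixture N I \<mu> (\<lambda>y. ?F y (X + Y)) = mixture N I \<mu> (\<lambda>y. ?F y X + ?F y Y)"
      by (rule mixture_cong) (rule Fadd[OF _ XY])
    also have "\<dots> = mixture N I \<mu> (\<lambda>y. ?F y X) + mixture N I \<mu> (\<lambda>y. ?F y Y)"
    proof (rule eq_matI)
      fix i j assume "i < dim_row (mixture N I \<mu> (\<lambda>y. ?F y X) + mixture N I \<mu> (\<lambda>y. ?F y Y))"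
        "j < dim_col (mixture N I \<mu> (\<lambda>y. ?F y X) + mixture N I \<mu> (\<lambda>y. ?F y Y))"
      hence ij: "i < N" "j < N" by (auto simp: mixture_def)
      have "(\<Sum>y\<in>I. of_real (\<mu> y) * (?F y X + ?F y Y) $$ (i, j))
        = (\<Sum>y\<in>I. of_real (\<mu> y) * ?F y X $$ (i, j) + of_real (\<mu> y) * ?F y Y $$ (i, j))"
      proof (rule sum.cong[OF refl])
        fix y assume y: "y \<in> I"
        have "(?F y X + ?F y Y) $$ (i, j) = ?F y X $$ (i, j) + ?F y Y $$ (i, j)"
          by (rule index_add_mat) (use Fc[OF y XY(2)] ij in auto)
        thus "of_real (\<mu> y) * (?F y X + ?F y Y) $$ (i, j)
          = of_real (\<mu> y) * ?F y X $$ (i, j) + of_real (\<mu> y) * ?F y Y $$ (i, j)"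
          by (simp only: distrib_left)
      qed
      thus "mixture N I \<mu> (\<lambda>y. ?F y X + ?F y Y) $$ (i, j)
        = (mixture N I \<mu> (\<lambda>y. ?F y X) + mixture N I \<mu> (\<lambda>y. ?F y Y)) $$ (i, j)"
        using ij by (simp add: mixture_def sum.distrib)
    qed (auto simp: mixture_def)
    finally show "unitary_mixture N I \<mu> U V \<Lambda> (X + Y) = unitary_mixture N I \<mu> U V \<Lambda> X + unitary_mixture N I \<mu> U V \<Lambda> Y"
      using XY by (simp add: unitary_mixture_def)
  next
    fix X :: "complex mat" and k :: complex assume X: "X \<in> carrier_mat N N"
    have "mixture N I \<mu> (\<lambda>y. ?F y (k \<cdot>\<^sub>m X)) = mixture N I \<mu> (\<lambda>y. k \<cdot>\<^sub>m ?F y X)"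
      by (rule mixture_cong) (rule Fsmult[OF _ X])
    also have "\<dots> = k \<cdot>\<^sub>m mixture N I \<mu> (\<lambda>y. ?F y X)"
    proof (rule eq_matI)
      fix i j assume "i < dim_row (k \<cdot>\<^sub>m mixture N I \<mu> (\<lambda>y. ?F y X))"
        "j < dim_col (k \<cdot>\<^sub>m mixture N I \<mu> (\<lambda>y. ?F y X))"
      hence ij: "i < N" "j < N" by (auto simp: mixture_def)
      have "(\<Sum>y\<in>I. of_real (\<mu> y) * (k \<cdot>\<^sub>m ?F y X) $$ (i, j)) = (\<Sum>y\<in>I. k * (of_real (\<mu> y) * ?F y X $$ (i, j)))"
      proof (rule sum.cong[OF refl])
        fix y assume y: "y \<in> I"
        have "(k \<cdot>\<^sub>m ?F y X) $$ (i, j) = k * ?F y X $$ (i, j)"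
          by (rule index_smult_mat) (use Fc[OF y X] ij in auto)
        thus "of_real (\<mu> y) * (k \<cdot>\<^sub>m ?F y X) $$ (i, j) = k * (of_real (\<mu> y) * ?F y X $$ (i, j))"
          by (simp only: mult.left_commute)
      qed
      thus "mixture N I \<mu> (\<lambda>y. k \<cdot>\<^sub>m ?F y X) $$ (i, j) = (k \<cdot>\<^sub>m mixture N I \<mu> (\<lambda>y. ?F y X)) $$ (i, j)"
        using ij by (simp add: mixture_def sum_distrib_left)
    qed (auto simp: mixture_def)
    finally show "unitary_mixture N I \<mu> U V \<Lambda> (k \<cdot>\<^sub>m X) = k \<cdot>\<^sub>m unitary_mixture N I \<mu> U V \<Lambda> X"
      using X by (simp add: unitary_mixture_def)
  next
    fix X :: "complex mat" assume X: "X \<in> carrier_mat N N"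
    have "mtrace (mixture N I \<mu> (\<lambda>y. ?F y X)) = (\<Sum>y\<in>I. of_real (\<mu> y) * mtrace X)"
      using Fc[OF _ X] Ftr[OF _ X] by (subst mtrace_mixture) auto
    also have "\<dots> = mtrace X" using mu(2) by (simp add: sum_distrib_right[symmetric] flip: of_real_sum)
    finally show "mtrace (unitary_mixture N I \<mu> U V \<Lambda> X) = mtrace X" using X by (simp add: unitary_mixture_def)
  next
    fix m :: nat and X assume m: "m > 0" and X: "psd (N * m) X"
    \<comment> \<open>Complete positivity: extended by the ancilla, the map is still a mixture of
      conjugated outputs of \<open>\<Lambda>\<close>.\<close>
    show "psd (N * m) (tensor_id N m (unitary_mixture N I \<mu> U V \<Lambda>) X)"
      by (subst tensor_id_unitary_mixture[OF L U V psd_carrier[OF X]])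
        (auto intro!: psd_mixture mu psd_conj channel_tensor_psd[OF L m] X)
  qed (auto simp: unitary_mixture_def)
qed

text \<open>For an input \<open>\<rho>\<close>, component \<open>y\<close> of the output comes from
  the rotated input \<open>\<rho>' y\<close>, which is itself a competitor in the supremum for
  \<open>\<Lambda>\<close>, with the same reference state. All components thus lie below that
  supremum, which serves as the bound \<open>B\<close> in
  \<open>sandwiched_renyi_mixture_le\<close>.\<close>

theorem chan_renyi_div_unitary_mixture_le:
  assumes L: "is_channel (d ^ n) \<Lambda>" and d: "d > 0" and \<alpha>: "ereal (1 / 2) \<le> \<alpha>"
    and I: "finite I" and mu: "\<And>y. y \<in> I \<Longrightarrow> 0 \<le> \<mu> y" "sum \<mu> I = 1"
    and U: "\<And>y. y \<in> I \<Longrightarrow> unitary (d ^ n) (U y)" and V: "\<And>y. y \<in> I \<Longrightarrow> unitary (d ^ n) (V y)"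
  shows "chan_renyi_div d n \<alpha> (unitary_mixture (d ^ n) I \<mu> U V \<Lambda>) \<le> chan_renyi_div d n \<alpha> \<Lambda>"
proof -
  define N where "N = d ^ n"
  note L = L[folded N_def] and U = U[folded N_def] and V = V[folded N_def]
  have N: "N > 0" using d by (simp add: N_def)
  have "sandwiched_renyi (N * m) \<alpha> (tensor_id N m (unitary_mixture N I \<mu> U V \<Lambda>) \<rho>) (tensor_id N m (depol N) \<rho>)
      \<le> chan_renyi_div d n \<alpha> \<Lambda>" if m: "m > 0" and \<rho>: "density (N * m) \<rho>" for m \<rho>
  proof -
    define \<sigma> where "\<sigma> = tensor_id N m (depol N) \<rho>"
    define \<rho>' where "\<rho>' y = kron_id N m (V y) * \<rho> * adj (kron_id N m (V y))" for y
    define \<tau> where "\<tau> y = tensor_id N m \<Lambda> (\<rho>' y)" for y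
    have \<rho>c: "\<rho> \<in> carrier_mat (N * m) (N * m)" using \<rho> by (auto simp: density_def psd_carrier)
    have \<sigma>: "density (N * m) \<sigma>" unfolding \<sigma>_def by (rule density_tensor_id_depol[OF N \<rho>])
    have \<rho>': "density (N * m) (\<rho>' y)" if "y \<in> I" for y
      unfolding \<rho>'_def by (rule density_conj_unitary[OF unitary_kron_id[OF V[OF that]] \<rho>])
    have \<sigma>': "tensor_id N m (depol N) (\<rho>' y) = \<sigma>" if "y \<in> I" for y
      unfolding \<rho>'_def \<sigma>_def by (rule tensor_id_depol_conj_input[OF V[OF that] \<rho>c])
    have \<tau>: "density (N * m) (\<tau> y)" if "y \<in> I" for y
      unfolding \<tau>_def by (rule density_tensor_id[OF L m \<rho>'[OF that]])
    \<comment> \<open>The constant is the same for all \<open>y\<close>, as the lemma on mixtures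
      requires.\<close>
    have D: "psd (N * m) (of_real (real (N * N)) \<cdot>\<^sub>m \<sigma> - \<tau> y)" if "y \<in> I" for y
      using psd_dominated_by_depol[of N m "\<tau> y"] \<tau>[OF that] \<sigma>'[OF that]
      by (simp add: density_def \<tau>_def tensor_id_depol_channel[OF L])
    have K: "unitary (N * m) (kron_id N m (U y))" if "y \<in> I" for y by (rule unitary_kron_id[OF U[OF that]])
    have fixed: "kron_id N m (U y) * \<sigma> * adj (kron_id N m (U y)) = \<sigma>" if "y \<in> I" for y
      unfolding \<sigma>_def by (rule tensor_id_depol_conj_output[OF U[OF that]])
    have "sandwiched_renyi (N * m) \<alpha> (mixture (N * m) I \<mu> (\<lambda>y. kron_id N m (U y) * \<tau> y * adj (kron_id N m (U y)))) \<sigma>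
      \<le> chan_renyi_div d n \<alpha> \<Lambda>"
    proof (rule sandwiched_renyi_mixture_le[OF I mu _ \<sigma> _ _ \<alpha>])
      show "0 < real (N * N)" using N by simp
      fix y assume y: "y \<in> I"
      show "density (N * m) (kron_id N m (U y) * \<tau> y * adj (kron_id N m (U y)))"
        by (rule density_conj_unitary[OF K[OF y] \<tau>[OF y]])
      have sc: "\<sigma> \<in> carrier_mat (N * m) (N * m)" "\<tau> y \<in> carrier_mat (N * m) (N * m)"
        by (auto simp: \<sigma>_def \<tau>_def)
      have "kron_id N m (U y) * (of_real (real (N * N)) \<cdot>\<^sub>m \<sigma> - \<tau> y) * adj (kron_id N m (U y))
        = of_real (real (N * N)) \<cdot>\<^sub>m \<sigma> - kron_id N m (U y) * \<tau> y * adj (kron_id N m (U y))"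
        by (subst mult_smult_diff_mult[of _ "N * m"]) (use sc in \<open>auto simp: fixed[OF y]\<close>)
      thus "psd (N * m) (of_real (real (N * N)) \<cdot>\<^sub>m \<sigma> - kron_id N m (U y) * \<tau> y * adj (kron_id N m (U y)))"
        using psd_conj[OF D[OF y] kron_id_carrier[of N m "U y"]] by simp
      have "sandwiched_renyi (N * m) \<alpha> (kron_id N m (U y) * \<tau> y * adj (kron_id N m (U y))) \<sigma>
        = sandwiched_renyi (N * m) \<alpha> (\<tau> y) \<sigma>"
        using \<tau>[OF y] \<sigma> by (intro sandwiched_renyi_conj_unitary[OF _ _ D[OF y] K[OF y] fixed[OF y]])
          (auto simp: density_def)
      also have "\<dots> = sandwiched_renyi (N * m) \<alpha> (tensor_id N m \<Lambda> (\<rho>' y)) (tensor_id N m (depol N) (\<rho>' y))"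
        by (simp add: \<sigma>'[OF y] \<tau>_def)
      also have "\<dots> \<le> chan_renyi_div d n \<alpha> \<Lambda>"
        unfolding chan_renyi_div_def N_def[symmetric] using m \<rho>'[OF y]
        by (intro SUP_upper2[of "(m, \<rho>' y)"]) auto
      finally show "sandwiched_renyi (N * m) \<alpha> (kron_id N m (U y) * \<tau> y * adj (kron_id N m (U y))) \<sigma>
        \<le> chan_renyi_div d n \<alpha> \<Lambda>" .
    qed
    thus ?thesis
      by (subst tensor_id_unitary_mixture[OF L U V \<rho>c]) (auto simp: \<tau>_def \<rho>'_def \<sigma>_def)
  qed
  thus ?thesis
    unfolding chan_renyi_div_def[of d n \<alpha> "unitary_mixture _ _ _ _ _ _"] N_def[symmetric]
    by (intro SUP_least) auto
qed

section \<open>Weyl operators and mean states\<close>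

lemma digit_Suc:
  assumes "k < m"
  shows "digit d (Suc m) k i = digit d m k (i div d)"
proof -
  have "m - k = Suc (m - 1 - k)" using assms by simp
  thus ?thesis by (simp add: digit_def div_mult2_eq)
qed

lemma digit_Suc_last: "digit d (Suc m) m i = i mod d"
  by (simp add: digit_def)

lemma digit_less: "0 < d \<Longrightarrow> digit d m k i < d"
  by (simp add: digit_def)

lemma digit_inject:
  assumes "i < d ^ m" "j < d ^ m" "\<And>k. k < m \<Longrightarrow> digit d m k i = digit d m k j"
  shows "i = j"
  using assms
proof (induction m arbitrary: i j)
  case (Suc m)
  have "i div d < d ^ m" "j div d < d ^ m"
    using Suc.prems by (auto simp: less_mult_imp_div_less mult.commute)
  moreover have "digit d m k (i div d) = digit d m k (j div d)" if "k < m" for k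
    using Suc.prems(3)[of k] that by (simp add: digit_Suc)
  ultimately have "i div d = j div d" by (rule Suc.IH)
  moreover have "i mod d = j mod d" using Suc.prems(3)[of m] by (simp add: digit_Suc_last)
  ultimately show ?case by (metis div_mult_mod_eq)
qed simp

lemma digit_surject:
  assumes "\<And>k. k < m \<Longrightarrow> c k < d"
  shows "\<exists>i<d ^ m. \<forall>k<m. digit d m k i = c k"
  using assms
proof (induction m)
  case (Suc m)
  then obtain i where i: "i < d ^ m" "\<forall>k<m. digit d m k i = c k" by force
  have cm: "c m < d" using Suc.prems by simp
  have "digit d (Suc m) k (i * d + c m) = c k" if "k < Suc m" for k
    using that i cm by (cases "k = m") (auto simp: digit_Suc digit_Suc_last)
  moreover have "i * d + c m < d ^ Suc m"
    using times_add_less[OF i(1) cm] by (simp add: mult.commute)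
  ultimately show ?case by blast
qed simp

section \<open>Characters modulo \<open>d\<close>\<close>

lemma chi_add: "chi d (a + b) = chi d a * chi d b"
  by (simp add: chi_def exp_add[symmetric] algebra_simps add_divide_distrib)

lemma chi_zero [simp]: "chi d 0 = 1"
  by (simp add: chi_def)

lemma chi_cis: "chi d k = cis (2 * pi * of_int k / of_nat d)"
  by (simp add: chi_def cis_conv_exp mult_ac)

lemma cmod_chi [simp]: "cmod (chi d k) = 1"
  by (simp add: chi_cis)

lemma chi_eq_1_iff:
  assumes "0 < d"
  shows "chi d k = 1 \<longleftrightarrow> int d dvd k"
proof
  assume "chi d k = 1"
  hence "cos (2 * pi * of_int k / of_nat d) = 1" by (metis chi_cis cis.simps(1) one_complex.simps(1))
  then obtain n :: int where "2 * pi * of_int k / of_nat d = of_int n * 2 * pi"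
    by (auto simp: cos_one_2pi_int)
  hence "real_of_int k = of_int (n * int d)" using assms by (simp add: field_simps)
  hence "k = n * int d" unfolding of_int_eq_iff .
  thus "int d dvd k" by simp
next
  assume "int d dvd k"
  then obtain n where "k = int d * n" by blast
  hence "2 * pi * of_int k / of_nat d = 2 * pi * of_int n" using assms by simp
  thus "chi d k = 1" unfolding chi_cis by (simp add: cis_multiple_2pi)
qed

lemma chi_cong:
  assumes "0 < d" "int d dvd a - b"
  shows "chi d a = chi d b"
  using chi_add[of d b "a - b"] assms chi_eq_1_iff[of d "a - b"] by simp

text \<open>The bicharacter \<open>chi(x . y)\<close> on integer vectors; commutation phases of Weyl
  operators and the Fourier analysis on phase space are expressed by it.\<close>

definition chdot :: "nat \<Rightarrow> nat \<Rightarrow> (nat \<Rightarrow> int) \<Rightarrow> (nat \<Rightarrow> int) \<Rightarrow> complex" where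
  "chdot d m x y = chi d (\<Sum>k<m. x k * y k)"

lemma chdot_add_left: "chdot d m (\<lambda>k. x k + x' k) y = chdot d m x y * chdot d m x' y"
  by (simp add: chdot_def chi_add[symmetric] sum.distrib algebra_simps)

lemma chdot_commute: "chdot d m x y = chdot d m y x"
  by (simp add: chdot_def mult.commute)

lemma chdot_add_right: "chdot d m x (\<lambda>k. y k + y' k) = chdot d m x y * chdot d m x y'"
  by (simp add: chdot_commute[of d m x] chdot_add_left)

lemma chdot_minus: "chdot d m (\<lambda>k. - x k) y = chdot d m x (\<lambda>k. - y k)"
  by (simp add: chdot_def)

lemma cmod_chdot [simp]: "cmod (chdot d m x y) = 1"
  by (simp add: chdot_def)

lemma chdot_cong:
  assumes "0 < d" "\<And>k. k < m \<Longrightarrow> int d dvd x k - x' k"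
  shows "chdot d m x y = chdot d m x' y"
proof -
  have "(\<Sum>k<m. x k * y k) - (\<Sum>k<m. x' k * y k) = (\<Sum>k<m. (x k - x' k) * y k)"
    by (simp add: sum_subtractf algebra_simps)
  moreover have "int d dvd (\<Sum>k<m. (x k - x' k) * y k)"
    using assms by (intro dvd_sum dvd_mult2) auto
  ultimately show ?thesis unfolding chdot_def using assms(1) by (intro chi_cong) auto
qed

lemma chdot_eq_1:
  assumes "0 < d" "\<And>k. k < m \<Longrightarrow> int d dvd x k"
  shows "chdot d m x y = 1"
  using chdot_cong[OF assms(1), of m x "\<lambda>_. 0" y] assms(2) by (simp add: chdot_def)

lemma chdot_cancel: "chdot d m x y * chdot d m x (\<lambda>k. - y k) = 1"
  by (simp add: chdot_def chi_add[symmetric] sum_negf)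

text \<open>Representatives of the vectors over the integers modulo \<open>d\<close>. As extensional
  functions they form a finite set on which congruence is plain equality, while the Weyl operators
  themselves accept arbitrary integer vectors.\<close>

definition residue_vectors :: "nat \<Rightarrow> nat \<Rightarrow> (nat \<Rightarrow> int) set" where
  "residue_vectors d m = ({..<m} \<rightarrow>\<^sub>E {0..<int d})"

definition reduce :: "nat \<Rightarrow> nat \<Rightarrow> (nat \<Rightarrow> int) \<Rightarrow> nat \<Rightarrow> int" where
  "reduce d m x = restrict (\<lambda>k. x k mod int d) {..<m}"

lemma reduce_in: "0 < d \<Longrightarrow> reduce d m x \<in> residue_vectors d m"
  by (auto simp: reduce_def residue_vectors_def)

lemma reduce_dvd: "k < m \<Longrightarrow> int d dvd reduce d m x k - x k"
  by (simp add: reduce_def mod_eq_dvd_iff[symmetric])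

lemma finite_residue_vectors [simp]: "finite (residue_vectors d m)"
  by (auto simp: residue_vectors_def intro!: finite_PiE)

lemma card_residue_vectors: "card (residue_vectors d m) = d ^ m"
  by (simp add: residue_vectors_def card_PiE)

lemma residue_vectors_eqI:
  assumes "x \<in> residue_vectors d m" "y \<in> residue_vectors d m" "\<And>k. k < m \<Longrightarrow> int d dvd x k - y k"
  shows "x = y"
proof (rule PiE_ext[of x "{..<m}" "\<lambda>_. {0..<int d}" y])
  fix k assume "k \<in> {..<m}"
  hence k: "k < m" "k \<in> {..<m}" by auto
  have "x k \<in> {0..<int d}" "y k \<in> {0..<int d}"
    using assms(1,2) k unfolding residue_vectors_def by (auto dest!: PiE_mem[OF _ k(2)])
  thus "x k = y k" using assms(3)[OF k(1)] by (simp add: mod_eq_dvd_iff[symmetric])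
qed (use assms in \<open>auto simp: residue_vectors_def\<close>)

lemma inj_on_translate: "inj_on (\<lambda>x. reduce d m (\<lambda>k. x k + t k)) (residue_vectors d m)"
proof (rule inj_onI)
  fix x y assume xy: "x \<in> residue_vectors d m" "y \<in> residue_vectors d m"
    and eq: "reduce d m (\<lambda>k. x k + t k) = reduce d m (\<lambda>k. y k + t k)"
  show "x = y"
  proof (rule residue_vectors_eqI[OF xy])
    fix k assume k: "k < m"
    have "(x k + t k) mod int d = (y k + t k) mod int d"
      using fun_cong[OF eq, of k] k by (simp add: reduce_def)
    thus "int d dvd x k - y k" by (simp add: mod_eq_dvd_iff)
  qed
qed

text \<open>The usual cancellation device: with \<open>c \<noteq> 1\<close> the sum must vanish. It
  serves the orthogonality of characters as well as the sum of a character over a subgroup.\<close>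

lemma sum_scaled_by_permutation:
  fixes h :: "'a \<Rightarrow> complex"
  assumes "finite A" "f ` A \<subseteq> A" "inj_on f A" "\<And>x. x \<in> A \<Longrightarrow> h (f x) = c * h x"
  shows "sum h A = c * sum h A"
proof -
  have "sum h A = sum h (f ` A)" using endo_inj_surj[OF assms(1-3)] by simp
  also have "\<dots> = (\<Sum>x\<in>A. h (f x))" using sum.reindex[OF assms(3)] by simp
  also have "\<dots> = c * sum h A" using assms(4) by (simp add: sum_distrib_left)
  finally show ?thesis .
qed

text \<open>If some \<open>y k\<close> is not divisible by \<open>d\<close>, translation by the
  \<open>k\<close>-th unit vector permutes the summands and rescales the sum by
  \<open>chi d (y k) \<noteq> 1\<close>.\<close>

lemma chdot_orthogonality:
  assumes d: "0 < d"
  shows "(\<Sum>x\<in>residue_vectors d m. chdot d m x y) = (if \<forall>k<m. int d dvd y k then of_nat (d ^ m) else 0)"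
proof (cases "\<forall>k<m. int d dvd y k")
  case True
  hence "chdot d m x y = 1" for x
    using chdot_eq_1[OF d, of m y x] by (simp add: chdot_commute)
  thus ?thesis using True by (simp add: card_residue_vectors)
next
  case False
  then obtain k where k: "k < m" "\<not> int d dvd y k" by blast
  let ?t = "\<lambda>l. if l = k then 1 else 0 :: int"
  have t: "chdot d m ?t y = chi d (y k)"
    using k by (simp add: chdot_def if_distrib[of "\<lambda>z. z * _"] cong: if_cong)
  have "(\<Sum>x\<in>residue_vectors d m. chdot d m x y) = chi d (y k) * (\<Sum>x\<in>residue_vectors d m. chdot d m x y)"
  proof (rule sum_scaled_by_permutation[OF finite_residue_vectors _ inj_on_translate])
    show "(\<lambda>x. reduce d m (\<lambda>k. x k + ?t k)) ` residue_vectors d m \<subseteq> residue_vectors d m"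
      using reduce_in[OF d] by blast
    fix x
    have "chdot d m (reduce d m (\<lambda>k. x k + ?t k)) y = chdot d m (\<lambda>k. x k + ?t k) y"
      by (rule chdot_cong[OF d reduce_dvd])
    thus "chdot d m (reduce d m (\<lambda>k. x k + ?t k)) y = chi d (y k) * chdot d m x y"
      by (simp only: chdot_add_left t mult.commute)
  qed
  moreover have "chi d (y k) \<noteq> 1" using k chi_eq_1_iff[OF d] by simp
  ultimately show ?thesis using False by auto
qed

section \<open>Basis states under cyclic shifts\<close>

definition digits :: "nat \<Rightarrow> nat \<Rightarrow> nat \<Rightarrow> nat \<Rightarrow> int" where
  "digits d m i k = int (digit d m k i)"

text \<open>The index of the basis state \<open>X^q |j>\<close>. Describing it by congruences admits
  arbitrary integer vectors \<open>q\<close>, so sums and negatives of shifts need no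
  reduction.\<close>

definition shift :: "nat \<Rightarrow> nat \<Rightarrow> (nat \<Rightarrow> int) \<Rightarrow> nat \<Rightarrow> nat" where
  "shift d m q j = (THE i. i < d ^ m \<and> (\<forall>k<m. int d dvd digits d m i k - (digits d m j k + q k)))"

lemma digits_inject:
  assumes "0 < d" "i < d ^ m" "j < d ^ m" "\<And>k. k < m \<Longrightarrow> int d dvd digits d m i k - digits d m j k"
  shows "i = j"
proof (rule digit_inject[OF assms(2,3)])
  fix k assume "k < m"
  hence "int (digit d m k i) mod int d = int (digit d m k j) mod int d"
    using assms(4) by (simp add: digits_def mod_eq_dvd_iff)
  thus "digit d m k i = digit d m k j"
    using digit_less[OF assms(1)] by (simp flip: of_nat_mod)
qed

lemma shift_ex1:
  assumes d: "0 < d"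
  shows "\<exists>!i. i < d ^ m \<and> (\<forall>k<m. int d dvd digits d m i k - (digits d m j k + q k))"
proof (rule ex_ex1I)
  let ?c = "\<lambda>k. nat ((digits d m j k + q k) mod int d)"
  have "?c k < d" for k using d by (simp add: nat_less_iff)
  then obtain i where i: "i < d ^ m" "\<forall>k<m. digit d m k i = ?c k" using digit_surject[of m ?c d] by auto
  have "int d dvd digits d m i k - (digits d m j k + q k)" if "k < m" for k
  proof -
    have "digits d m i k = (digits d m j k + q k) mod int d" using i(2) that d by (simp add: digits_def[of d m i])
    thus ?thesis by (simp add: mod_eq_dvd_iff[symmetric])
  qed
  thus "\<exists>i<d ^ m. \<forall>k<m. int d dvd digits d m i k - (digits d m j k + q k)" using i(1) by blast
next
  fix i i' assume *: "i < d ^ m \<and> (\<forall>k<m. int d dvd digits d m i k - (digits d m j k + q k))"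
    "i' < d ^ m \<and> (\<forall>k<m. int d dvd digits d m i' k - (digits d m j k + q k))"
  have "int d dvd digits d m i k - digits d m i' k" if "k < m" for k
    using dvd_diff[of "int d" "digits d m i k - (digits d m j k + q k)" "digits d m i' k - (digits d m j k + q k)"]
      * that by simp
  thus "i = i'" using * by (intro digits_inject[OF d]) auto
qed

lemma shift_less: "0 < d \<Longrightarrow> shift d m q j < d ^ m"
  and digits_shift: "0 < d \<Longrightarrow> k < m \<Longrightarrow> int d dvd digits d m (shift d m q j) k - (digits d m j k + q k)"
  unfolding shift_def using theI'[OF shift_ex1[of d m j q]] by blast+

lemma shift_eqI:
  assumes "0 < d" "i < d ^ m" "\<And>k. k < m \<Longrightarrow> int d dvd digits d m i k - (digits d m j k + q k)"
  shows "shift d m q j = i"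
  unfolding shift_def using assms by (intro the1_equality[OF shift_ex1]) auto

lemma eq_shift_iff:
  assumes "0 < d" "i < d ^ m"
  shows "i = shift d m q j \<longleftrightarrow> (\<forall>k<m. int d dvd digits d m i k - (digits d m j k + q k))"
  using shift_eqI[OF assms] digits_shift[OF assms(1)] by metis

lemma shift_shift:
  assumes "0 < d"
  shows "shift d m q (shift d m q' j) = shift d m (\<lambda>k. q k + q' k) j"
proof (rule shift_eqI[OF assms shift_less[OF assms]])
  fix k assume "k < m"
  from digits_shift[OF assms this, of "\<lambda>k. q k + q' k" j] digits_shift[OF assms this, of q' j]
  have "int d dvd (digits d m (shift d m (\<lambda>k. q k + q' k) j) k - (digits d m j k + (q k + q' k))) -
    (digits d m (shift d m q' j) k - (digits d m j k + q' k))"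
    by (rule dvd_diff)
  thus "int d dvd digits d m (shift d m (\<lambda>k. q k + q' k) j) k - (digits d m (shift d m q' j) k + q k)"
    by (simp add: algebra_simps)
qed

lemma shift_inj:
  assumes "0 < d" "i < d ^ m" "j < d ^ m" "shift d m q i = shift d m q j"
  shows "i = j"
proof (rule digits_inject[OF assms(1-3)])
  fix k assume "k < m"
  from digits_shift[OF assms(1) this, of q j] digits_shift[OF assms(1) this, of q i]
  have "int d dvd (digits d m (shift d m q j) k - (digits d m j k + q k)) -
    (digits d m (shift d m q i) k - (digits d m i k + q k))"
    by (rule dvd_diff)
  thus "int d dvd digits d m i k - digits d m j k" by (simp add: assms(4))
qed

lemma chdot_digits_shift:
  assumes "0 < d"
  shows "chdot d m p (digits d m (shift d m q j)) = chdot d m p (digits d m j) * chdot d m p q"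
proof -
  have "chdot d m (digits d m (shift d m q j)) p = chdot d m (\<lambda>k. digits d m j k + q k) p"
    by (rule chdot_cong[OF assms digits_shift[OF assms]])
  thus ?thesis by (simp add: chdot_commute[of d m p] chdot_add_left)
qed

text \<open>The operator \<open>Z\<^sup>p X\<^sup>q\<close>, that is, the Weyl operator without its phase.\<close>

definition clock_shift :: "nat \<Rightarrow> nat \<Rightarrow> (nat \<Rightarrow> int) \<Rightarrow> (nat \<Rightarrow> int) \<Rightarrow> complex mat" where
  "clock_shift d m p q = mat (d ^ m) (d ^ m) (\<lambda>(i, j).
     if i = shift d m q j then chdot d m p (digits d m i) else 0)"

text \<open>Unimodular, hence invisible in moduli of the characteristic function and in
  conjugations. Splitting it off leaves operators with a simple multiplication rule.\<close>

definition weyl_phase :: "nat \<Rightarrow> nat \<Rightarrow> (nat \<Rightarrow> int) \<Rightarrow> (nat \<Rightarrow> int) \<Rightarrow> complex" where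
  "weyl_phase d m p q = (\<Prod>k<m. chi d (- inv2 d * p k * q k))"

lemma cmod_weyl_phase [simp]: "cmod (weyl_phase d m p q) = 1"
  by (simp add: weyl_phase_def prod_norm[symmetric])

lemma clock_shift_carrier [simp]: "clock_shift d m p q \<in> carrier_mat (d ^ m) (d ^ m)"
  by (simp add: clock_shift_def)

lemma clock_shift_dim [simp]: "dim_row (clock_shift d m p q) = d ^ m" "dim_col (clock_shift d m p q) = d ^ m"
  by (simp_all add: clock_shift_def)

lemma smult_smult_mat: "(a::complex) \<cdot>\<^sub>m (b \<cdot>\<^sub>m A) = (a * b) \<cdot>\<^sub>m A"
  by (rule eq_matI) auto

lemma clock_shift_index:
  "i < d ^ m \<Longrightarrow> j < d ^ m \<Longrightarrow>
    clock_shift d m p q $$ (i, j) = (if i = shift d m q j then chdot d m p (digits d m i) else 0)"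
  by (simp add: clock_shift_def)

lemma chi_sum: "chi d (sum f A) = (\<Prod>x\<in>A. chi d (f x))"
  by (induction A rule: infinite_finite_induct) (auto simp: chi_add)

text \<open>The product over the qudits is nonzero exactly when every digit condition holds, that
  is, when \<open>i = shift d m q j\<close>; the local phases then multiply to
  \<open>weyl_phase\<close> and a character.\<close>

lemma weyl_eq_clock_shift:
  assumes d: "0 < d"
  shows "weyl d m p q = weyl_phase d m p q \<cdot>\<^sub>m clock_shift d m p q"
proof (rule eq_matI)
  fix i j assume "i < dim_row (weyl_phase d m p q \<cdot>\<^sub>m clock_shift d m p q)"
    "j < dim_col (weyl_phase d m p q \<cdot>\<^sub>m clock_shift d m p q)"
  hence ij: "i < d ^ m" "j < d ^ m" by (auto simp: clock_shift_def)
  let ?P = "\<lambda>k. int d dvd digits d m i k - (digits d m j k + q k)"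
  have w: "weyl1 d (p k) (q k) $$ (digit d m k i, digit d m k j)
    = (if ?P k then chi d (- inv2 d * p k * q k) * chi d (p k * digits d m i k) else 0)" for k
    using digit_less[OF d] by (simp add: weyl1_def digits_def mod_eq_dvd_iff)
  have "weyl d m p q $$ (i, j) =
    (\<Prod>k<m. if ?P k then chi d (- inv2 d * p k * q k) * chi d (p k * digits d m i k) else 0)"
    using ij by (simp add: weyl_def w)
  also have "\<dots> = weyl_phase d m p q * (if \<forall>k<m. ?P k then chdot d m p (digits d m i) else 0)"
  proof (cases "\<forall>k<m. ?P k")
    case True
    thus ?thesis by (simp add: weyl_phase_def chdot_def chi_sum prod.distrib)
  next
    case False
    thus ?thesis by (subst prod_zero) auto
  qed
  also have "\<dots> = (weyl_phase d m p q \<cdot>\<^sub>m clock_shift d m p q) $$ (i, j)"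
    using ij eq_shift_iff[OF d ij(1)] by (simp add: clock_shift_def)
  finally show "weyl d m p q $$ (i, j) = (weyl_phase d m p q \<cdot>\<^sub>m clock_shift d m p q) $$ (i, j)" .
qed (auto simp: weyl_def clock_shift_def)

lemma weyl_carrier [simp]: "weyl d m p q \<in> carrier_mat (d ^ m) (d ^ m)"
  by (simp add: weyl_def)

text \<open>Moving \<open>X^q\<close> past \<open>Z^p'\<close> costs the phase
  \<open>chi(-p' . q)\<close>; exponents of like operators add.\<close>

lemma clock_shift_mult:
  assumes d: "0 < d"
  shows "clock_shift d m p q * clock_shift d m p' q' =
    chdot d m p' (\<lambda>k. - q k) \<cdot>\<^sub>m clock_shift d m (\<lambda>k. p k + p' k) (\<lambda>k. q k + q' k)"
proof (rule eq_matI)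
  let ?R = "chdot d m p' (\<lambda>k. - q k) \<cdot>\<^sub>m clock_shift d m (\<lambda>k. p k + p' k) (\<lambda>k. q k + q' k)"
  fix i j assume "i < dim_row ?R" "j < dim_col ?R"
  hence ij: "i < d ^ m" "j < d ^ m" by (auto simp: clock_shift_def)
  let ?l = "shift d m q' j"
  have "(clock_shift d m p q * clock_shift d m p' q') $$ (i, j) =
    (\<Sum>l<d ^ m. if l = ?l then (if i = shift d m q ?l
       then chdot d m p (digits d m i) * chdot d m p' (digits d m ?l) else 0) else 0)"
    unfolding mult_mat_index[OF clock_shift_carrier clock_shift_carrier ij]
    by (intro sum.cong refl) (use ij in \<open>auto simp: clock_shift_index\<close>)
  also have "\<dots> = (if i = shift d m q ?l then chdot d m p (digits d m i) * chdot d m p' (digits d m ?l) else 0)"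
    using shift_less[OF d] by simp
  also have "\<dots> = ?R $$ (i, j)"
  proof (cases "i = shift d m q ?l")
    case True
    have "chdot d m p' (digits d m i) * chdot d m p' (\<lambda>k. - q k)
        = chdot d m p' (digits d m ?l) * (chdot d m p' q * chdot d m p' (\<lambda>k. - q k))"
      unfolding True by (simp add: chdot_digits_shift[OF d])
    hence "chdot d m p' (digits d m ?l) = chdot d m p' (digits d m i) * chdot d m p' (\<lambda>k. - q k)"
      by (simp add: chdot_cancel)
    thus ?thesis using True ij by (simp add: clock_shift_index shift_shift[OF d] chdot_add_left mult_ac)
  next
    case False
    thus ?thesis using ij by (simp add: clock_shift_def shift_shift[OF d])
  qed
  finally show "(clock_shift d m p q * clock_shift d m p' q') $$ (i, j) = ?R $$ (i, j)" .
qed (auto simp: clock_shift_def)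

text \<open>Both orders give the same operator up to a phase; the quotient of the two phases is a
  character of the symplectic form of the labels.\<close>

lemma clock_shift_commute:
  assumes d: "0 < d"
  shows "clock_shift d m p q * clock_shift d m p' q' =
    (chdot d m p' (\<lambda>k. - q k) * chdot d m p q') \<cdot>\<^sub>m (clock_shift d m p' q' * clock_shift d m p q)"
proof -
  have "(chdot d m p' (\<lambda>k. - q k) * chdot d m p q') * chdot d m p (\<lambda>k. - q' k) = chdot d m p' (\<lambda>k. - q k)"
    using chdot_cancel[of d m p q'] by (simp add: mult.assoc)
  thus ?thesis
    unfolding clock_shift_mult[OF d] smult_smult_mat by (simp only: add.commute)
qed

lemma unitary_clock_shift:
  assumes d: "0 < d"
  shows "unitary (d ^ m) (clock_shift d m p q)"
proof (rule unitaryI_columns[OF clock_shift_carrier])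
  fix i j assume ij: "i < d ^ m" "j < d ^ m"
  have c: "cnj z * z = 1" if "cmod z = 1" for z
    using that by (metis complex_norm_square mult.commute of_real_1 one_power2)
  have "(\<Sum>k<d ^ m. cnj (clock_shift d m p q $$ (k, i)) * clock_shift d m p q $$ (k, j))
    = (\<Sum>k<d ^ m. if k = shift d m q i then (if shift d m q i = shift d m q j then 1 else 0) else 0)"
    by (intro sum.cong refl) (use ij in \<open>auto simp: clock_shift_index c\<close>)
  also have "\<dots> = (if i = j then 1 else 0)"
    using shift_less[OF d] shift_inj[OF d ij] by auto
  finally show "(\<Sum>k<d ^ m. cnj (clock_shift d m p q $$ (k, i)) * clock_shift d m p q $$ (k, j)) = (if i = j then 1 else 0)" .
qed

lemma unitary_smult:
  assumes "unitary N U" "cmod c = 1"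
  shows "unitary N (c \<cdot>\<^sub>m U)"
proof (rule unitaryI_columns)
  have U: "U \<in> carrier_mat N N" using assms(1) by (rule unitary_carrier)
  show "c \<cdot>\<^sub>m U \<in> carrier_mat N N" using U by simp
  have c: "cnj c * c = 1" using assms(2) by (metis complex_norm_square mult.commute of_real_1 one_power2)
  fix i j assume ij: "i < N" "j < N"
  have "(\<Sum>k<N. cnj ((c \<cdot>\<^sub>m U) $$ (k, i)) * (c \<cdot>\<^sub>m U) $$ (k, j)) = (\<Sum>k<N. (cnj c * c) * (cnj (U $$ (k, i)) * U $$ (k, j)))"
    by (intro sum.cong refl) (use ij U in auto)
  thus "(\<Sum>k<N. cnj ((c \<cdot>\<^sub>m U) $$ (k, i)) * (c \<cdot>\<^sub>m U) $$ (k, j)) = (if i = j then 1 else 0)"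
    using unitary_columns[OF assms(1) ij] by (simp add: c)
qed

lemma unitary_weyl: "0 < d \<Longrightarrow> unitary (d ^ m) (weyl d m p q)"
  by (simp add: weyl_eq_clock_shift unitary_smult unitary_clock_shift)

lemma clock_shift_cong:
  assumes d: "0 < d" and "\<And>k. k < m \<Longrightarrow> int d dvd p k - p' k" and q: "\<And>k. k < m \<Longrightarrow> int d dvd q k - q' k"
  shows "clock_shift d m p q = clock_shift d m p' q'"
proof -
  have "shift d m q j = shift d m q' j" for j
  proof (rule shift_eqI[OF d shift_less[OF d]])
    fix k assume "k < m"
    hence "int d dvd (digits d m (shift d m q' j) k - (digits d m j k + q' k)) - (q k - q' k)"
      by (intro dvd_diff digits_shift[OF d] q)
    thus "int d dvd digits d m (shift d m q' j) k - (digits d m j k + q k)" by (simp add: algebra_simps)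
  qed
  moreover have "chdot d m p y = chdot d m p' y" for y by (rule chdot_cong[OF d assms(2)])
  ultimately show ?thesis unfolding clock_shift_def by presburger
qed

section \<open>Characteristic functions\<close>

lemma charfun_clock_shift:
  assumes "0 < d" "\<rho> \<in> carrier_mat (d ^ m) (d ^ m)"
  shows "charfun d m \<rho> p q = weyl_phase d m (\<lambda>k. - p k) (\<lambda>k. - q k) *
    mtrace (\<rho> * clock_shift d m (\<lambda>k. - p k) (\<lambda>k. - q k))"
  using assms
  by (simp add: charfun_def weyl_eq_clock_shift mult_smult_distrib[of _ "d ^ m" "d ^ m" _ "d ^ m"] mtrace_smult[of _ "d ^ m"])

text \<open>Commuting the two Weyl operators leaves a symplectic character as factor. A random Weyl
  conjugation therefore multiplies the characteristic function by the Fourier transform of its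
  law.\<close>

lemma charfun_conj_weyl:
  assumes d: "0 < d" and \<rho>: "\<rho> \<in> carrier_mat (d ^ m) (d ^ m)"
  shows "charfun d m (weyl d m a b * \<rho> * adj (weyl d m a b)) p q =
    chdot d m a q * chdot d m (\<lambda>k. - p k) b * charfun d m \<rho> p q"
proof -
  let ?N = "d ^ m"
  define W where "W = weyl d m a b"
  define w where "w = weyl d m (\<lambda>k. - p k) (\<lambda>k. - q k)"
  define z where "z = chdot d m a q * chdot d m (\<lambda>k. - p k) b"
  have c: "W \<in> carrier_mat ?N ?N" "w \<in> carrier_mat ?N ?N" "adj W \<in> carrier_mat ?N ?N" by (auto simp: W_def w_def)
  have U: "unitary ?N W" unfolding W_def by (rule unitary_weyl[OF d])
  have "w * W = z \<cdot>\<^sub>m (W * w)"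
    unfolding w_def W_def weyl_eq_clock_shift[OF d] z_def
    using clock_shift_commute[OF d, of m "\<lambda>k. - p k" "\<lambda>k. - q k" a b]
    by (simp add: mult_smult_distrib[of _ ?N ?N _ ?N] mult_smult_assoc_mat[of _ ?N ?N _ ?N] smult_smult_mat mult_ac)
  hence "adj W * (w * W) = z \<cdot>\<^sub>m w"
    using c unitary_cancel(2)[OF U c(2)] by (simp add: mult_smult_distrib[of _ ?N ?N _ ?N])
  hence "\<rho> * (adj W * (w * W)) = z \<cdot>\<^sub>m (\<rho> * w)"
    using c \<rho> by (simp add: mult_smult_distrib[of _ ?N ?N _ ?N])
  moreover have "mtrace (W * \<rho> * adj W * w) = mtrace (\<rho> * (adj W * (w * W)))"
    using mtrace_mult_comm[of W ?N "\<rho> * adj W * w"] c \<rho> by (simp add: assoc_mult_mat[of _ ?N ?N _ ?N _ ?N])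
  ultimately have "mtrace (W * \<rho> * adj W * w) = mtrace (z \<cdot>\<^sub>m (\<rho> * w))" by (simp only:)
  also have "\<dots> = z * mtrace (\<rho> * w)" using c \<rho> by (intro mtrace_smult[of _ ?N]) simp
  finally show ?thesis by (simp only: charfun_def W_def w_def z_def)
qed

text \<open>If \<open>|Tr (\<rho> W)| = 1\<close> for a unitary \<open>W\<close>, then \<open>W\<close> acts as a scalar on the support of \<open>\<rho>\<close>,
  because \<open>Tr ((W - c)\<^sup>* \<rho> (W - c)) = 1 - |c|\<^sup>2\<close> for \<open>c = Tr (\<rho> W)\<close>.\<close>

lemma density_mult_unitary_scalar:
  assumes \<rho>: "density N \<rho>" and W: "unitary N W" and tr: "cmod (mtrace (\<rho> * W)) = 1"
  shows "\<rho> * W = mtrace (\<rho> * W) \<cdot>\<^sub>m \<rho>"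
proof -
  define c where "c = mtrace (\<rho> * W)"
  have p: "psd N \<rho>" and t: "mtrace \<rho> = 1" using \<rho> by (auto simp: density_def)
  have h: "hermitian N \<rho>" using p by (rule psd_hermitian)
  have \<rho>c: "\<rho> \<in> carrier_mat N N" and Wc: "W \<in> carrier_mat N N"
    using p W by (auto simp: psd_carrier unitary_carrier)
  \<comment> \<open>Column \<open>j\<close> of \<open>W - c\<close>. The forms of
    \<open>\<rho>\<close> at these columns add up to the trace that is to vanish.\<close>
  define v where "v j i = W $$ (i, j) - (if i = j then c else 0)" for j i
  have cc: "cnj c * c = 1" using tr by (metis c_def complex_norm_square mult.commute of_real_1 one_power2)
  have c_sum: "c = (\<Sum>j<N. \<Sum>i<N. \<rho> $$ (j, i) * W $$ (i, j))"
    unfolding c_def mtrace_sum[OF mult_carrier_square[OF \<rho>c Wc]]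
    by (intro sum.cong refl) (auto simp: mult_mat_index[OF \<rho>c Wc])
  have "(\<Sum>j<N. sform N \<rho> (v j) (v j)) = 0"
  proof -
    \<comment> \<open>Expanding the form at \<open>W - c\<close> gives four sums, each equal to one;
      with their signs they cancel.\<close>
    have 1: "(\<Sum>j<N. sform N \<rho> (\<lambda>i. W $$ (i, j)) (\<lambda>i. W $$ (i, j))) = 1"
    proof -
      have "(\<Sum>j<N. sform N \<rho> (\<lambda>i. W $$ (i, j)) (\<lambda>i. W $$ (i, j)))
        = (\<Sum>j<N. \<Sum>i<N. \<Sum>l<N. \<rho> $$ (i, l) * (W $$ (l, j) * cnj (W $$ (i, j))))"
        unfolding sform_def by (intro sum.cong refl) (simp add: mult_ac)
      also have "\<dots> = (\<Sum>i<N. \<Sum>j<N. \<Sum>l<N. \<rho> $$ (i, l) * (W $$ (l, j) * cnj (W $$ (i, j))))"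
        by (rule sum.swap)
      also have "\<dots> = (\<Sum>i<N. \<Sum>l<N. \<Sum>j<N. \<rho> $$ (i, l) * (W $$ (l, j) * cnj (W $$ (i, j))))"
        by (rule sum.cong[OF refl], rule sum.swap)
      also have "\<dots> = (\<Sum>i<N. \<Sum>l<N. if l = i then \<rho> $$ (i, i) else 0)"
        by (intro sum.cong refl) (simp add: sum_distrib_left[symmetric] unitary_rows[OF W])
      also have "\<dots> = mtrace \<rho>" unfolding mtrace_sum[OF \<rho>c] by (intro sum.cong refl) simp
      finally show ?thesis using t by simp
    qed
    have e: "sform N \<rho> (\<lambda>i. if i = j then c else 0) w = cnj c * (\<Sum>l<N. \<rho> $$ (j, l) * w l)" if "j < N" for j w
    proof -
      have "sform N \<rho> (\<lambda>i. if i = j then c else 0) w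
        = (\<Sum>i<N. if i = j then cnj c * (\<Sum>l<N. \<rho> $$ (j, l) * w l) else 0)"
        unfolding sform_def by (intro sum.cong[OF refl]) (auto simp: sum_distrib_left mult_ac)
      thus ?thesis using that by simp
    qed
    have 2: "(\<Sum>j<N. sform N \<rho> (\<lambda>i. if i = j then c else 0) (\<lambda>i. W $$ (i, j))) = 1"
    proof -
      have "(\<Sum>j<N. sform N \<rho> (\<lambda>i. if i = j then c else 0) (\<lambda>i. W $$ (i, j))) = cnj c * c"
        by (subst (2) c_sum) (simp add: e sum_distrib_left)
      thus ?thesis by (simp add: cc)
    qed
    have 3: "(\<Sum>j<N. sform N \<rho> (\<lambda>i. W $$ (i, j)) (\<lambda>i. if i = j then c else 0)) = 1"
    proof -
      have "(\<Sum>j<N. sform N \<rho> (\<lambda>i. W $$ (i, j)) (\<lambda>i. if i = j then c else 0)) = cnj 1"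
        unfolding 2[symmetric] cnj_sum by (simp only: cnj_sform[OF h])
      thus ?thesis by simp
    qed
    have 4: "(\<Sum>j<N. sform N \<rho> (\<lambda>i. if i = j then c else 0) (\<lambda>i. if i = j then c else 0)) = 1"
    proof -
      have "(\<Sum>j<N. sform N \<rho> (\<lambda>i. if i = j then c else 0) (\<lambda>i. if i = j then c else 0))
        = (\<Sum>j<N. (cnj c * c) * \<rho> $$ (j, j))"
      proof (rule sum.cong[OF refl])
        fix j assume "j \<in> {..<N}"
        hence j: "j < N" by simp
        have "(\<Sum>l<N. \<rho> $$ (j, l) * (if l = j then c else 0)) = (\<Sum>l<N. if l = j then \<rho> $$ (j, j) * c else 0)"
          by (intro sum.cong refl) auto
        thus "sform N \<rho> (\<lambda>i. if i = j then c else 0) (\<lambda>i. if i = j then c else 0) = (cnj c * c) * \<rho> $$ (j, j)"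
          using j by (simp add: e[OF j])
      qed
      thus ?thesis using t by (simp add: cc mtrace_sum[OF \<rho>c])
    qed
    show ?thesis
      unfolding v_def sform_diff_diff by (simp add: sum.distrib sum_subtractf 1 2 3 4)
  qed
  hence "(\<Sum>j<N. Re (sform N \<rho> (v j) (v j))) = 0" by (simp flip: Re_sum)
  hence z: "Re (sform N \<rho> (v j) (v j)) = 0" if "j < N" for j
    using that psd_sform_nonneg[OF p] by (subst (asm) sum_nonneg_eq_0_iff) auto
  show ?thesis unfolding c_def[symmetric]
  proof (rule eq_matI)
    fix i j assume "i < dim_row (c \<cdot>\<^sub>m \<rho>)" "j < dim_col (c \<cdot>\<^sub>m \<rho>)"
    hence ij: "i < N" "j < N" using \<rho>c by auto
    have "0 = (\<Sum>l<N. \<rho> $$ (i, l) * v j l)" using psd_kernel[OF p z[OF ij(2)] ij(1)] by simp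
    also have "\<dots> = (\<Sum>l<N. \<rho> $$ (i, l) * W $$ (l, j) - (if l = j then \<rho> $$ (i, j) * c else 0))"
      by (intro sum.cong refl) (auto simp: v_def algebra_simps)
    also have "\<dots> = (\<rho> * W) $$ (i, j) - c * \<rho> $$ (i, j)"
      using ij by (simp add: sum_subtractf mult_mat_index[OF \<rho>c Wc] mult.commute)
    finally show "(\<rho> * W) $$ (i, j) = (c \<cdot>\<^sub>m \<rho>) $$ (i, j)" using ij \<rho>c by simp
  qed (use \<rho>c Wc in auto)
qed

text \<open>\<open>\<rho>\<close> absorbs the first operator as a unimodular scalar, so the trace
  against the product of both factors into the two given traces. The product is again of clock-shift
  form up to a phase.\<close>

lemma charfun_modulus_one_add:
  assumes d: "0 < d" and \<rho>: "density (d ^ m) \<rho>"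
    and 1: "cmod (charfun d m \<rho> p q) = 1" and 2: "cmod (charfun d m \<rho> p' q') = 1"
  shows "cmod (charfun d m \<rho> (\<lambda>k. p k + p' k) (\<lambda>k. q k + q' k)) = 1"
proof -
  let ?N = "d ^ m"
  let ?W = "clock_shift d m (\<lambda>k. - p k) (\<lambda>k. - q k)" and ?W' = "clock_shift d m (\<lambda>k. - p' k) (\<lambda>k. - q' k)"
  let ?V = "clock_shift d m (\<lambda>k. - (p k + p' k)) (\<lambda>k. - (q k + q' k))"
  have \<rho>c: "\<rho> \<in> carrier_mat ?N ?N" using \<rho> by (auto simp: density_def psd_carrier)
  have c1: "cmod (mtrace (\<rho> * ?W)) = 1" "cmod (mtrace (\<rho> * ?W')) = 1"
    using 1 2 by (auto simp: charfun_clock_shift[OF d \<rho>c] norm_mult)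
  have "\<rho> * (?W * ?W') = \<rho> * ?W * ?W'" using \<rho>c by (simp add: assoc_mult_mat[of _ ?N ?N _ ?N _ ?N])
  also have "\<rho> * ?W = mtrace (\<rho> * ?W) \<cdot>\<^sub>m \<rho>"
    by (rule density_mult_unitary_scalar[OF \<rho> unitary_clock_shift[OF d] c1(1)])
  finally have "\<rho> * (?W * ?W') = mtrace (\<rho> * ?W) \<cdot>\<^sub>m (\<rho> * ?W')"
    using \<rho>c by (simp add: mult_smult_assoc_mat[of _ ?N ?N _ ?N])
  hence "cmod (mtrace (\<rho> * (?W * ?W'))) = 1"
    using c1 \<rho>c by (simp add: mtrace_smult[of _ ?N] norm_mult)
  moreover have "\<rho> * (?W * ?W') = chdot d m (\<lambda>k. - p' k) (\<lambda>k. - (- q k)) \<cdot>\<^sub>m (\<rho> * ?V)"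
    using \<rho>c by (simp add: clock_shift_mult[OF d] mult_smult_distrib[of _ ?N ?N _ ?N] add.commute)
  ultimately have "cmod (mtrace (\<rho> * ?V)) = 1"
    using \<rho>c by (simp add: mtrace_smult[of _ ?N] norm_mult)
  thus ?thesis by (simp add: charfun_clock_shift[OF d \<rho>c] norm_mult)
qed

lemma cmod_charfun_cong:
  assumes d: "0 < d" and \<rho>: "\<rho> \<in> carrier_mat (d ^ m) (d ^ m)"
    and p: "\<And>k. k < m \<Longrightarrow> int d dvd p k - p' k" and q: "\<And>k. k < m \<Longrightarrow> int d dvd q k - q' k"
  shows "cmod (charfun d m \<rho> p q) = cmod (charfun d m \<rho> p' q')"
proof -
  have "clock_shift d m (\<lambda>k. - p k) (\<lambda>k. - q k) = clock_shift d m (\<lambda>k. - p' k) (\<lambda>k. - q' k)"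
    using p q by (intro clock_shift_cong[OF d]) (auto simp: dvd_diff_commute)
  thus ?thesis by (simp add: charfun_clock_shift[OF d \<rho>] norm_mult)
qed

lemma cmod_charfun_reduce:
  assumes "0 < d" "\<rho> \<in> carrier_mat (d ^ m) (d ^ m)"
  shows "cmod (charfun d m \<rho> (reduce d m p) (reduce d m q)) = cmod (charfun d m \<rho> p q)"
  by (rule cmod_charfun_cong[OF assms reduce_dvd reduce_dvd])

lemma charfun_zero:
  assumes d: "0 < d" and \<rho>: "\<rho> \<in> carrier_mat (d ^ m) (d ^ m)"
  shows "charfun d m \<rho> (\<lambda>_. 0) (\<lambda>_. 0) = mtrace \<rho>"
proof -
  have "shift d m (\<lambda>_. 0) j = j" if "j < d ^ m" for j using that by (intro shift_eqI[OF d]) auto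
  hence "clock_shift d m (\<lambda>_. 0) (\<lambda>_. 0) = 1\<^sub>m (d ^ m)"
    by (intro eq_matI) (auto simp: clock_shift_def chdot_def)
  thus ?thesis using \<rho> by (simp add: charfun_clock_shift[OF d \<rho>] weyl_phase_def)
qed

text \<open>Fourier inversion, which makes the description of the mean state unique. The
  displacement \<open>q\<close> from \<open>i0\<close> to \<open>j0\<close> selects one cyclic
  diagonal of the matrix, and summing over \<open>p\<close> against the character at
  \<open>j0\<close> isolates the entry \<open>(i0, j0)\<close>.\<close>

lemma charfun_inject:
  assumes d: "0 < d" and \<sigma>: "\<sigma> \<in> carrier_mat (d ^ m) (d ^ m)" and \<sigma>': "\<sigma>' \<in> carrier_mat (d ^ m) (d ^ m)"
    and eq: "\<And>p q. charfun d m \<sigma> p q = charfun d m \<sigma>' p q"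
  shows "\<sigma> = \<sigma>'"
proof (rule eq_matI)
  let ?N = "d ^ m"
  fix i0 j0 assume "i0 < dim_row \<sigma>'" "j0 < dim_col \<sigma>'"
  hence ij: "i0 < ?N" "j0 < ?N" using \<sigma>' by auto
  define q where "q k = digits d m j0 k - digits d m i0 k" for k
  define f where "f \<tau> i = \<tau> $$ (i, shift d m q i)" for \<tau> :: "complex mat" and i
  have sh: "shift d m q i = j0 \<longleftrightarrow> i = i0" if "i < ?N" for i
  proof -
    have "shift d m q i0 = j0" using ij by (intro shift_eqI[OF d]) (auto simp: q_def)
    thus ?thesis using shift_inj[OF d that ij(1), of q] by auto
  qed
  have tr: "mtrace (\<tau> * clock_shift d m p q) = (\<Sum>i<?N. f \<tau> i * chdot d m p (digits d m (shift d m q i)))"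
    if \<tau>: "\<tau> \<in> carrier_mat ?N ?N" for \<tau> p
    unfolding mtrace_sum[OF mult_carrier_square[OF \<tau> clock_shift_carrier]]
  proof (rule sum.cong[OF refl])
    fix i assume "i \<in> {..<?N}"
    hence i: "i < ?N" by simp
    have "(\<tau> * clock_shift d m p q) $$ (i, i) =
      (\<Sum>l<?N. if l = shift d m q i then f \<tau> i * chdot d m p (digits d m (shift d m q i)) else 0)"
      unfolding mult_mat_index[OF \<tau> clock_shift_carrier i i]
      by (intro sum.cong refl) (use i in \<open>auto simp: clock_shift_index f_def\<close>)
    thus "(\<tau> * clock_shift d m p q) $$ (i, i) = f \<tau> i * chdot d m p (digits d m (shift d m q i))"
      using shift_less[OF d] by simp
  qed
  have inv: "(\<Sum>p\<in>residue_vectors d m. mtrace (\<tau> * clock_shift d m p q) * chdot d m p (\<lambda>k. - digits d m j0 k))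
      = of_nat ?N * \<tau> $$ (i0, j0)" if \<tau>: "\<tau> \<in> carrier_mat ?N ?N" for \<tau>
  proof -
    have "(\<Sum>p\<in>residue_vectors d m. mtrace (\<tau> * clock_shift d m p q) * chdot d m p (\<lambda>k. - digits d m j0 k))
      = (\<Sum>p\<in>residue_vectors d m. \<Sum>i<?N. f \<tau> i * chdot d m p (\<lambda>k. digits d m (shift d m q i) k + - digits d m j0 k))"
      by (simp only: tr[OF \<tau>] chdot_add_right sum_distrib_right mult.assoc)
    also have "\<dots> = (\<Sum>i<?N. f \<tau> i * (\<Sum>p\<in>residue_vectors d m.
        chdot d m p (\<lambda>k. digits d m (shift d m q i) k + - digits d m j0 k)))"
      by (subst sum.swap) (simp add: sum_distrib_left)
    also have "\<dots> = (\<Sum>i<?N. if i = i0 then \<tau> $$ (i0, j0) * of_nat ?N else 0)"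
    proof (rule sum.cong[OF refl])
      fix i assume "i \<in> {..<?N}"
      hence i: "i < ?N" by simp
      have "(\<forall>k<m. int d dvd digits d m (shift d m q i) k + - digits d m j0 k) \<longleftrightarrow> i = i0"
        using digits_inject[OF d shift_less[OF d] ij(2), of q i] sh[OF i] by auto
      thus "f \<tau> i * (\<Sum>p\<in>residue_vectors d m. chdot d m p (\<lambda>k. digits d m (shift d m q i) k + - digits d m j0 k))
        = (if i = i0 then \<tau> $$ (i0, j0) * of_nat ?N else 0)"
        using sh[OF ij(1)] by (simp add: chdot_orthogonality[OF d] f_def)
    qed
    also have "\<dots> = of_nat ?N * \<tau> $$ (i0, j0)" using ij by simp
    finally show ?thesis .
  qed
  have "mtrace (\<sigma> * clock_shift d m p q) = mtrace (\<sigma>' * clock_shift d m p q)" for p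
  proof -
    have "weyl_phase d m p q \<noteq> 0" by (metis cmod_weyl_phase norm_zero zero_neq_one)
    thus ?thesis
      using eq[of "\<lambda>k. - p k" "\<lambda>k. - q k"]
      by (simp add: charfun_clock_shift[OF d \<sigma>] charfun_clock_shift[OF d \<sigma>'])
  qed
  hence "of_nat ?N * \<sigma> $$ (i0, j0) = of_nat ?N * \<sigma>' $$ (i0, j0)"
    unfolding inv[OF \<sigma>, symmetric] inv[OF \<sigma>', symmetric] by (simp only:)
  thus "\<sigma> $$ (i0, j0) = \<sigma>' $$ (i0, j0)" using d by simp
qed (use \<sigma> \<sigma>' in auto)

text \<open>The phase space points where \<open>|\<Xi>| = 1\<close> form a group, so the Fourier transform of their
  indicator function is non-negative; it is the law of the random Weyl conjugation.\<close>

theorem mean_state_weyl_mixture: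
  assumes d: "0 < d" and \<rho>: "density (d ^ m) \<rho>"
  shows "\<exists>\<mu>. (\<forall>y. 0 \<le> \<mu> y) \<and> sum \<mu> (residue_vectors d m \<times> residue_vectors d m) = 1 \<and>
    mean_state d m \<rho> = mixture (d ^ m) (residue_vectors d m \<times> residue_vectors d m) \<mu>
      (\<lambda>(a, b). weyl d m a b * \<rho> * adj (weyl d m a b))"
proof -
  let ?N = "d ^ m"
  define R where "R = residue_vectors d m"
  have \<rho>c: "\<rho> \<in> carrier_mat ?N ?N" and t: "mtrace \<rho> = 1" using \<rho> by (auto simp: density_def psd_carrier)
  define good where "good p q \<longleftrightarrow> cmod (charfun d m \<rho> p q) = 1" for p q
  define G where "G = {x \<in> R \<times> R. good (fst x) (snd x)}"
  define h where "h y x = chdot d m (fst x) (snd y) * chdot d m (\<lambda>k. - snd x k) (fst y)" for x y :: "(nat \<Rightarrow> int) \<times> (nat \<Rightarrow> int)"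
  \<comment> \<open>The character \<open>h y\<close> summed over the subgroup \<open>G\<close>: the
    size of \<open>G\<close> if \<open>h y\<close> is trivial on it and zero otherwise, so real and
    nonnegative in either case.\<close>
  define S where "S y = sum (h y) G" for y
  have G: "finite G" "G \<subseteq> R \<times> R" by (auto simp: G_def R_def)
  have S: "S y = of_real (Re (S y)) \<and> 0 \<le> Re (S y)" for y
  proof (cases "\<forall>x\<in>G. h y x = 1")
    case True
    thus ?thesis by (simp add: S_def)
  next
    case False
    then obtain x0 where x0: "x0 \<in> G" "h y x0 \<noteq> 1" by blast
    \<comment> \<open>Translation by \<open>x0\<close>, followed by reduction to representatives;
      that it maps \<open>G\<close> into itself is the group property.\<close>
    define f where "f x = (reduce d m (\<lambda>k. fst x k + fst x0 k), reduce d m (\<lambda>k. snd x k + snd x0 k))"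
      for x :: "(nat \<Rightarrow> int) \<times> (nat \<Rightarrow> int)"
    have "S y = h y x0 * S y"
      unfolding S_def
    proof (rule sum_scaled_by_permutation[OF G(1)])
      show "inj_on f G"
      proof (rule inj_onI)
        fix x z assume "x \<in> G" "z \<in> G" and eq: "f x = f z"
        hence R: "fst x \<in> residue_vectors d m" "snd x \<in> residue_vectors d m"
          "fst z \<in> residue_vectors d m" "snd z \<in> residue_vectors d m"
          using G(2) by (auto simp: R_def)
        have "fst x = fst z" using eq by (intro inj_onD[OF inj_on_translate[of _ _ "fst x0"] _ R(1,3)]) (simp add: f_def)
        moreover have "snd x = snd z" using eq by (intro inj_onD[OF inj_on_translate[of _ _ "snd x0"] _ R(2,4)]) (simp add: f_def)
        ultimately show "x = z" by (rule prod_eqI)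
      qed
      show "f ` G \<subseteq> G"
      proof
        fix z assume "z \<in> f ` G"
        then obtain x where x: "x \<in> G" "z = f x" by blast
        have "good (\<lambda>k. fst x k + fst x0 k) (\<lambda>k. snd x k + snd x0 k)"
          using x(1) x0(1) unfolding good_def G_def by (intro charfun_modulus_one_add[OF d \<rho>]) auto
        hence "good (fst z) (snd z)"
          unfolding good_def x(2) f_def
          by (simp add: cmod_charfun_reduce[OF d \<rho>c])
        thus "z \<in> G" using reduce_in[OF d] by (auto simp: G_def x(2) f_def R_def)
      qed
      fix x :: "(nat \<Rightarrow> int) \<times> (nat \<Rightarrow> int)"
      have "chdot d m (reduce d m (\<lambda>k. fst x k + fst x0 k)) (snd y) = chdot d m (\<lambda>k. fst x k + fst x0 k) (snd y)"
        by (rule chdot_cong[OF d reduce_dvd])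
      moreover have "chdot d m (reduce d m (\<lambda>k. snd x k + snd x0 k)) (\<lambda>k. - fst y k)
        = chdot d m (\<lambda>k. snd x k + snd x0 k) (\<lambda>k. - fst y k)"
        by (rule chdot_cong[OF d reduce_dvd])
      ultimately show "h y (f x) = h y x0 * h y x"
        by (simp add: h_def f_def chdot_minus chdot_add_left mult_ac)
    qed
    hence "S y = 0" using x0(2) by auto
    thus ?thesis by simp
  qed
  \<comment> \<open>Phase space has \<open>?N * ?N\<close> points, which is the normalisation of the
    Fourier transform.\<close>
  define \<mu> where "\<mu> y = Re (S y) / real (?N * ?N)" for y
  have \<mu>: "of_real (\<mu> y) = S y / of_nat (?N * ?N)" for y
    using S[of y] by (simp add: \<mu>_def)
  \<comment> \<open>The inverse transform: orthogonality in both variables leaves only the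
    representative of \<open>(p, q)\<close>, which contributes if it belongs to
    \<open>G\<close>.\<close>
  have fourier: "(\<Sum>(a, b)\<in>R \<times> R. of_real (\<mu> (a, b)) * (chdot d m a q * chdot d m (\<lambda>k. - p k) b))
      = (if good p q then 1 else 0)" for p q
  proof -
    let ?r = "(reduce d m p, reduce d m q)"
    have "of_nat (?N * ?N) * (\<Sum>(a, b)\<in>R \<times> R. of_real (\<mu> (a, b)) * (chdot d m a q * chdot d m (\<lambda>k. - p k) b))
      = (\<Sum>(a, b)\<in>R \<times> R. S (a, b) * (chdot d m a q * chdot d m (\<lambda>k. - p k) b))"
      unfolding sum_distrib_left \<mu> using d by (intro sum.cong refl) auto
    also have "\<dots> = (\<Sum>(a, b)\<in>R \<times> R. \<Sum>x\<in>G. chdot d m a (\<lambda>k. q k + - snd x k) * chdot d m b (\<lambda>k. fst x k + - p k))"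
    proof (intro sum.cong refl, clarify)
      fix a b
      have "h (a, b) x * (chdot d m a q * chdot d m (\<lambda>k. - p k) b)
        = chdot d m a (\<lambda>k. q k + - snd x k) * chdot d m b (\<lambda>k. fst x k + - p k)" for x
        unfolding chdot_add_right h_def fst_conv snd_conv
        by (simp add: chdot_commute[of d m b] chdot_commute[of d m _ a] mult_ac)
      thus "S (a, b) * (chdot d m a q * chdot d m (\<lambda>k. - p k) b)
        = (\<Sum>x\<in>G. chdot d m a (\<lambda>k. q k + - snd x k) * chdot d m b (\<lambda>k. fst x k + - p k))"
        unfolding S_def sum_distrib_right by simp
    qed
    also have "\<dots> = (\<Sum>x\<in>G. \<Sum>(a, b)\<in>R \<times> R. chdot d m a (\<lambda>k. q k + - snd x k) * chdot d m b (\<lambda>k. fst x k + - p k))"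
      unfolding case_prod_unfold by (rule sum.swap)
    also have "\<dots> = (\<Sum>x\<in>G. (\<Sum>a\<in>R. chdot d m a (\<lambda>k. q k + - snd x k)) * (\<Sum>b\<in>R. chdot d m b (\<lambda>k. fst x k + - p k)))"
      by (simp only: sum_product sum.cartesian_product)
    also have "\<dots> = (\<Sum>x\<in>G. if x = ?r then of_nat (?N * ?N) else 0)"
    proof (rule sum.cong[OF refl])
      fix x assume x: "x \<in> G"
      hence xR: "fst x \<in> residue_vectors d m" "snd x \<in> residue_vectors d m" using G(2) by (auto simp: R_def)
      have *: "(\<forall>k<m. int d dvd z k - u k) \<longleftrightarrow> z = reduce d m u" if z: "z \<in> residue_vectors d m" for z u
      proof
        assume A: "\<forall>k<m. int d dvd z k - u k"
        have "int d dvd (z k - u k) - (reduce d m u k - u k)" if "k < m" for k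
          by (rule dvd_diff[OF _ reduce_dvd[OF that]]) (use A that in auto)
        thus "z = reduce d m u" by (intro residue_vectors_eqI[OF z reduce_in[OF d]]) simp
      qed (use reduce_dvd in auto)
      have "(\<forall>k<m. int d dvd q k + - snd x k) \<longleftrightarrow> snd x = reduce d m q"
        using *[OF xR(2), of q] by (simp add: dvd_diff_commute)
      moreover have "(\<forall>k<m. int d dvd fst x k + - p k) \<longleftrightarrow> fst x = reduce d m p"
        using *[OF xR(1), of p] by simp
      ultimately show "(\<Sum>a\<in>R. chdot d m a (\<lambda>k. q k + - snd x k)) * (\<Sum>b\<in>R. chdot d m b (\<lambda>k. fst x k + - p k))
        = (if x = ?r then of_nat (?N * ?N) else 0)"
        unfolding R_def chdot_orthogonality[OF d] by (cases x) auto
    qed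
    also have "\<dots> = of_nat (?N * ?N) * (if good p q then 1 else 0)"
    proof -
      have "?r \<in> G \<longleftrightarrow> good p q"
        using reduce_in[OF d] by (simp add: G_def R_def good_def cmod_charfun_reduce[OF d \<rho>c])
      thus ?thesis using G(1) by simp
    qed
    finally show ?thesis using d by simp
  qed
  have sum1: "sum \<mu> (R \<times> R) = 1"
  proof -
    \<comment> \<open>The total mass is the transform at the origin, where the characteristic
      function equals the trace.\<close>
    have "good (\<lambda>_. 0) (\<lambda>_. 0)" by (simp add: good_def charfun_zero[OF d \<rho>c] t)
    hence "complex_of_real (sum \<mu> (R \<times> R)) = of_real 1"
      using fourier[of "\<lambda>_. 0" "\<lambda>_. 0"] by (simp add: chdot_def case_prod_unfold)
    thus ?thesis unfolding of_real_eq_iff .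
  qed
  define M where "M = mixture ?N (R \<times> R) \<mu> (\<lambda>(a, b). weyl d m a b * \<rho> * adj (weyl d m a b))"
  have char: "charfun d m M p q = (if good p q then charfun d m \<rho> p q else 0)" for p q
  proof -
    let ?w = "weyl d m (\<lambda>k. - p k) (\<lambda>k. - q k)"
    have Wc: "(case y of (a, b) \<Rightarrow> weyl d m a b * \<rho> * adj (weyl d m a b)) \<in> carrier_mat ?N ?N" for y
      using \<rho>c by (auto split: prod.split)
    have "charfun d m M p q = (\<Sum>y\<in>R \<times> R. of_real (\<mu> y) * charfun d m (case y of (a, b) \<Rightarrow> weyl d m a b * \<rho> * adj (weyl d m a b)) p q)"
      unfolding charfun_def M_def by (simp add: mixture_mult[OF Wc weyl_carrier] mtrace_mixture Wc)
    also have "\<dots> = (\<Sum>(a, b)\<in>R \<times> R. of_real (\<mu> (a, b)) * (chdot d m a q * chdot d m (\<lambda>k. - p k) b)) * charfun d m \<rho> p q"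
      unfolding sum_distrib_right
      by (intro sum.cong refl) (auto simp: charfun_conj_weyl[OF d \<rho>c])
    finally show ?thesis unfolding fourier by simp
  qed
  have "mean_state d m \<rho> = M"
    unfolding mean_state_def
  proof (rule the_equality)
    show "M \<in> carrier_mat ?N ?N \<and> (\<forall>p q. charfun d m M p q = (if cmod (charfun d m \<rho> p q) = 1 then charfun d m \<rho> p q else 0))"
      using char by (auto simp: good_def M_def)
    fix \<sigma> assume "\<sigma> \<in> carrier_mat ?N ?N \<and> (\<forall>p q. charfun d m \<sigma> p q = (if cmod (charfun d m \<rho> p q) = 1 then charfun d m \<rho> p q else 0))"
    thus "\<sigma> = M" using char by (intro charfun_inject[OF d]) (auto simp: good_def M_def)
  qed
  thus ?thesis using sum1 S unfolding M_def R_def by (intro exI[of _ \<mu>]) (auto simp: \<mu>_def)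
qed

section \<open>Choi states and mean channels\<close>

definition mat_unit :: "nat \<Rightarrow> nat \<Rightarrow> nat \<Rightarrow> complex mat" where
  "mat_unit N a b = mat N N (\<lambda>(i, j). if i = a \<and> j = b then 1 else 0)"

lemma mat_unit_carrier [simp]: "mat_unit N a b \<in> carrier_mat N N"
  by (simp add: mat_unit_def)

lemma channel_add:
  "is_channel N \<Lambda> \<Longrightarrow> X \<in> carrier_mat N N \<Longrightarrow> Y \<in> carrier_mat N N \<Longrightarrow> \<Lambda> (X + Y) = \<Lambda> X + \<Lambda> Y"
  by (simp add: is_channel_def)

lemma channel_smult: "is_channel N \<Lambda> \<Longrightarrow> X \<in> carrier_mat N N \<Longrightarrow> \<Lambda> (c \<cdot>\<^sub>m X) = c \<cdot>\<^sub>m \<Lambda> X"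
  by (simp add: is_channel_def)

lemma channel_expand:
  assumes L: "is_channel N \<Lambda>" and X: "X \<in> carrier_mat N N" and ij: "i < N" "j < N"
  shows "\<Lambda> X $$ (i, j) = (\<Sum>a<N. \<Sum>b<N. X $$ (a, b) * \<Lambda> (mat_unit N a b) $$ (i, j))"
proof -
  \<comment> \<open>\<open>P S\<close> keeps the entries of \<open>X\<close> at positions in
    \<open>S\<close>, so additivity is applied one entry at a time. The empty case writes the zero
    matrix as \<open>0\<close> times itself to use homogeneity.\<close>
  define P where "P S = mat N N (\<lambda>x. if x \<in> S then X $$ x else 0)" for S
  have P: "P S \<in> carrier_mat N N" for S by (simp add: P_def)
  have Lc: "\<Lambda> Y \<in> carrier_mat N N" if "Y \<in> carrier_mat N N" for Y using channel_carrier[OF L that] .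
  have "\<Lambda> (P S) $$ (i, j) = (\<Sum>(a, b)\<in>S. X $$ (a, b) * \<Lambda> (mat_unit N a b) $$ (i, j))"
    if "finite S" for S
    using that
  proof induction
    case empty
    have "P {} = 0 \<cdot>\<^sub>m P {}" by (rule eq_matI) (auto simp: P_def)
    hence "\<Lambda> (P {}) = 0 \<cdot>\<^sub>m \<Lambda> (P {})" using channel_smult[OF L P] by metis
    hence "\<Lambda> (P {}) $$ (i, j) = (0 \<cdot>\<^sub>m \<Lambda> (P {})) $$ (i, j)" by simp
    also have "\<dots> = 0" using Lc[OF P[of "{}"]] ij by simp
    finally show ?case by simp
  next
    case (insert x S)
    obtain a b where x: "x = (a, b)" by (cases x)
    have "P (insert x S) = X $$ (a, b) \<cdot>\<^sub>m mat_unit N a b + P S"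
      by (rule eq_matI) (use insert(2) in \<open>auto simp: P_def mat_unit_def x\<close>)
    hence "\<Lambda> (P (insert x S)) = X $$ (a, b) \<cdot>\<^sub>m \<Lambda> (mat_unit N a b) + \<Lambda> (P S)"
      by (simp add: channel_add[OF L _ P] channel_smult[OF L])
    hence "\<Lambda> (P (insert x S)) $$ (i, j) = X $$ (a, b) * \<Lambda> (mat_unit N a b) $$ (i, j) + \<Lambda> (P S) $$ (i, j)"
      using Lc[OF P[of S]] Lc[OF mat_unit_carrier[of N a b]] ij by simp
    thus ?case using insert by (simp add: x)
  qed
  from this[of "{..<N} \<times> {..<N}"]
  have "\<Lambda> (P ({..<N} \<times> {..<N})) $$ (i, j) = (\<Sum>a<N. \<Sum>b<N. X $$ (a, b) * \<Lambda> (mat_unit N a b) $$ (i, j))"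
    by (simp add: sum.cartesian_product)
  moreover have "P ({..<N} \<times> {..<N}) = X" using X by (intro eq_matI) (auto simp: P_def)
  ultimately show ?thesis by simp
qed

lemma choi_carrier [simp]: "choi N \<Lambda> \<in> carrier_mat (N * N) (N * N)"
  by (simp add: choi_def id_tensor_def)

lemma choi_index:
  assumes L: "is_channel N \<Lambda>" and ij: "i < N * N" "j < N * N"
  shows "choi N \<Lambda> $$ (i, j) = \<Lambda> (mat_unit N (i div N) (j div N)) $$ (i mod N, j mod N) / of_nat N"
proof -
  note b = div_mod_bounds[OF ij(1)] div_mod_bounds[OF ij(2)]
  have "mat N N (\<lambda>(a, b). max_ent N $$ ((i div N) * N + a, (j div N) * N + b))
    = (1 / of_nat N) \<cdot>\<^sub>m mat_unit N (i div N) (j div N)"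
    by (rule eq_matI) (use b in \<open>auto simp: max_ent_def mat_unit_def times_add_less\<close>)
  hence "choi N \<Lambda> $$ (i, j) = \<Lambda> ((1 / of_nat N) \<cdot>\<^sub>m mat_unit N (i div N) (j div N)) $$ (i mod N, j mod N)"
    using ij by (simp add: choi_def id_tensor_def)
  also have "\<dots> = (1 / of_nat N) * \<Lambda> (mat_unit N (i div N) (j div N)) $$ (i mod N, j mod N)"
    using channel_carrier[OF L mat_unit_carrier[of N "i div N" "j div N"]] b by (simp add: channel_smult[OF L])
  finally show ?thesis by simp
qed

text \<open>Up to the factor \<open>1 / N\<close> the blocks of the Choi state are the images of the
  matrix units, and by linearity these determine the map. This is the uniqueness behind
  \<open>mean_channel\<close>.\<close>

lemma choi_inject:
  assumes L: "is_channel N \<Lambda>" and L': "is_channel N \<Lambda>'" and eq: "choi N \<Lambda> = choi N \<Lambda>'"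
    and X: "X \<in> carrier_mat N N"
  shows "\<Lambda> X = \<Lambda>' X"
proof (rule eq_matI)
  fix i j assume "i < dim_row (\<Lambda>' X)" "j < dim_col (\<Lambda>' X)"
  hence ij: "i < N" "j < N" using channel_carrier[OF L' X] by auto
  have "\<Lambda> (mat_unit N a b) $$ (i, j) = \<Lambda>' (mat_unit N a b) $$ (i, j)" if ab: "a < N" "b < N" for a b
    using arg_cong[OF eq, of "\<lambda>J. J $$ (a * N + i, b * N + j)"] ij
      choi_index[OF L times_add_less[OF ab(1) ij(1)] times_add_less[OF ab(2) ij(2)]]
      choi_index[OF L' times_add_less[OF ab(1) ij(1)] times_add_less[OF ab(2) ij(2)]]
    by simp
  thus "\<Lambda> X $$ (i, j) = \<Lambda>' X $$ (i, j)"
    by (simp add: channel_expand[OF L X ij] channel_expand[OF L' X ij])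
qed (use channel_carrier[OF L X] channel_carrier[OF L' X] in auto)

text \<open>A rank-one form: its value is the squared modulus of the sum of the coordinates at
  doubled indices, divided by \<open>N\<close>.\<close>

lemma psd_max_ent:
  assumes "N > 0"
  shows "psd (N * N) (max_ent N)"
proof -
  have "0 \<le> Re (sform (N * N) (max_ent N) v v)" for v
  proof -
    define s where "s = (\<Sum>b<N. v (b * N + b))"
    have "sform (N * N) (max_ent N) v v = (\<Sum>a<N. \<Sum>r<N. \<Sum>b<N. \<Sum>t<N.
      if t = b then (if r = a then cnj (v (a * N + a)) * v (b * N + b) / of_nat N else 0) else 0)"
      unfolding sform_times by (intro sum.cong refl) (auto simp: max_ent_def times_add_less)
    also have "\<dots> = (\<Sum>a<N. \<Sum>r<N. \<Sum>b<N. if r = a then cnj (v (a * N + a)) * v (b * N + b) / of_nat N else 0)"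
      by (rule sum.cong[OF refl], rule sum.cong[OF refl], rule sum.cong[OF refl]) simp
    also have "\<dots> = (\<Sum>a<N. \<Sum>r<N. if r = a then cnj (v (a * N + a)) * s / of_nat N else 0)"
      by (rule sum.cong[OF refl], rule sum.cong[OF refl]) (auto simp: s_def sum_distrib_left sum_divide_distrib)
    also have "\<dots> = (\<Sum>a<N. cnj (v (a * N + a)) * s / of_nat N)"
      by (rule sum.cong[OF refl]) simp
    also have "\<dots> = (cnj s * s) / of_nat N"
      by (simp add: s_def sum_distrib_right sum_divide_distrib)
    also have "cnj s * s = of_real ((cmod s)\<^sup>2)" by (metis complex_norm_square mult.commute)
    finally show ?thesis by (simp add: Re_divide_of_nat)
  qed
  moreover have "hermitian (N * N) (max_ent N)"
    by (rule hermitianI) (auto simp: max_ent_def)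
  ultimately show ?thesis by (simp add: psd_iff_sform)
qed

text \<open>A permutation of the basis keeps positivity. It is taken to be an involution, as the
  exchange of two equal tensor factors is.\<close>

lemma psd_reindex:
  assumes A: "psd N A" and B: "B \<in> carrier_mat N N" and f: "\<And>i. i < N \<Longrightarrow> f i < N \<and> f (f i) = i"
    and eq: "\<And>i j. i < N \<Longrightarrow> j < N \<Longrightarrow> B $$ (i, j) = A $$ (f i, f j)"
  shows "psd N B"
proof -
  have re: "(\<Sum>i<N. g i) = (\<Sum>i<N. g (f i))" for g :: "nat \<Rightarrow> complex"
    by (rule sum.reindex_bij_witness[of _ f f]) (use f in auto)
  have "sform N B v v = sform N A (\<lambda>i. v (f i)) (\<lambda>i. v (f i))" for v
  proof -
    have "sform N B v v = (\<Sum>i<N. \<Sum>j<N. cnj (v (f i)) * B $$ (f i, f j) * v (f j))"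
      unfolding sform_def by (subst re, rule sum.cong[OF refl], rule re)
    also have "\<dots> = sform N A (\<lambda>i. v (f i)) (\<lambda>i. v (f i))"
      unfolding sform_def by (intro sum.cong refl) (use f in \<open>simp add: eq\<close>)
    finally show ?thesis .
  qed
  moreover have "hermitian N B"
    using f by (intro hermitianI[OF B]) (simp add: eq hermitian_index[OF psd_hermitian[OF A]])
  ultimately show ?thesis using psd_sform_nonneg[OF A] by (simp add: psd_iff_sform)
qed

text \<open>Complete positivity is formulated with the ancilla on the right, whereas the Choi state
  has the reference on the left. The maximally entangled state is symmetric under exchange of the
  factors, so the two outputs differ only by that permutation \<open>f\<close> of indices.\<close>

lemma density_choi:
  assumes L: "is_channel N \<Lambda>" and N: "N > 0"
  shows "density (N * N) (choi N \<Lambda>)"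
proof -
  define f where "f i = (i mod N) * N + i div N" for i
  have f: "f i < N * N \<and> f (f i) = i" if "i < N * N" for i
    using div_mod_bounds[OF that] by (simp add: f_def times_add_less)
  have "psd (N * N) (choi N \<Lambda>)"
  proof (rule psd_reindex[OF channel_tensor_psd[OF L N psd_max_ent[OF N]] choi_carrier f])
    fix i j assume ij: "i < N * N" "j < N * N"
    note b = div_mod_bounds[OF ij(1)] div_mod_bounds[OF ij(2)]
    have "mat N N (\<lambda>(a, b). max_ent N $$ ((i div N) * N + a, (j div N) * N + b))
      = mat N N (\<lambda>(a, b). max_ent N $$ (a * N + i div N, b * N + j div N))"
      by (rule eq_matI) (use b in \<open>auto simp: max_ent_def times_add_less\<close>)
    thus "choi N \<Lambda> $$ (i, j) = tensor_id N N \<Lambda> (max_ent N) $$ (f i, f j)"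
      using ij b f by (simp add: choi_def id_tensor_def tensor_id_index) (simp add: f_def)
  qed
  moreover have "mtrace (choi N \<Lambda>) = 1"
  proof -
    have "(\<Sum>r<N. \<Lambda> (mat_unit N a a) $$ (r, r)) = 1" if "a < N" for a
    proof -
      have "(\<Sum>r<N. \<Lambda> (mat_unit N a a) $$ (r, r)) = mtrace (mat_unit N a a)"
        using channel_trace[OF L mat_unit_carrier] mtrace_sum[OF channel_carrier[OF L mat_unit_carrier]] by metis
      thus ?thesis using that by (simp add: mtrace_sum[OF mat_unit_carrier]) (simp add: mat_unit_def)
    qed
    moreover have "mtrace (choi N \<Lambda>) = (\<Sum>a<N. \<Sum>r<N. \<Lambda> (mat_unit N a a) $$ (r, r) / of_nat N)"
      unfolding mtrace_sum[OF choi_carrier] sum_lessThan_times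
      by (intro sum.cong refl) (simp add: choi_index[OF L] times_add_less)
    ultimately show ?thesis using N by (simp add: sum_divide_distrib[symmetric])
  qed
  ultimately show ?thesis by (simp add: density_def)
qed

lemma conj_mat_unit_index:
  assumes V: "V \<in> carrier_mat N N" and "a < N" "b < N" "i < N" "j < N"
  shows "(V * mat_unit N a b * adj V) $$ (i, j) = V $$ (i, a) * cnj (V $$ (j, b))"
proof -
  have "(V * mat_unit N a b * adj V) $$ (i, j) =
    (\<Sum>k<N. \<Sum>l<N. if l = b then (if k = a then V $$ (i, a) * cnj (V $$ (j, b)) else 0) else 0)"
    unfolding conj_mat_index[OF V mat_unit_carrier assms(4,5)]
    by (intro sum.cong refl) (auto simp: mat_unit_def)
  thus ?thesis using assms by simp
qed

text \<open>\<open>W\<close> is the transpose of \<open>V\<close> tensored with \<open>U\<close>. On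
  the maximally entangled vector the transpose of \<open>V\<close> on the reference equals
  \<open>V\<close> on the input, so the conjugated Choi state belongs to the map
  \<open>X \<mapsto> U * \<Lambda> (V * X * adj V) * adj U\<close>.\<close>

lemma choi_conj:
  assumes L: "is_channel N \<Lambda>" and U: "U \<in> carrier_mat N N" and V: "V \<in> carrier_mat N N"
    and W: "W \<in> carrier_mat (N * N) (N * N)"
    and WUV: "\<And>i j. i < N * N \<Longrightarrow> j < N * N \<Longrightarrow> W $$ (i, j) = V $$ (j div N, i div N) * U $$ (i mod N, j mod N)"
    and ij: "i < N * N" "j < N * N"
  shows "(W * choi N \<Lambda> * adj W) $$ (i, j) =
    (U * \<Lambda> (V * mat_unit N (i div N) (j div N) * adj V) * adj U) $$ (i mod N, j mod N) / of_nat N"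
proof -
  note b = div_mod_bounds[OF ij(1)] div_mod_bounds[OF ij(2)]
  let ?E = "V * mat_unit N (i div N) (j div N) * adj V"
  have Ec: "?E \<in> carrier_mat N N" using V by auto
  let ?g = "\<lambda>a r c s. V $$ (a, i div N) * cnj (V $$ (c, j div N)) *
      (U $$ (i mod N, r) * \<Lambda> (mat_unit N a c) $$ (r, s) * cnj (U $$ (j mod N, s))) / of_nat N"
  have "(W * choi N \<Lambda> * adj W) $$ (i, j) = (\<Sum>a<N. \<Sum>r<N. \<Sum>c<N. \<Sum>s<N. ?g a r c s)"
    unfolding conj_mat_index[OF W choi_carrier ij] sum_lessThan_times
    by (intro sum.cong refl) (use ij in \<open>simp add: WUV choi_index[OF L] times_add_less\<close>)
  also have "\<dots> = (\<Sum>a<N. \<Sum>c<N. \<Sum>r<N. \<Sum>s<N. ?g a r c s)"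
    by (rule sum.cong[OF refl], rule sum.swap)
  also have "\<dots> = (\<Sum>a<N. \<Sum>r<N. \<Sum>s<N. \<Sum>c<N. ?g a r c s)"
    by (rule sum.cong[OF refl], subst sum.swap, rule sum.cong[OF refl], rule sum.swap)
  also have "\<dots> = (\<Sum>r<N. \<Sum>s<N. \<Sum>a<N. \<Sum>c<N. ?g a r c s)"
    by (subst sum.swap, rule sum.cong[OF refl], rule sum.swap)
  also have "\<dots> = (\<Sum>r<N. \<Sum>s<N. U $$ (i mod N, r) * \<Lambda> ?E $$ (r, s) * cnj (U $$ (j mod N, s)) / of_nat N)"
  proof (intro sum.cong refl)
    fix r s assume "r \<in> {..<N}" "s \<in> {..<N}"
    hence rs: "r < N" "s < N" by auto
    have "\<Lambda> ?E $$ (r, s) = (\<Sum>a<N. \<Sum>c<N. V $$ (a, i div N) * cnj (V $$ (c, j div N)) * \<Lambda> (mat_unit N a c) $$ (r, s))"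
      unfolding channel_expand[OF L Ec rs]
      by (intro sum.cong refl) (use b in \<open>simp add: conj_mat_unit_index[OF V]\<close>)
    thus "(\<Sum>a<N. \<Sum>c<N. ?g a r c s) = U $$ (i mod N, r) * \<Lambda> ?E $$ (r, s) * cnj (U $$ (j mod N, s)) / of_nat N"
      by (simp add: sum_distrib_left sum_distrib_right sum_divide_distrib mult_ac)
  qed
  also have "\<dots> = (U * \<Lambda> ?E * adj U) $$ (i mod N, j mod N) / of_nat N"
    unfolding conj_mat_index[OF U channel_carrier[OF L Ec] b(2,4)] by (simp add: sum_divide_distrib)
  finally show ?thesis .
qed

lemma choi_unitary_mixture:
  assumes L: "is_channel N \<Lambda>" and mu: "\<And>y. y \<in> I \<Longrightarrow> 0 \<le> \<mu> y" "sum \<mu> I = 1"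
    and U: "\<And>y. y \<in> I \<Longrightarrow> unitary N (U y)" and V: "\<And>y. y \<in> I \<Longrightarrow> unitary N (V y)"
    and W: "\<And>y. y \<in> I \<Longrightarrow> W y \<in> carrier_mat (N * N) (N * N)"
    and WUV: "\<And>y i j. y \<in> I \<Longrightarrow> i < N * N \<Longrightarrow> j < N * N \<Longrightarrow>
      W y $$ (i, j) = V y $$ (j div N, i div N) * U y $$ (i mod N, j mod N)"
  shows "choi N (unitary_mixture N I \<mu> U V \<Lambda>) = mixture (N * N) I \<mu> (\<lambda>y. W y * choi N \<Lambda> * adj (W y))"
proof (rule eq_matI)
  fix i j assume "i < dim_row (mixture (N * N) I \<mu> (\<lambda>y. W y * choi N \<Lambda> * adj (W y)))"
    "j < dim_col (mixture (N * N) I \<mu> (\<lambda>y. W y * choi N \<Lambda> * adj (W y)))"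
  hence ij: "i < N * N" "j < N * N" by (auto simp: mixture_def)
  note b = div_mod_bounds[OF ij(1)] div_mod_bounds[OF ij(2)]
  have "mixture (N * N) I \<mu> (\<lambda>y. W y * choi N \<Lambda> * adj (W y)) $$ (i, j) =
    (\<Sum>y\<in>I. of_real (\<mu> y) * ((U y * \<Lambda> (V y * mat_unit N (i div N) (j div N) * adj (V y)) * adj (U y)) $$ (i mod N, j mod N) / of_nat N))"
    unfolding mixture_index[OF ij]
    by (intro sum.cong refl) (simp add: choi_conj[OF L unitary_carrier[OF U] unitary_carrier[OF V] W WUV ij])
  also have "\<dots> = unitary_mixture N I \<mu> U V \<Lambda> (mat_unit N (i div N) (j div N)) $$ (i mod N, j mod N) / of_nat N"
    using b by (simp add: unitary_mixture_def mixture_index sum_divide_distrib)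
  also have "\<dots> = choi N (unitary_mixture N I \<mu> U V \<Lambda>) $$ (i, j)"
    by (rule choi_index[OF is_channel_unitary_mixture[OF L mu U V] ij, symmetric])
  finally show "choi N (unitary_mixture N I \<mu> U V \<Lambda>) $$ (i, j)
    = mixture (N * N) I \<mu> (\<lambda>y. W y * choi N \<Lambda> * adj (W y)) $$ (i, j)" ..
qed (auto simp: mixture_def choi_def id_tensor_def)

section \<open>Weyl operators on the doubled system\<close>

lemma digit_div:
  assumes "k < n"
  shows "digit d (2 * n) k i = digit d n k (i div d ^ n)"
proof -
  have "2 * n - 1 - k = n + (n - 1 - k)" using assms by simp
  hence "d ^ (2 * n - 1 - k) = d ^ n * d ^ (n - 1 - k)" by (simp only: power_add)
  thus ?thesis by (simp add: digit_def div_mult2_eq)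
qed

lemma digit_mod:
  assumes "k < n" "0 < d"
  shows "digit d (2 * n) (n + k) i = digit d n k (i mod d ^ n)"
proof -
  define e where "e = n - 1 - k"
  have n: "n = e + Suc k" using assms by (simp add: e_def)
  have "i mod d ^ n = d ^ e * (i div d ^ e mod d ^ Suc k) + i mod d ^ e"
    unfolding n power_add by (rule mod_mult2_eq)
  hence "i mod d ^ n div d ^ e = i div d ^ e mod d ^ Suc k" using assms(2) by simp
  hence "i mod d ^ n div d ^ e mod d = i div d ^ e mod d" by (simp add: mod_mod_cancel)
  moreover have "2 * n - 1 - (n + k) = e" using assms by (simp add: e_def)
  ultimately show ?thesis by (simp add: digit_def e_def)
qed

text \<open>The leftmost \<open>n\<close> qudits make up the quotient part of the index and the
  others the remainder, which matches the Choi state with its reference placed first.\<close>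

lemma weyl_double_index:
  assumes d: "0 < d" and ij: "i < d ^ n * d ^ n" "j < d ^ n * d ^ n"
  shows "weyl d (2 * n) p q $$ (i, j) = weyl d n p q $$ (i div d ^ n, j div d ^ n) *
    weyl d n (\<lambda>k. p (n + k)) (\<lambda>k. q (n + k)) $$ (i mod d ^ n, j mod d ^ n)"
proof -
  let ?w = "\<lambda>k. weyl1 d (p k) (q k) $$ (digit d (2 * n) k i, digit d (2 * n) k j)"
  have N: "d ^ (2 * n) = d ^ n * d ^ n" by (simp add: mult_2 power_add)
  have "(\<Prod>k<2 * n. ?w k) = (\<Prod>k<n. ?w k) * (\<Prod>k<n. ?w (n + k))"
  proof -
    have "(\<Prod>k\<in>{0..<n + n}. ?w k) = (\<Prod>k\<in>{0..<n}. ?w k) * (\<Prod>k\<in>{n..<n + n}. ?w k)"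
      by (rule prod.atLeastLessThan_concat[symmetric]) auto
    also have "(\<Prod>k\<in>{n..<n + n}. ?w k) = (\<Prod>k\<in>{0..<n}. ?w (n + k))"
      by (subst prod.atLeastLessThan_shift_0) simp
    finally show ?thesis by (simp add: mult_2 atLeast0LessThan)
  qed
  thus ?thesis
    using ij div_mod_bounds[OF ij(1)] div_mod_bounds[OF ij(2)]
    by (simp add: weyl_def N digit_div digit_mod d)
qed

lemma unitary_transpose:
  assumes "unitary N U"
  shows "unitary N (transpose_mat U)"
proof (rule unitaryI_columns)
  have U: "U \<in> carrier_mat N N" using assms by (rule unitary_carrier)
  show "transpose_mat U \<in> carrier_mat N N" using U by simp
  fix i j assume ij: "i < N" "j < N"
  have "(\<Sum>k<N. cnj (transpose_mat U $$ (k, i)) * transpose_mat U $$ (k, j)) = (\<Sum>k<N. U $$ (j, k) * cnj (U $$ (i, k)))"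
    by (intro sum.cong refl) (use ij U in auto)
  thus "(\<Sum>k<N. cnj (transpose_mat U $$ (k, i)) * transpose_mat U $$ (k, j)) = (if i = j then 1 else 0)"
    using unitary_rows[OF assms ij(2,1)] by auto
qed

text \<open>A Weyl operator on the doubled system is a tensor product. Its reference half becomes
  the input unitary \<open>V\<close> by transposition and its output half becomes \<open>U\<close>,
  so the Weyl mixture for the mean Choi state is a mixture on the level of channels.\<close>

lemma mean_channel_unitary_mixture:
  assumes d: "0 < d" and L: "is_channel (d ^ n) \<Lambda>"
  shows "\<exists>(I :: ((nat \<Rightarrow> int) \<times> (nat \<Rightarrow> int)) set) \<mu> U V. finite I \<and> (\<forall>y. 0 \<le> \<mu> y) \<and> sum \<mu> I = 1 \<and>
    (\<forall>y. unitary (d ^ n) (U y)) \<and> (\<forall>y. unitary (d ^ n) (V y)) \<and>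
    mean_channel d n \<Lambda> = unitary_mixture (d ^ n) I \<mu> U V \<Lambda>"
proof -
  let ?N = "d ^ n"
  have N: "?N > 0" using d by simp
  have N2: "d ^ (2 * n) = ?N * ?N" by (simp add: mult_2 power_add)
  define I where "I = residue_vectors d (2 * n) \<times> residue_vectors d (2 * n)"
  define W where "W y = weyl d (2 * n) (fst y) (snd y)" for y
  define V where "V y = transpose_mat (weyl d n (fst y) (snd y))" for y
  define U where "U y = weyl d n (\<lambda>k. fst y (n + k)) (\<lambda>k. snd y (n + k))" for y
  obtain \<mu> where \<mu>: "\<And>y. 0 \<le> \<mu> y" "sum \<mu> I = 1"
    and mean: "mean_state d (2 * n) (choi ?N \<Lambda>) = mixture (?N * ?N) I \<mu> (\<lambda>y. W y * choi ?N \<Lambda> * adj (W y))"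
    using mean_state_weyl_mixture[OF d, of "2 * n" "choi ?N \<Lambda>"] density_choi[OF L N]
    unfolding N2 I_def[symmetric] W_def case_prod_unfold by blast
  have U: "unitary ?N (U y)" for y unfolding U_def by (rule unitary_weyl[OF d])
  have V: "unitary ?N (V y)" for y unfolding V_def by (rule unitary_transpose[OF unitary_weyl[OF d]])
  define \<Lambda>' where "\<Lambda>' = unitary_mixture ?N I \<mu> U V \<Lambda>"
  have L': "is_channel ?N \<Lambda>'" unfolding \<Lambda>'_def by (rule is_channel_unitary_mixture[OF L \<mu> U V])
  have choi': "choi ?N \<Lambda>' = mean_state d (2 * n) (choi ?N \<Lambda>)"
    unfolding \<Lambda>'_def mean
  proof (rule choi_unitary_mixture[OF L \<mu> U V])
    show "W y \<in> carrier_mat (?N * ?N) (?N * ?N)" for y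
      using weyl_carrier[of d "2 * n"] unfolding W_def N2 .
    fix y i j assume ij: "i < ?N * ?N" "j < ?N * ?N"
    show "W y $$ (i, j) = V y $$ (j div ?N, i div ?N) * U y $$ (i mod ?N, j mod ?N)"
      using div_mod_bounds[OF ij(1)] div_mod_bounds[OF ij(2)] carrier_matD[OF weyl_carrier[of d n "fst y" "snd y"]]
      by (simp add: W_def V_def U_def weyl_double_index[OF d ij])
  qed
  \<comment> \<open>Channels with this Choi state agree on \<open>N x N\<close> matrices by
    \<open>choi_inject\<close> and elsewhere by the prescribed value zero, so the description picks
    out \<open>\<Lambda>'\<close>.\<close>
  have "mean_channel d n \<Lambda> = \<Lambda>'"
    unfolding mean_channel_def
  proof (rule the_equality)
    show "is_channel ?N \<Lambda>' \<and> (\<forall>X. X \<notin> carrier_mat ?N ?N \<longrightarrow> \<Lambda>' X = 0\<^sub>m ?N ?N) \<and>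
      choi ?N \<Lambda>' = mean_state d (2 * n) (choi ?N \<Lambda>)"
      using L' choi' by (simp add: \<Lambda>'_def unitary_mixture_def)
    fix \<Phi> assume \<Phi>: "is_channel ?N \<Phi> \<and> (\<forall>X. X \<notin> carrier_mat ?N ?N \<longrightarrow> \<Phi> X = 0\<^sub>m ?N ?N) \<and>
      choi ?N \<Phi> = mean_state d (2 * n) (choi ?N \<Lambda>)"
    show "\<Phi> = \<Lambda>'"
    proof
      fix X
      show "\<Phi> X = \<Lambda>' X"
      proof (cases "X \<in> carrier_mat ?N ?N")
        case True
        thus ?thesis using \<Phi> choi' by (intro choi_inject[OF _ L']) auto
      next
        case False
        thus ?thesis using \<Phi> by (simp add: \<Lambda>'_def unitary_mixture_def)
      qed
    qed
  qed
  thus ?thesis unfolding \<Lambda>'_def using \<mu> U V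
    by (intro exI[of _ I] exI[of _ \<mu>] exI[of _ U] exI[of _ V]) (auto simp: I_def)
qed

theorem mainTheorem19:
  fixes d n :: nat and \<alpha> :: ereal and \<Lambda> :: "complex mat \<Rightarrow> complex mat"
  assumes "prime d" and "d \<ge> 7" and "n \<ge> 1"
    and "ereal (1 / 2) \<le> \<alpha>"
    and "is_channel (d ^ n) \<Lambda>"
  shows "chan_renyi_entropy d n \<alpha> (mean_channel d n \<Lambda>) \<ge> chan_renyi_entropy d n \<alpha> \<Lambda>"
proof -
  have d: "0 < d" using assms(2) by simp
  obtain I :: "((nat \<Rightarrow> int) \<times> (nat \<Rightarrow> int)) set" and \<mu> U V
    where "finite I" "\<And>y. 0 \<le> \<mu> y" "sum \<mu> I = 1"
      "\<And>y. unitary (d ^ n) (U y)" "\<And>y. unitary (d ^ n) (V y)"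
    and mean: "mean_channel d n \<Lambda> = unitary_mixture (d ^ n) I \<mu> U V \<Lambda>"
    using mean_channel_unitary_mixture[OF d assms(5)] by blast
  hence "chan_renyi_div d n \<alpha> (mean_channel d n \<Lambda>) \<le> chan_renyi_div d n \<alpha> \<Lambda>"
    unfolding mean by (intro chan_renyi_div_unitary_mixture_le[OF assms(5) d assms(4)])
  thus ?thesis unfolding chan_renyi_entropy_def by (intro ereal_minus_mono) auto
qed

end
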